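(* Let $\mathfrak g$ be a simple complex Lie algebra of type $G_2$, $F_4$, $E_6$, $E_7$ or $E_8$, and let $\delta=\dim_{\mathbb C}\mathfrak g$. Then the functor $\Phi\colon\mathcal T_\delta\to\mathfrak g\text{-mod}$ factors through the quotient $\mathcal{EL}_\delta$ of $\mathcal T_\delta$.
   Context: The ground field is $\mathbb C$ and all categories and functors are $\mathbb C$-linear. $\mathfrak g\text{-mod}$ is the category of finite-dimensional representations of $\mathfrak g$; $\mathfrak g$ also denotes the adjoint representation. $\mathcal T_\delta$ is the strict $\mathbb C$-linear monoidal category (unit object $\mathbf 1$) generated by one object $X$ and morphisms $$m\colon X\otimes X\to X,\quad s\colon X\otimes X\to X\otimes X,\quad \eta\colon\mathbf 1\to X\otimes X,\quad \varepsilon\colon X\otimes X\to\mathbf 1,$$ subject to the following relations (writing $1$ for $\mathrm{id}_X$ and composing right to left): (i) $(\varepsilon\otimes1)(1\otimes\eta)=1=(1\otimes\varepsilon)(\eta\otimes1)$; (ii) $\sigma:=(1\otimes m)(\eta\otimes 1)=(m\otimes1)(1\otimes\eta)\colon X\to X\otimes X$; (iii) $(1\otimes\varepsilon)(s\otimes1)=(\varepsilon\otimes1)(1\otimes s)$; (iv) $s\circ s=1\otimes1$ and $(s\otimes1)(1\otimes s)(s\otimes1)=(1\otimes s)(s\otimes1)(1\otimes s)$; (v) $(1\otimes m)(s\otimes1)(1\otimes s)=s(m\otimes1)$ and $(1\otimes s)(s\otimes1)(1\otimes\sigma)=(\sigma\otimes1)s$; (vi) $\varepsilon s=\varepsilon$,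 $\; m s=-m$, $\; m\sigma=1$, $\;\varepsilon\eta=\delta\,\mathrm{id}_{\mathbf 1}$. $\Phi\colon\mathcal T_\delta\to\mathfrak g\text{-mod}$ is the monoidal functor with $\Phi(X)=\mathfrak g$, $\Phi(m)(a\otimes b)=[a,b]$, $\Phi(s)(a\otimes b)=b\otimes a$, $\Phi(\varepsilon)(a\otimes b)=\kappa(a,b)$ (Killing form), and $\Phi(\eta)(1)=\sum_{b\in B}b\otimes b^\vee$, where $B$ is a basis of $\mathfrak g$ and $\{b^\vee\}$ is the dual basis with respect to $\kappa$. Put $K:=\sigma m$, $H:=(m\otimes1)(1\otimes\sigma)=(1\otimes m)(\sigma\otimes1)$, $D:=(m\otimes1)(1\otimes s)(\sigma\otimes1)$, $\tau:=(1\otimes\sigma)\eta=(\sigma\otimes1)\eta\colon\mathbf 1\to X^{\otimes3}$, and $T:=(1\otimes m\otimes1)(\sigma\otimes\sigma)\colon X^{\otimes2}\to X^{\otimes3}$. The category $\mathcal{EL}_\delta$ is the quotient of $\mathcal T_\delta$ by the tensor ideal generated by the three relations $$D=K-H,$$ $$H\circ H=\tfrac16(H+K)+\tfrac{5}{6(\delta+2)}\left(1_{X\otimes X}+\eta\varepsilon+s\right),$$ $$T\circ H=\tfrac1{12}\left(T+(\sigma\otimes1)\sigma m+(1\otimes\sigma)\sigma m+T s\right)+\tfrac{5}{12(\delta+2)}\,S,$$ where $$S=\tau\varepsilon+1\otimes\sigma+\sigma\otimes1+\eta\otimes m+m\otimes\eta+(s\otimes1)(m\otimes\eta)+(1\otimes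 s)(\sigma\otimes1)+(s\otimes1)(1\otimes\sigma)+(\sigma\otimes1)s+(1\otimes\sigma)s.$$ "Factors through $\mathcal{EL}_\delta$" means that $\Phi$ is the composite of the quotient functor $\mathcal T_\delta\to\mathcal{EL}_\delta$ with a functor $\mathcal{EL}_\delta\to\mathfrak g\text{-mod}$. *)

theory Defs
  imports Complex_Main "HOL-Library.FuncSet" "HOL-Library.Function_Algebras"
begin

section \<open>Linear monoidal categories, quotients and tensor ideals\<close>

text \<open>
  Data of a (strict) complex-linear monoidal category. The operations on morphisms are only
  meaningful on suitably composable or parallel arguments taken from the hom-spaces.
\<close>

record ('o, 'm) lmcat =
  obj :: "'o set"
  hom :: "'o \<Rightarrow> 'o \<Rightarrow> 'm set"
  idm :: "'o \<Rightarrow> 'm"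
  cmp :: "'m \<Rightarrow> 'm \<Rightarrow> 'm"
  zer :: "'o \<Rightarrow> 'o \<Rightarrow> 'm"
  add :: "'m \<Rightarrow> 'm \<Rightarrow> 'm"
  scl :: "complex \<Rightarrow> 'm \<Rightarrow> 'm"
  uni :: "'o"
  tob :: "'o \<Rightarrow> 'o \<Rightarrow> 'o"
  tmo :: "'m \<Rightarrow> 'm \<Rightarrow> 'm"

definition linear_functor ::
    "('o, 'm) lmcat \<Rightarrow> ('p, 'n) lmcat \<Rightarrow> ('o \<Rightarrow> 'p) \<Rightarrow> ('m \<Rightarrow> 'n) \<Rightarrow> bool" where
  "linear_functor C D Fo Fm \<longleftrightarrow>
     (\<forall>A\<in>obj C. Fo A \<in> obj D \<and> Fm (idm C A) = idm D (Fo A)) \<and>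
     (\<forall>A\<in>obj C. \<forall>B\<in>obj C. \<forall>f\<in>hom C A B.
        Fm f \<in> hom D (Fo A) (Fo B) \<and>
        (\<forall>c. Fm (scl C c f) = scl D c (Fm f)) \<and>
        (\<forall>g\<in>hom C A B. Fm (add C f g) = add D (Fm f) (Fm g)) \<and>
        (\<forall>E\<in>obj C. \<forall>g\<in>hom C B E. Fm (cmp C g f) = cmp D (Fm g) (Fm f)))"

definition cls :: "('m \<Rightarrow> 'm \<Rightarrow> bool) \<Rightarrow> 'm \<Rightarrow> 'm set" where
  "cls R f = {g. R f g}"

text \<open>
  The quotient by a congruence \<open>R\<close> on morphisms. The union in each operation is over all
  representatives; for a congruence every set in the union is the same class.
\<close>

definition quot :: "('o, 'm) lmcat \<Rightarrow> ('m \<Rightarrow> 'm \<Rightarrow> bool) \<Rightarrow> ('o, 'm set) lmcat" where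
  "quot C R =
     \<lparr>obj = obj C,
      hom = (\<lambda>A B. cls R ` hom C A B),
      idm = (\<lambda>A. cls R (idm C A)),
      cmp = (\<lambda>P Q. \<Union>p\<in>P. \<Union>q\<in>Q. cls R (cmp C p q)),
      zer = (\<lambda>A B. cls R (zer C A B)),
      add = (\<lambda>P Q. \<Union>p\<in>P. \<Union>q\<in>Q. cls R (add C p q)),
      scl = (\<lambda>c P. \<Union>p\<in>P. cls R (scl C c p)),
      uni = uni C,
      tob = tob C,
      tmo = (\<lambda>P Q. \<Union>p\<in>P. \<Union>q\<in>Q. cls R (tmo C p q))\<rparr>"

definition factors_through ::
    "('o, 'm) lmcat \<Rightarrow> ('q, 'l) lmcat \<Rightarrow> ('p, 'n) lmcat \<Rightarrow> ('o \<Rightarrow> 'q) \<Rightarrow> ('m \<Rightarrow> 'l) \<Rightarrow>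
     ('o \<Rightarrow> 'p) \<Rightarrow> ('m \<Rightarrow> 'n) \<Rightarrow> bool" where
  "factors_through C E D Qo Qm Fo Fm \<longleftrightarrow>
     (\<exists>Go Gm. linear_functor E D Go Gm \<and>
        (\<forall>A\<in>obj C. Fo A = Go (Qo A)) \<and>
        (\<forall>A\<in>obj C. \<forall>B\<in>obj C. \<forall>f\<in>hom C A B. Fm f = Gm (Qm f)))"

inductive tensor_ideal :: "('o, 'm) lmcat \<Rightarrow> 'm set \<Rightarrow> 'o \<Rightarrow> 'o \<Rightarrow> 'm \<Rightarrow> bool"
  for C :: "('o, 'm) lmcat" and G :: "'m set" where
  gen: "A \<in> obj C \<Longrightarrow> B \<in> obj C \<Longrightarrow> f \<in> hom C A B \<Longrightarrow> f \<in> G \<Longrightarrow> tensor_ideal C G A B f"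
| zero: "A \<in> obj C \<Longrightarrow> B \<in> obj C \<Longrightarrow> tensor_ideal C G A B (zer C A B)"
| add: "tensor_ideal C G A B f \<Longrightarrow> tensor_ideal C G A B g \<Longrightarrow> tensor_ideal C G A B (add C f g)"
| scl: "tensor_ideal C G A B f \<Longrightarrow> tensor_ideal C G A B (scl C c f)"
| comp_left: "tensor_ideal C G A B f \<Longrightarrow> E \<in> obj C \<Longrightarrow> g \<in> hom C B E \<Longrightarrow>
    tensor_ideal C G A E (cmp C g f)"
| comp_right: "tensor_ideal C G A B f \<Longrightarrow> E \<in> obj C \<Longrightarrow> g \<in> hom C E A \<Longrightarrow>
    tensor_ideal C G E B (cmp C f g)"
| tens_left: "tensor_ideal C G A B f \<Longrightarrow> E \<in> obj C \<Longrightarrow> F \<in> obj C \<Longrightarrow> g \<in> hom C E F \<Longrightarrow>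
    tensor_ideal C G (tob C E A) (tob C F B) (tmo C g f)"
| tens_right: "tensor_ideal C G A B f \<Longrightarrow> E \<in> obj C \<Longrightarrow> F \<in> obj C \<Longrightarrow> g \<in> hom C E F \<Longrightarrow>
    tensor_ideal C G (tob C A E) (tob C B F) (tmo C f g)"

definition diff :: "('o, 'm) lmcat \<Rightarrow> 'm \<Rightarrow> 'm \<Rightarrow> 'm" where
  "diff C f g = add C f (scl C (-1) g)"

definition ideal_cong ::
    "('o, 'm) lmcat \<Rightarrow> ('o \<Rightarrow> 'o \<Rightarrow> 'm \<Rightarrow> bool) \<Rightarrow> 'm \<Rightarrow> 'm \<Rightarrow> bool" where
  "ideal_cong C J f g \<longleftrightarrow>
     (\<exists>A\<in>obj C. \<exists>B\<in>obj C. f \<in> hom C A B \<and> g \<in> hom C A B \<and> J A B (diff C f g))"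


section \<open>The category presented by generators and relations\<close>

text \<open>
  The object \<open>n\<close> stands for the \<open>n\<close>-fold tensor power of the generating object. Morphisms are
  formal expressions; composition is written right to left.
\<close>

datatype tm =
    Id nat
  | GM | GS | GEta | GEps
  | Zero nat nat
  | Add tm tm (infixl "\<boxplus>" 65)
  | Scal complex tm (infixr "\<odot>" 75)
  | Comp tm tm (infixr "\<cdot>" 70)
  | Tens tm tm (infixr "\<boxtimes>" 73)

primrec src :: "tm \<Rightarrow> nat" where
  "src (Id n) = n"
| "src GM = 2" | "src GS = 2" | "src GEta = 0" | "src GEps = 2"
| "src (Zero m n) = m"
| "src (a \<boxplus> b) = src a"
| "src (c \<odot> a) = src a"
| "src (b \<cdot> a) = src a"
| "src (a \<boxtimes> b) = src a + src b"

primrec tgt :: "tm \<Rightarrow> nat" where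
  "tgt (Id n) = n"
| "tgt GM = 1" | "tgt GS = 2" | "tgt GEta = 2" | "tgt GEps = 0"
| "tgt (Zero m n) = n"
| "tgt (a \<boxplus> b) = tgt a"
| "tgt (c \<odot> a) = tgt a"
| "tgt (b \<cdot> a) = tgt b"
| "tgt (a \<boxtimes> b) = tgt a + tgt b"

primrec wf_tm :: "tm \<Rightarrow> bool" where
  "wf_tm (Id n) = True"
| "wf_tm GM = True" | "wf_tm GS = True" | "wf_tm GEta = True" | "wf_tm GEps = True"
| "wf_tm (Zero m n) = True"
| "wf_tm (a \<boxplus> b) = (wf_tm a \<and> wf_tm b \<and> src a = src b \<and> tgt a = tgt b)"
| "wf_tm (c \<odot> a) = wf_tm a"
| "wf_tm (b \<cdot> a) = (wf_tm b \<and> wf_tm a \<and> src b = tgt a)"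
| "wf_tm (a \<boxtimes> b) = (wf_tm a \<and> wf_tm b)"

definition tms :: "nat \<Rightarrow> nat \<Rightarrow> tm set" where
  "tms m n = {t. wf_tm t \<and> src t = m \<and> tgt t = n}"

definition tm_cat :: "(nat, tm) lmcat" where
  "tm_cat = \<lparr>obj = UNIV, hom = tms, idm = Id, cmp = Comp, zer = Zero, add = Add, scl = Scal,
             uni = 0, tob = (+), tmo = Tens\<rparr>"

text \<open>
  The congruence on expressions generated by a set of relations together with the axioms of a
  strict complex-linear monoidal category.
\<close>

inductive tm_cong :: "(tm \<times> tm) set \<Rightarrow> tm \<Rightarrow> tm \<Rightarrow> bool" for R :: "(tm \<times> tm) set" where
  base: "(a, b) \<in> R \<Longrightarrow> a \<in> tms m n \<Longrightarrow> b \<in> tms m n \<Longrightarrow> tm_cong R a b"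
| refl: "a \<in> tms m n \<Longrightarrow> tm_cong R a a"
| sym: "tm_cong R a b \<Longrightarrow> tm_cong R b a"
| trans: "tm_cong R a b \<Longrightarrow> tm_cong R b c \<Longrightarrow> tm_cong R a c"
| add_cong: "tm_cong R a a' \<Longrightarrow> tm_cong R b b' \<Longrightarrow> src a = src b \<Longrightarrow> tgt a = tgt b \<Longrightarrow>
    tm_cong R (a \<boxplus> b) (a' \<boxplus> b')"
| scal_cong: "tm_cong R a a' \<Longrightarrow> tm_cong R (c \<odot> a) (c \<odot> a')"
| comp_cong: "tm_cong R b b' \<Longrightarrow> tm_cong R a a' \<Longrightarrow> src b = tgt a \<Longrightarrow>
    tm_cong R (b \<cdot> a) (b' \<cdot> a')"
| tens_cong: "tm_cong R a a' \<Longrightarrow> tm_cong R b b' \<Longrightarrow> tm_cong R (a \<boxtimes> b) (a' \<boxtimes> b')"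
| add_assoc: "a \<in> tms m n \<Longrightarrow> b \<in> tms m n \<Longrightarrow> c \<in> tms m n \<Longrightarrow>
    tm_cong R ((a \<boxplus> b) \<boxplus> c) (a \<boxplus> (b \<boxplus> c))"
| add_comm: "a \<in> tms m n \<Longrightarrow> b \<in> tms m n \<Longrightarrow> tm_cong R (a \<boxplus> b) (b \<boxplus> a)"
| add_zero: "a \<in> tms m n \<Longrightarrow> tm_cong R (a \<boxplus> Zero m n) a"
| add_neg: "a \<in> tms m n \<Longrightarrow> tm_cong R (a \<boxplus> (-1) \<odot> a) (Zero m n)"
| scal_scal: "a \<in> tms m n \<Longrightarrow> tm_cong R (c \<odot> d \<odot> a) ((c * d) \<odot> a)"
| scal_one: "a \<in> tms m n \<Longrightarrow> tm_cong R (1 \<odot> a) a"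
| scal_add_left: "a \<in> tms m n \<Longrightarrow> tm_cong R ((c + d) \<odot> a) (c \<odot> a \<boxplus> d \<odot> a)"
| scal_add_right: "a \<in> tms m n \<Longrightarrow> b \<in> tms m n \<Longrightarrow>
    tm_cong R (c \<odot> (a \<boxplus> b)) (c \<odot> a \<boxplus> c \<odot> b)"
| comp_assoc: "a \<in> tms m n \<Longrightarrow> b \<in> tms n p \<Longrightarrow> c \<in> tms p q \<Longrightarrow>
    tm_cong R ((c \<cdot> b) \<cdot> a) (c \<cdot> (b \<cdot> a))"
| id_left: "a \<in> tms m n \<Longrightarrow> tm_cong R (Id n \<cdot> a) a"
| id_right: "a \<in> tms m n \<Longrightarrow> tm_cong R (a \<cdot> Id m) a"
| comp_add_left: "a \<in> tms m n \<Longrightarrow> b \<in> tms n p \<Longrightarrow> b' \<in> tms n p \<Longrightarrow>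
    tm_cong R ((b \<boxplus> b') \<cdot> a) ((b \<cdot> a) \<boxplus> (b' \<cdot> a))"
| comp_add_right: "a \<in> tms m n \<Longrightarrow> a' \<in> tms m n \<Longrightarrow> b \<in> tms n p \<Longrightarrow>
    tm_cong R (b \<cdot> (a \<boxplus> a')) ((b \<cdot> a) \<boxplus> (b \<cdot> a'))"
| comp_scal_left: "a \<in> tms m n \<Longrightarrow> b \<in> tms n p \<Longrightarrow> tm_cong R ((c \<odot> b) \<cdot> a) (c \<odot> (b \<cdot> a))"
| comp_scal_right: "a \<in> tms m n \<Longrightarrow> b \<in> tms n p \<Longrightarrow> tm_cong R (b \<cdot> (c \<odot> a)) (c \<odot> (b \<cdot> a))"
| tens_assoc: "a \<in> tms m n \<Longrightarrow> b \<in> tms p q \<Longrightarrow> c \<in> tms k l \<Longrightarrow>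
    tm_cong R ((a \<boxtimes> b) \<boxtimes> c) (a \<boxtimes> (b \<boxtimes> c))"
| tens_unit_left: "a \<in> tms m n \<Longrightarrow> tm_cong R (Id 0 \<boxtimes> a) a"
| tens_unit_right: "a \<in> tms m n \<Longrightarrow> tm_cong R (a \<boxtimes> Id 0) a"
| tens_id: "tm_cong R (Id m \<boxtimes> Id n) (Id (m + n))"
| interchange: "a \<in> tms m n \<Longrightarrow> b \<in> tms n p \<Longrightarrow> c \<in> tms m' n' \<Longrightarrow> d \<in> tms n' p' \<Longrightarrow>
    tm_cong R ((b \<boxtimes> d) \<cdot> (a \<boxtimes> c)) ((b \<cdot> a) \<boxtimes> (d \<cdot> c))"
| tens_add_left: "a \<in> tms m n \<Longrightarrow> a' \<in> tms m n \<Longrightarrow> b \<in> tms p q \<Longrightarrow>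
    tm_cong R ((a \<boxplus> a') \<boxtimes> b) ((a \<boxtimes> b) \<boxplus> (a' \<boxtimes> b))"
| tens_add_right: "a \<in> tms m n \<Longrightarrow> b \<in> tms p q \<Longrightarrow> b' \<in> tms p q \<Longrightarrow>
    tm_cong R (a \<boxtimes> (b \<boxplus> b')) ((a \<boxtimes> b) \<boxplus> (a \<boxtimes> b'))"
| tens_scal_left: "a \<in> tms m n \<Longrightarrow> b \<in> tms p q \<Longrightarrow>
    tm_cong R ((c \<odot> a) \<boxtimes> b) (c \<odot> (a \<boxtimes> b))"
| tens_scal_right: "a \<in> tms m n \<Longrightarrow> b \<in> tms p q \<Longrightarrow>
    tm_cong R (a \<boxtimes> (c \<odot> b)) (c \<odot> (a \<boxtimes> b))"

abbreviation I1 :: tm where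
  "I1 \<equiv> Id 1"

definition Sigma_tm :: tm where
  "Sigma_tm = (I1 \<boxtimes> GM) \<cdot> (GEta \<boxtimes> I1)"

definition T_rels :: "complex \<Rightarrow> (tm \<times> tm) set" where
  "T_rels \<delta> =
    {((GEps \<boxtimes> I1) \<cdot> (I1 \<boxtimes> GEta), I1),
     ((I1 \<boxtimes> GEps) \<cdot> (GEta \<boxtimes> I1), I1),
     ((I1 \<boxtimes> GM) \<cdot> (GEta \<boxtimes> I1), (GM \<boxtimes> I1) \<cdot> (I1 \<boxtimes> GEta)),
     ((I1 \<boxtimes> GEps) \<cdot> (GS \<boxtimes> I1), (GEps \<boxtimes> I1) \<cdot> (I1 \<boxtimes> GS)),
     (GS \<cdot> GS, I1 \<boxtimes> I1),
     ((GS \<boxtimes> I1) \<cdot> (I1 \<boxtimes> GS) \<cdot> (GS \<boxtimes> I1), (I1 \<boxtimes> GS) \<cdot> (GS \<boxtimes> I1) \<cdot> (I1 \<boxtimes> GS)),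
     ((I1 \<boxtimes> GM) \<cdot> (GS \<boxtimes> I1) \<cdot> (I1 \<boxtimes> GS), GS \<cdot> (GM \<boxtimes> I1)),
     ((I1 \<boxtimes> GS) \<cdot> (GS \<boxtimes> I1) \<cdot> (I1 \<boxtimes> Sigma_tm), (Sigma_tm \<boxtimes> I1) \<cdot> GS),
     (GEps \<cdot> GS, GEps),
     (GM \<cdot> GS, (-1) \<odot> GM),
     (GM \<cdot> Sigma_tm, I1),
     (GEps \<cdot> GEta, \<delta> \<odot> Id 0)}"

definition T_cat :: "complex \<Rightarrow> (nat, tm set) lmcat" where
  "T_cat \<delta> = quot tm_cat (tm_cong (T_rels \<delta>))"

definition K_tm :: tm where
  "K_tm = Sigma_tm \<cdot> GM"

definition H_tm :: tm where
  "H_tm = (GM \<boxtimes> I1) \<cdot> (I1 \<boxtimes> Sigma_tm)"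

definition D_tm :: tm where
  "D_tm = (GM \<boxtimes> I1) \<cdot> (I1 \<boxtimes> GS) \<cdot> (Sigma_tm \<boxtimes> I1)"

definition tau_tm :: tm where
  "tau_tm = (I1 \<boxtimes> Sigma_tm) \<cdot> GEta"

definition T_tm :: tm where
  "T_tm = (I1 \<boxtimes> GM \<boxtimes> I1) \<cdot> (Sigma_tm \<boxtimes> Sigma_tm)"

definition S_tm :: tm where
  "S_tm =
     tau_tm \<cdot> GEps \<boxplus> I1 \<boxtimes> Sigma_tm \<boxplus> Sigma_tm \<boxtimes> I1 \<boxplus> GEta \<boxtimes> GM \<boxplus> GM \<boxtimes> GEta
     \<boxplus> (GS \<boxtimes> I1) \<cdot> (GM \<boxtimes> GEta) \<boxplus> (I1 \<boxtimes> GS) \<cdot> (Sigma_tm \<boxtimes> I1)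
     \<boxplus> (GS \<boxtimes> I1) \<cdot> (I1 \<boxtimes> Sigma_tm) \<boxplus> (Sigma_tm \<boxtimes> I1) \<cdot> GS \<boxplus> (I1 \<boxtimes> Sigma_tm) \<cdot> GS"

definition EL_rels :: "complex \<Rightarrow> (tm \<times> tm) set" where
  "EL_rels \<delta> =
    {(D_tm, K_tm \<boxplus> (-1) \<odot> H_tm),
     (H_tm \<cdot> H_tm,
      (1/6) \<odot> (H_tm \<boxplus> K_tm)
      \<boxplus> (5 / (6 * (\<delta> + 2))) \<odot> (I1 \<boxtimes> I1 \<boxplus> GEta \<cdot> GEps \<boxplus> GS)),
     (T_tm \<cdot> H_tm,
      (1/12) \<odot> (T_tm \<boxplus> (Sigma_tm \<boxtimes> I1) \<cdot> Sigma_tm \<cdot> GM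
                     \<boxplus> (I1 \<boxtimes> Sigma_tm) \<cdot> Sigma_tm \<cdot> GM \<boxplus> T_tm \<cdot> GS)
      \<boxplus> (5 / (12 * (\<delta> + 2))) \<odot> S_tm)}"

definition EL_ideal :: "complex \<Rightarrow> nat \<Rightarrow> nat \<Rightarrow> tm set \<Rightarrow> bool" where
  "EL_ideal \<delta> =
     tensor_ideal (T_cat \<delta>)
       {diff (T_cat \<delta>) (cls (tm_cong (T_rels \<delta>)) l) (cls (tm_cong (T_rels \<delta>)) r) | l r.
          (l, r) \<in> EL_rels \<delta>}"

definition EL_cong :: "complex \<Rightarrow> tm set \<Rightarrow> tm set \<Rightarrow> bool" where
  "EL_cong \<delta> = ideal_cong (T_cat \<delta>) (EL_ideal \<delta>)"

text \<open>The quotient functor is the identity on objects and \<open>cls (EL_cong \<delta>)\<close> on morphisms.\<close>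

definition EL_cat :: "complex \<Rightarrow> (nat, tm set set) lmcat" where
  "EL_cat \<delta> = quot (T_cat \<delta>) (EL_cong \<delta>)"

primrec tpow :: "('o, 'm) lmcat \<Rightarrow> 'o \<Rightarrow> nat \<Rightarrow> 'o" where
  "tpow C X 0 = uni C"
| "tpow C X (Suc n) = tob C X (tpow C X n)"

text \<open>
  Interpretation of expressions in a strict linear monoidal category, given the images of the
  generating object and of the four generating morphisms.
\<close>

primrec eval_tm :: "('o, 'm) lmcat \<Rightarrow> 'o \<Rightarrow> 'm \<Rightarrow> 'm \<Rightarrow> 'm \<Rightarrow> 'm \<Rightarrow> tm \<Rightarrow> 'm" where
  "eval_tm C X m s e k (Id n) = idm C (tpow C X n)"
| "eval_tm C X m s e k GM = m"
| "eval_tm C X m s e k GS = s"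
| "eval_tm C X m s e k GEta = e"
| "eval_tm C X m s e k GEps = k"
| "eval_tm C X m s e k (Zero i j) = zer C (tpow C X i) (tpow C X j)"
| "eval_tm C X m s e k (a \<boxplus> b) = add C (eval_tm C X m s e k a) (eval_tm C X m s e k b)"
| "eval_tm C X m s e k (c \<odot> a) = scl C c (eval_tm C X m s e k a)"
| "eval_tm C X m s e k (b \<cdot> a) = cmp C (eval_tm C X m s e k b) (eval_tm C X m s e k a)"
| "eval_tm C X m s e k (a \<boxtimes> b) = tmo C (eval_tm C X m s e k a) (eval_tm C X m s e k b)"


section \<open>Tensors as functions on words\<close>

type_synonym 'i ten = "'i list \<Rightarrow> complex"

definition ten_scale :: "complex \<Rightarrow> 'i ten \<Rightarrow> 'i ten" where
  "ten_scale c v = (\<lambda>w. c * v w)"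

interpretation ten: vector_space ten_scale
  by unfold_locales (auto simp: ten_scale_def fun_eq_iff algebra_simps)

text \<open>
  If \<open>V\<close> and \<open>W\<close> are spaces of functions on words of length \<open>m\<close> and \<open>n\<close>, the span of all
  \<open>tprod m v w\<close> is a model of their tensor product, consisting of functions on words of length
  \<open>m + n\<close>; in this model the tensor product is strictly associative and unital.
\<close>

definition tprod :: "nat \<Rightarrow> 'i ten \<Rightarrow> 'i ten \<Rightarrow> 'i ten" where
  "tprod m v w = (\<lambda>l. v (take m l) * w (drop m l))"

definition ten_one :: "'i ten" where
  "ten_one = (\<lambda>l. if l = [] then 1 else 0)"

definition lin_on ::
    "(complex \<Rightarrow> 'a \<Rightarrow> 'a) \<Rightarrow> (complex \<Rightarrow> 'b \<Rightarrow> 'b) \<Rightarrow> 'a::ab_group_add set \<Rightarrow>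
     ('a \<Rightarrow> 'b::ab_group_add) \<Rightarrow> bool" where
  "lin_on s1 s2 V f \<longleftrightarrow>
     (\<forall>v\<in>V. \<forall>w\<in>V. f (v + w) = f v + f w) \<and> (\<forall>c. \<forall>v\<in>V. f (s1 c v) = s2 c (f v))"

record ('g, 'i) rep =
  deg :: nat
  car :: "'i ten set"
  act :: "'g \<Rightarrow> 'i ten \<Rightarrow> 'i ten"

datatype ('g, 'i) intw = Intw (isrc: "('g, 'i) rep") (itgt: "('g, 'i) rep") (imap: "'i ten \<Rightarrow> 'i ten")

definition tens_car :: "('g, 'i) rep \<Rightarrow> ('g, 'i) rep \<Rightarrow> 'i ten set" where
  "tens_car V W = ten.span {tprod (deg V) v w | v w. v \<in> car V \<and> w \<in> car W}"

text \<open>The linear map on the tensor product induced by a bilinear map \<open>\<beta>\<close>.\<close>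

definition lift :: "('g, 'i) rep \<Rightarrow> ('g, 'i) rep \<Rightarrow> ('i ten \<Rightarrow> 'i ten \<Rightarrow> 'i ten) \<Rightarrow> 'i ten \<Rightarrow> 'i ten" where
  "lift V W \<beta> =
     (THE h. h \<in> extensional (tens_car V W) \<and> lin_on ten_scale ten_scale (tens_car V W) h \<and>
        (\<forall>v\<in>car V. \<forall>w\<in>car W. h (tprod (deg V) v w) = \<beta> v w))"

definition tens_rep :: "('g, 'i) rep \<Rightarrow> ('g, 'i) rep \<Rightarrow> ('g, 'i) rep" where
  "tens_rep V W =
     \<lparr>deg = deg V + deg W, car = tens_car V W,
      act = (\<lambda>x. lift V W (\<lambda>v w. tprod (deg V) (act V x v) w + tprod (deg V) v (act W x w)))\<rparr>"

definition unit_rep :: "('g, 'i) rep" where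
  "unit_rep = \<lparr>deg = 0, car = ten.span {ten_one}, act = (\<lambda>x. restrict (\<lambda>v. 0) (ten.span {ten_one}))\<rparr>"


section \<open>Complex Lie algebras and their representations\<close>

locale complex_lie_algebra = finite_dimensional_vector_space scale Basis
  for scale :: "complex \<Rightarrow> 'g::ab_group_add \<Rightarrow> 'g" (infixr "*s" 75)
    and Basis :: "'g set" +
  fixes brk :: "'g \<Rightarrow> 'g \<Rightarrow> 'g"
  assumes brk_linear_right: "Vector_Spaces.linear scale scale (\<lambda>y. brk x y)"
    and brk_linear_left: "Vector_Spaces.linear scale scale (\<lambda>x. brk x y)"
    and brk_alt: "brk x x = 0"
    and jacobi: "brk x (brk y z) + brk y (brk z x) + brk z (brk x y) = 0"
begin

definition killing :: "'g \<Rightarrow> 'g \<Rightarrow> complex" where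
  "killing x y = (\<Sum>b\<in>Basis. representation Basis (brk x (brk y b)) b)"

definition simple :: bool where
  "simple \<longleftrightarrow> (\<exists>x y. brk x y \<noteq> 0) \<and>
     (\<forall>J. subspace J \<and> (\<forall>x. \<forall>y\<in>J. brk x y \<in> J) \<longrightarrow> J = {0} \<or> J = UNIV)"

text \<open>For semisimple Lie algebras: a maximal abelian subalgebra acting diagonalizably.\<close>

definition cartan_subalgebra :: "'g set \<Rightarrow> bool" where
  "cartan_subalgebra H \<longleftrightarrow> subspace H \<and>
     (\<forall>x\<in>H. \<forall>y\<in>H. brk x y = 0) \<and>
     (\<forall>x. (\<forall>h\<in>H. brk h x = 0) \<longrightarrow> x \<in> H) \<and>
     (\<forall>h\<in>H. span {x. \<exists>c. brk h x = c *s x} = UNIV)"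

definition root_space :: "'g set \<Rightarrow> ('g \<Rightarrow> complex) \<Rightarrow> 'g set" where
  "root_space H \<alpha> = {x. \<forall>h\<in>H. brk h x = \<alpha> h *s x}"

definition roots :: "'g set \<Rightarrow> ('g \<Rightarrow> complex) set" where
  "roots H = {\<alpha> \<in> extensional H. lin_on scale (*) H \<alpha> \<and> (\<exists>h\<in>H. \<alpha> h \<noteq> 0) \<and>
                root_space H \<alpha> \<noteq> {0}}"

definition root_base :: "'g set \<Rightarrow> nat \<Rightarrow> (nat \<Rightarrow> 'g \<Rightarrow> complex) \<Rightarrow> bool" where
  "root_base H r \<alpha> \<longleftrightarrow>
     (\<forall>i<r. \<alpha> i \<in> roots H) \<and>
     (\<forall>c. (\<forall>h\<in>H. (\<Sum>i<r. c i * \<alpha> i h) = 0) \<longrightarrow> (\<forall>i<r. c i = 0)) \<and>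
     (\<forall>\<beta>\<in>roots H. \<exists>k :: nat \<Rightarrow> int.
        (\<forall>h\<in>H. \<beta> h = (\<Sum>i<r. of_int (k i) * \<alpha> i h)) \<and>
        ((\<forall>i<r. k i \<ge> 0) \<or> (\<forall>i<r. k i \<le> 0)))"

text \<open>
  \<open>t i\<close> is the element of \<open>H\<close> corresponding to \<open>\<alpha> i\<close> under the Killing form, so that
  \<open>killing (t i) (t j)\<close> is the induced form \<open>(\<alpha> i, \<alpha> j)\<close> on the dual of \<open>H\<close>, and \<open>A\<close> is the
  matrix of Cartan integers \<open>2 (\<alpha> i, \<alpha> j) / (\<alpha> j, \<alpha> j)\<close>.
\<close>

definition has_cartan_matrix :: "int list list \<Rightarrow> bool" where
  "has_cartan_matrix A \<longleftrightarrow>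
     (\<exists>H \<alpha> t. cartan_subalgebra H \<and> root_base H (length A) \<alpha> \<and>
        (\<forall>i<length A. t i \<in> H \<and> (\<forall>h\<in>H. killing (t i) h = \<alpha> i h)) \<and>
        (\<forall>i<length A. \<forall>j<length A.
           of_int (A ! i ! j) = 2 * killing (t i) (t j) / killing (t j) (t j)))"

definition is_rep :: "('g, 'i) rep \<Rightarrow> bool" where
  "is_rep V \<longleftrightarrow>
     (\<exists>S. finite S \<and> car V = ten.span S) \<and>
     (\<forall>v\<in>car V. \<forall>l. length l \<noteq> deg V \<longrightarrow> v l = 0) \<and>
     (\<forall>x. act V x \<in> car V \<rightarrow>\<^sub>E car V \<and> lin_on ten_scale ten_scale (car V) (act V x)) \<and>
     (\<forall>v\<in>car V. lin_on scale ten_scale UNIV (\<lambda>x. act V x v)) \<and>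
     (\<forall>x y. \<forall>v\<in>car V. act V (brk x y) v = act V x (act V y v) - act V y (act V x v))"

text \<open>
  A strict monoidal model of the category of finite-dimensional representations: objects are
  representations on finite-dimensional spaces of functions on words of a fixed length over an
  alphabet \<open>'i\<close>, and morphisms are all intertwiners. When \<open>'i\<close> is infinite, every
  finite-dimensional representation is isomorphic to an object (already with words of length 1).
\<close>

definition gmod :: "(('g, 'i) rep, ('g, 'i) intw) lmcat" where
  "gmod =
     \<lparr>obj = {V. is_rep V},
      hom = (\<lambda>V W. {Intw V W f | f. f \<in> car V \<rightarrow>\<^sub>E car W \<and> lin_on ten_scale ten_scale (car V) f \<and>
                      (\<forall>x. \<forall>v\<in>car V. f (act V x v) = act W x (f v))}),
      idm = (\<lambda>V. Intw V V (restrict (\<lambda>v. v) (car V))),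
      cmp = (\<lambda>g f. Intw (isrc f) (itgt g) (compose (car (isrc f)) (imap g) (imap f))),
      zer = (\<lambda>V W. Intw V W (restrict (\<lambda>v. 0) (car V))),
      add = (\<lambda>f g. Intw (isrc f) (itgt f) (restrict (\<lambda>v. imap f v + imap g v) (car (isrc f)))),
      scl = (\<lambda>c f. Intw (isrc f) (itgt f) (restrict (\<lambda>v. ten_scale c (imap f v)) (car (isrc f)))),
      uni = unit_rep,
      tob = tens_rep,
      tmo = (\<lambda>f g. Intw (tens_rep (isrc f) (isrc g)) (tens_rep (itgt f) (itgt g))
                     (lift (isrc f) (isrc g)
                        (\<lambda>v w. tprod (deg (itgt f)) (imap f v) (imap g w))))\<rparr>"

text \<open>
  The Lie algebra is realized as a space of functions on one-letter words by evaluating linear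
  functionals, i.e. by its embedding into the double dual.
\<close>

definition emb :: "'g \<Rightarrow> ('g \<Rightarrow> complex) ten" where
  "emb x = (\<lambda>l. case l of [\<phi>] \<Rightarrow> if Vector_Spaces.linear scale (*) \<phi> then \<phi> x else 0 | _ \<Rightarrow> 0)"

definition unemb :: "('g \<Rightarrow> complex) ten \<Rightarrow> 'g" where
  "unemb = inv emb"

definition adj_rep :: "('g, 'g \<Rightarrow> complex) rep" where
  "adj_rep = \<lparr>deg = 1, car = range emb,
              act = (\<lambda>x. restrict (\<lambda>v. emb (brk x (unemb v))) (range emb))\<rparr>"

definition dual_vec :: "'g \<Rightarrow> 'g" where
  "dual_vec b = (THE d. \<forall>c\<in>Basis. killing c d = (if c = b then 1 else 0))"

definition Phi_m :: "('g, 'g \<Rightarrow> complex) intw" where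
  "Phi_m = Intw (tens_rep adj_rep adj_rep) adj_rep
             (lift adj_rep adj_rep (\<lambda>a b. emb (brk (unemb a) (unemb b))))"

definition Phi_s :: "('g, 'g \<Rightarrow> complex) intw" where
  "Phi_s = Intw (tens_rep adj_rep adj_rep) (tens_rep adj_rep adj_rep)
             (lift adj_rep adj_rep (\<lambda>a b. tprod 1 b a))"

definition Phi_eps :: "('g, 'g \<Rightarrow> complex) intw" where
  "Phi_eps = Intw (tens_rep adj_rep adj_rep) unit_rep
               (lift adj_rep adj_rep (\<lambda>a b. ten_scale (killing (unemb a) (unemb b)) ten_one))"

definition Phi_eta :: "('g, 'g \<Rightarrow> complex) intw" where
  "Phi_eta = Intw unit_rep (tens_rep adj_rep adj_rep)
               (restrict (\<lambda>v. ten_scale (v []) (\<Sum>b\<in>Basis. tprod 1 (emb b) (emb (dual_vec b))))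
                  (car (unit_rep :: ('g, 'g \<Rightarrow> complex) rep)))"

definition Phi_obj :: "nat \<Rightarrow> ('g, 'g \<Rightarrow> complex) rep" where
  "Phi_obj n = tpow gmod adj_rep n"

definition Phi_tm :: "tm \<Rightarrow> ('g, 'g \<Rightarrow> complex) intw" where
  "Phi_tm = eval_tm gmod adj_rep Phi_m Phi_s Phi_eta Phi_eps"

text \<open>All representatives of a morphism class have the same interpretation, which is its image.\<close>

definition Phi_mor :: "tm set \<Rightarrow> ('g, 'g \<Rightarrow> complex) intw" where
  "Phi_mor P = the_elem (Phi_tm ` P)"

end


section \<open>The exceptional types\<close>

datatype exceptional = G2 | F4 | E6 | E7 | E8

text \<open>Bourbaki numbering of the simple roots; in type G2 the first root is short.\<close>

definition cartan_E8 :: "int list list" where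
  "cartan_E8 =
    [[ 2,  0, -1,  0,  0,  0,  0,  0],
     [ 0,  2,  0, -1,  0,  0,  0,  0],
     [-1,  0,  2, -1,  0,  0,  0,  0],
     [ 0, -1, -1,  2, -1,  0,  0,  0],
     [ 0,  0,  0, -1,  2, -1,  0,  0],
     [ 0,  0,  0,  0, -1,  2, -1,  0],
     [ 0,  0,  0,  0,  0, -1,  2, -1],
     [ 0,  0,  0,  0,  0,  0, -1,  2]]"

fun cartan_matrix :: "exceptional \<Rightarrow> int list list" where
  "cartan_matrix G2 = [[2, -1], [-3, 2]]"
| "cartan_matrix F4 =
    [[ 2, -1,  0,  0],
     [-1,  2, -2,  0],
     [ 0, -1,  2, -1],
     [ 0,  0, -1,  2]]"
| "cartan_matrix E6 = map (take 6) (take 6 cartan_E8)"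
| "cartan_matrix E7 = map (take 7) (take 7 cartan_E8)"
| "cartan_matrix E8 = cartan_E8"

end

theory Submission
  imports Defs
begin

text \<open>
  A diagram with \<open>m\<close> inputs and \<open>n\<close> outputs acts on functions: a
  multilinear function \<open>F\<close> of \<open>n\<close> elements of the Lie algebra is
  pulled back to a multilinear function \<open>sem t F\<close> of \<open>m\<close> elements.
  Multilinear functions separate tensors, so an equation between images of diagrams holds as
  soon as both sides pull back every \<open>F\<close> in the same way, and it is enough to
  take for \<open>F\<close> products of functionals \<open>killing p\<close>. In this form the
  relations of the source category and \<open>D = K - H\<close> are the Jacobi identity, the
  invariance and nondegeneracy of the Killing form and the fact that the Casimir operator is
  the identity (\<open>T_rels_sound\<close>, \<open>D_relation\<close>).

  Closing up the diagrams \<open>H \<circ> H\<close> and \<open>T \<circ> H\<close> gives the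
  traces of products of four and of five adjoint operators. Exchanging two neighbours in such
  a product changes the trace by a shorter trace with a bracket as one of its arguments. Hence
  the trace of four is known once its symmetrisation is, and the relation for \<open>H \<circ>
  H\<close> amounts to the quartic identity \<open>sym_tr4 = 5 / (2 * (\<delta> + 2)) *
  sym_killing\<close>, which polarises the formula for the trace of the fourth power of an
  adjoint operator (lemma \<open>box\<close>). The relation for \<open>T \<circ> H\<close> is
  a consequence: four exchanges of neighbours reverse a product of five, and reversal changes
  the sign of the trace because adjoint operators are skew, so twice the trace of five is a
  sum of traces of four (lemma \<open>pentagon\<close>).

  The quartic identity is where the exceptional types enter. Subtract from
  \<open>sym_tr4\<close> the multiple of \<open>sym_killing\<close> that makes the difference
  vanish at a long simple root. The difference is an invariant quartic form. On the Cartan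
  subalgebra it is unchanged by the simple reflections (\<open>mirror_simple_root\<close>),
  and such a form vanishes there (\<open>exceptional_vanish\<close>): its only possible
  nonzero values belong to pairs of orthogonal long roots, all these pairs are conjugate, and
  in a subsystem of type \<open>D\<^sub>4\<close> the values at three such pairs add up to
  zero. For \<open>G\<^sub>2\<close> the long roots form a system \<open>A\<^sub>2\<close>,
  which has no orthogonal pairs. From the Cartan subalgebra the vanishing spreads to the whole
  Lie algebra, one argument at a time, by applying root vectors
  (\<open>vanish_from_H\<close>). The factor \<open>5 / (2 * (\<delta> + 2))\<close> comes
  from contracting two arguments with the Casimir element (\<open>contract_sym_tr4\<close>,
  \<open>contract_sym_killing\<close>).

  To return from functions to representations, \<open>n\<close>-fold tensors are evaluated on
  words of coordinate functionals (\<open>Cn_expand\<close>). This gives the linear maps that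
  define tensor products of morphisms (\<open>lift_Cn\<close>), and it shows that the image of
  a diagram is determined by the pullback \<open>sem\<close> (\<open>Phi_tm_realizes\<close>).
  Diagrams that pull back every function to zero are closed under the operations of a tensor
  ideal (\<open>EL_ideal_null\<close>), so congruent diagrams have equal images and the
  functor is well defined on the quotient (\<open>Phi_factors\<close>).
\<close>

section \<open>The bracket and linear forms\<close>

context complex_lie_algebra
begin

definition lin_form :: "('g \<Rightarrow> complex) \<Rightarrow> bool" where
  "lin_form f \<longleftrightarrow> (\<forall>x y. f (x + y) = f x + f y) \<and> (\<forall>c x. f (c *s x) = c * f x)"

definition lin_map :: "('g \<Rightarrow> 'g) \<Rightarrow> bool" where
  "lin_map f \<longleftrightarrow> (\<forall>x y. f (x + y) = f x + f y) \<and> (\<forall>c x. f (c *s x) = c *s f x)"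

lemma vector_space_complex: "vector_space ((*) :: complex \<Rightarrow> complex \<Rightarrow> complex)"
  by unfold_locales (auto simp: algebra_simps)

lemma lin_form_iff: "lin_form f \<longleftrightarrow> Vector_Spaces.linear scale (*) f"
  using vector_space_complex vector_space_axioms
  by (auto simp: lin_form_def Vector_Spaces.linear_iff)

lemma lin_map_iff: "lin_map f \<longleftrightarrow> Vector_Spaces.linear scale scale f"
  using vector_space_axioms by (auto simp: lin_map_def Vector_Spaces.linear_iff)

lemma lin_form_0: "lin_form f \<Longrightarrow> f 0 = 0"
  unfolding lin_form_def by (metis scale_zero_left mult_zero_left)

lemma lin_form_sum: "lin_form f \<Longrightarrow> f (\<Sum>i\<in>A. g i) = (\<Sum>i\<in>A. f (g i))"
  by (induction A rule: infinite_finite_induct) (auto simp: lin_form_0 lin_form_def)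

lemma lin_form_sum_scale:
  "lin_form f \<Longrightarrow> f (\<Sum>i\<in>A. c i *s g i) = (\<Sum>i\<in>A. c i * f (g i))"
  by (subst lin_form_sum) (auto simp: lin_form_def)

lemma lin_map_0: "lin_map f \<Longrightarrow> f 0 = 0"
  unfolding lin_map_def by (metis scale_zero_left)

lemma lin_map_sum: "lin_map f \<Longrightarrow> f (\<Sum>i\<in>A. g i) = (\<Sum>i\<in>A. f (g i))"
  by (induction A rule: infinite_finite_induct) (auto simp: lin_map_0 lin_map_def)

lemma lin_map_brk: "lin_map (brk x)"
  using brk_linear_right lin_map_iff by blast

lemma lin_map_brk_left: "lin_map (\<lambda>x. brk x y)"
  using brk_linear_left lin_map_iff by blast

lemma brk_add: "brk x (y + z) = brk x y + brk x z" "brk (x + y) z = brk x z + brk y z"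
  using lin_map_brk[of x] lin_map_brk_left[of z] by (auto simp: lin_map_def)

lemma brk_scale: "brk x (c *s y) = c *s brk x y" "brk (c *s x) y = c *s brk x y"
  using lin_map_brk[of x] lin_map_brk_left[of y] by (auto simp: lin_map_def)

lemma brk_0: "brk x 0 = 0" "brk 0 x = 0"
  using lin_map_0[OF lin_map_brk[of x]] lin_map_0[OF lin_map_brk_left[of x]] by auto

lemma brk_minus: "brk x (- y) = - brk x y" "brk (- x) y = - brk x y"
  using brk_add(1)[of x y "-y"] brk_add(2)[of x "-x" y] 
  by (simp_all add: brk_0 eq_neg_iff_add_eq_0 add.commute)

lemma brk_diff: "brk x (y - z) = brk x y - brk x z" "brk (x - y) z = brk x z - brk y z"
  using brk_add(1)[of x y "-z"] brk_add(2)[of x "-y" z] by (simp_all add: brk_minus)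

lemma brk_sum: "brk x (\<Sum>i\<in>A. g i) = (\<Sum>i\<in>A. brk x (g i))" "brk (\<Sum>i\<in>A. g i) x = (\<Sum>i\<in>A. brk (g i) x)"
  using lin_map_sum[OF lin_map_brk] lin_map_sum[OF lin_map_brk_left] by auto

lemma brk_skew: "brk y x = - brk x y"
proof -
  have "brk y x + brk x y = 0"
    using brk_alt[of "x + y"] unfolding brk_add by (simp add: brk_alt add.commute)
  then show ?thesis by (simp only: eq_neg_iff_add_eq_0)
qed

lemma brk_brk_left: "brk (brk x y) z = brk x (brk y z) - brk y (brk x z)"
  using jacobi[of x y z] brk_skew[of z "brk x y"] brk_skew[of z x]
  by (simp add: brk_minus algebra_simps)

definition coord :: "'g \<Rightarrow> 'g \<Rightarrow> complex" where
  "coord b v = representation Basis v b"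

lemma lin_form_coord: "lin_form (coord b)"
  unfolding lin_form_def coord_def
  by (simp add: representation_add representation_scale independent_Basis span_Basis)

lemma coord_Basis: "b \<in> Basis \<Longrightarrow> c \<in> Basis \<Longrightarrow> coord b c = (if c = b then 1 else 0)"
  by (simp add: coord_def representation_basis independent_Basis)

lemma sum_coord: "(\<Sum>b\<in>Basis. coord b v *s b) = v"
  unfolding coord_def
  by (rule sum_representation_eq) (auto simp: independent_Basis span_Basis finite_Basis)

lemma lin_form_expand: "lin_form f \<Longrightarrow> f v = (\<Sum>b\<in>Basis. coord b v * f b)"
  using lin_form_sum_scale[of f "\<lambda>b. coord b v" "\<lambda>b. b" Basis] by (simp add: sum_coord)

lemma lin_form_compose: "lin_form f \<Longrightarrow> lin_map g \<Longrightarrow> lin_form (\<lambda>x. f (g x))"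
  by (auto simp: lin_form_def lin_map_def)


section \<open>Traces of products of adjoint operators\<close>

definition tr :: "('g \<Rightarrow> 'g) \<Rightarrow> complex" where
  "tr f = (\<Sum>b\<in>Basis. coord b (f b))"

lemma tr_commute:
  assumes "lin_map f" "lin_map g"
  shows "tr (\<lambda>v. f (g v)) = tr (\<lambda>v. g (f v))"
proof -
  have *: "tr (\<lambda>v. f (g v)) = (\<Sum>b\<in>Basis. \<Sum>c\<in>Basis. coord c (g b) * coord b (f c))"
    if "lin_map f" "lin_map g" for f g
    unfolding tr_def
    by (rule sum.cong[OF HOL.refl]) (rule lin_form_expand[OF lin_form_compose[OF lin_form_coord that(1)]])
  show ?thesis
    unfolding *[OF assms] *[OF assms(2,1)] by (subst sum.swap) (simp add: mult.commute)
qed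

lemma tr_add: "tr (\<lambda>v. f v + g v) = tr f + tr g"
  using lin_form_coord by (simp add: tr_def lin_form_def sum.distrib)

lemma tr_scale: "tr (\<lambda>v. c *s f v) = c * tr f"
  using lin_form_coord by (simp add: tr_def lin_form_def sum_distrib_left)

lemma tr_diff: "tr (\<lambda>v. f v - g v) = tr f - tr g"
  using tr_add[of f "\<lambda>v. (-1) *s g v"] tr_scale[of "-1" g] by simp

definition tr3 :: "'g \<Rightarrow> 'g \<Rightarrow> 'g \<Rightarrow> complex" where
  "tr3 a b c = tr (\<lambda>v. brk a (brk b (brk c v)))"

definition tr4 :: "'g \<Rightarrow> 'g \<Rightarrow> 'g \<Rightarrow> 'g \<Rightarrow> complex" where
  "tr4 a b c d = tr (\<lambda>v. brk a (brk b (brk c (brk d v))))"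

definition tr5 :: "'g \<Rightarrow> 'g \<Rightarrow> 'g \<Rightarrow> 'g \<Rightarrow> 'g \<Rightarrow> complex" where
  "tr5 a b c d e = tr (\<lambda>v. brk a (brk b (brk c (brk d (brk e v)))))"

lemma killing_tr: "killing x y = tr (\<lambda>v. brk x (brk y v))"
  by (simp add: killing_def tr_def coord_def)

lemma killing_commute: "killing x y = killing y x"
  using tr_commute[OF lin_map_brk lin_map_brk] by (simp add: killing_tr)

lemma tr3_cyclic: "tr3 a b c = tr3 b c a"
  unfolding tr3_def
  by (rule tr_commute[of "brk a" "\<lambda>v. brk b (brk c v)"]) (simp_all add: lin_map_def brk_add brk_scale)

lemma tr4_cyclic: "tr4 a b c d = tr4 b c d a"
  unfolding tr4_def
  by (rule tr_commute[of "brk a" "\<lambda>v. brk b (brk c (brk d v))"]) (simp_all add: lin_map_def brk_add brk_scale)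

lemma tr5_cyclic: "tr5 a b c d e = tr5 b c d e a"
  unfolding tr5_def
  by (rule tr_commute[of "brk a" "\<lambda>v. brk b (brk c (brk d (brk e v)))"]) (simp_all add: lin_map_def brk_add brk_scale)

lemma killing_brk1: "killing (brk x y) z = tr3 x y z - tr3 y x z"
  by (simp add: killing_tr tr3_def brk_brk_left tr_diff)

lemma tr3_brk1: "tr3 (brk x y) c d = tr4 x y c d - tr4 y x c d"
  by (simp add: tr4_def tr3_def brk_brk_left tr_diff)

lemma tr4_brk1: "tr4 (brk x y) c d e = tr5 x y c d e - tr5 y x c d e"
  by (simp add: tr4_def tr5_def brk_brk_left tr_diff)

lemma killing_invariant: "killing (brk x y) z = killing x (brk y z)"
proof -
  have "killing (brk x y) z = tr3 x y z - tr3 y x z"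
    by (rule killing_brk1)
  also have "\<dots> = tr3 y z x - tr3 z y x"
    using tr3_cyclic[of x y z] tr3_cyclic[of z y x] by presburger
  also have "\<dots> = killing x (brk y z)"
    unfolding killing_commute[of x "brk y z"] by (rule killing_brk1[symmetric])
  finally show ?thesis .
qed

lemma lin_form_killing: "lin_form (killing x)"
  unfolding killing_tr lin_form_def by (auto simp: brk_add brk_scale tr_add tr_scale)

lemma lin_form_killing_left: "lin_form (\<lambda>x. killing x y)"
  using lin_form_killing[of y] unfolding killing_commute[of _ y] .

lemma killing_add: "killing x (y + z) = killing x y + killing x z" "killing (x + y) z = killing x z + killing y z"
  using lin_form_killing[of x] lin_form_killing_left[of z] by (auto simp: lin_form_def)

lemma killing_scale: "killing x (c *s y) = c * killing x y" "killing (c *s x) y = c * killing x y"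
  using lin_form_killing[of x] lin_form_killing_left[of y] by (auto simp: lin_form_def)

lemma killing_0: "killing x 0 = 0" "killing 0 x = 0"
  using lin_form_0[OF lin_form_killing] lin_form_0[OF lin_form_killing_left] by auto

lemma killing_minus: "killing x (- y) = - killing x y" "killing (- x) y = - killing x y"
  using killing_scale(1)[of x "-1" y] killing_scale(2)[of "-1" x y] by simp_all

lemma killing_diff: "killing x (y - z) = killing x y - killing x z" "killing (x - y) z = killing x z - killing y z"
  using killing_add(1)[of x y "-z"] killing_add(2)[of x "-y" z] by (simp_all add: killing_minus)

lemma killing_sum:
  "killing x (\<Sum>i\<in>A. g i) = (\<Sum>i\<in>A. killing x (g i))" "killing (\<Sum>i\<in>A. g i) x = (\<Sum>i\<in>A. killing (g i) x)"
  using lin_form_sum[OF lin_form_killing] lin_form_sum[OF lin_form_killing_left] by auto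

lemma killing_skew: "killing (brk x y) z = - killing y (brk x z)"
  using killing_invariant[of y x z] brk_skew[of y x] by (simp add: killing_minus minus_equation_iff)

end

locale killing_lie_algebra = complex_lie_algebra scale Basis brk
  for scale :: "complex \<Rightarrow> 'g::ab_group_add \<Rightarrow> 'g" (infixr "*s" 75)
    and Basis :: "'g set" and brk :: "'g \<Rightarrow> 'g \<Rightarrow> 'g" +
  assumes nondegenerate: "(\<And>y. killing x y = 0) \<Longrightarrow> x = 0"
begin

lemma killing_eqI: "(\<And>z. killing x z = killing y z) \<Longrightarrow> x = y"
  using nondegenerate[of "x - y"] by (simp add: killing_diff)

lemma dual_vec_exists:
  assumes "b \<in> Basis"
  shows "\<exists>d. \<forall>c\<in>Basis. killing c d = (if c = b then 1 else 0)"
proof -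
  define L where "L v = (\<Sum>c\<in>Basis. killing c v *s c)" for v
  have coordL: "coord c (L v) = killing c v" if "c \<in> Basis" for c v
    using that finite_Basis unfolding L_def
    by (subst lin_form_sum_scale[OF lin_form_coord]) (simp add: coord_Basis if_distrib cong: if_cong)
  have lin: "Vector_Spaces.linear scale scale L"
    unfolding lin_map_iff[symmetric] lin_map_def L_def
    by (auto simp: killing_add killing_scale scale_left_distrib sum.distrib scale_sum_right)
  have "inj L"
  proof (rule injI, rule killing_eqI)
    fix x y z assume "L x = L y"
    then have *: "killing c x = killing c y" if "c \<in> Basis" for c
      using coordL[OF that] by metis
    then show "killing x z = killing y z"
      unfolding killing_commute[of _ z]
      using lin_form_expand[OF lin_form_killing_left, of z x] lin_form_expand[OF lin_form_killing_left, of z y]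
      by (metis (no_types, lifting) sum.cong)
  qed
  then have "surj L"
    using linear_inj_imp_surj lin by blast
  then obtain d where "L d = b" by (metis surjD)
  then show ?thesis
    using coordL assms by (metis coord_Basis)
qed

lemma killing_dual_vec:
  assumes "b \<in> Basis" "c \<in> Basis"
  shows "killing c (dual_vec b) = (if c = b then 1 else 0)"
proof -
  let ?P = "\<lambda>d. \<forall>c\<in>Basis. killing c d = (if c = b then 1 else 0)"
  have "\<exists>!d. ?P d"
  proof (rule ex_ex1I)
    show "\<exists>d. ?P d" by (rule dual_vec_exists[OF assms(1)])
    fix d d' assume "?P d" "?P d'"
    then have "killing d z = killing d' z" for z
      unfolding killing_commute[of _ z]
      using lin_form_expand[OF lin_form_killing_left, of z d] lin_form_expand[OF lin_form_killing_left, of z d'] by simp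
    then show "d = d'" by (rule killing_eqI)
  qed
  from theI'[OF this] show ?thesis using assms unfolding dual_vec_def by blast
qed

lemma coord_eq_killing: "b \<in> Basis \<Longrightarrow> coord b v = killing v (dual_vec b)"
  using lin_form_expand[OF lin_form_killing_left, of v "dual_vec b"] finite_Basis
  by (simp add: killing_dual_vec if_distrib cong: if_cong)

lemma sum_killing_dual_right: "(\<Sum>b\<in>Basis. killing v (dual_vec b) *s b) = v"
  using sum_coord[of v] by (simp add: coord_eq_killing)

lemma sum_killing_dual_left: "(\<Sum>b\<in>Basis. killing v b *s dual_vec b) = v"
proof (rule killing_eqI)
  fix z
  have "killing v z = (\<Sum>b\<in>Basis. coord b z * killing v b)"
    by (rule lin_form_expand[OF lin_form_killing])
  then show "killing (\<Sum>b\<in>Basis. killing v b *s dual_vec b) z = killing v z"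
    by (simp add: killing_sum killing_scale coord_eq_killing killing_commute mult.commute)
qed

lemma contract_left:
  assumes "lin_form f"
  shows "(\<Sum>b\<in>Basis. killing v b * f (dual_vec b)) = f v"
  using lin_form_sum_scale[OF assms, of "killing v" dual_vec Basis] by (simp add: sum_killing_dual_left)

lemma contract_right:
  assumes "lin_form f"
  shows "(\<Sum>b\<in>Basis. killing v (dual_vec b) * f b) = f v"
  using lin_form_sum_scale[OF assms, of "\<lambda>b. killing v (dual_vec b)" "\<lambda>b. b" Basis]
  by (simp add: sum_killing_dual_right)

lemma tr_killing: "tr f = (\<Sum>b\<in>Basis. killing (f b) (dual_vec b))"
  by (simp add: tr_def coord_eq_killing)

text \<open>
  The sum of \<open>b \<otimes> dual_vec b\<close> over the basis does not depend on the
  basis, so an operator acting on the first factor may be moved to the second factor as its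
  adjoint.
\<close>

lemma contract_pair:
  assumes "\<And>y. lin_form (\<lambda>x. G x y)" "\<And>x. lin_form (G x)"
    and "lin_map f" "\<And>u v. killing (f u) v = killing u (f' v)"
  shows "(\<Sum>b\<in>Basis. G (f b) (dual_vec b)) = (\<Sum>b\<in>Basis. G b (f' (dual_vec b)))"
proof -
  have "(\<Sum>b\<in>Basis. G (f b) (dual_vec b)) =
      (\<Sum>b\<in>Basis. \<Sum>c\<in>Basis. killing (f b) (dual_vec c) * G c (dual_vec b))"
    by (simp only: contract_right[OF assms(1)])
  also have "\<dots> = (\<Sum>c\<in>Basis. \<Sum>b\<in>Basis. killing (f' (dual_vec c)) b * G c (dual_vec b))"
    by (subst sum.swap) (simp add: assms(4) killing_commute)
  also have "\<dots> = (\<Sum>c\<in>Basis. G c (f' (dual_vec c)))"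
    by (simp only: contract_left[OF assms(2)])
  finally show ?thesis .
qed

lemma contract_swap:
  assumes "\<And>y. lin_form (\<lambda>x. G x y)" "\<And>x. lin_form (G x)"
  shows "(\<Sum>b\<in>Basis. G b (dual_vec b)) = (\<Sum>b\<in>Basis. G (dual_vec b) b)"
proof -
  have "(\<Sum>b\<in>Basis. G b (dual_vec b)) =
      (\<Sum>b\<in>Basis. \<Sum>c\<in>Basis. killing b c * G (dual_vec c) (dual_vec b))"
    by (simp only: contract_left[OF assms(1)])
  also have "\<dots> = (\<Sum>c\<in>Basis. \<Sum>b\<in>Basis. killing c b * G (dual_vec c) (dual_vec b))"
    by (subst sum.swap) (simp add: killing_commute)
  also have "\<dots> = (\<Sum>c\<in>Basis. G (dual_vec c) c)"
    by (simp only: contract_left[OF assms(2)])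
  finally show ?thesis .
qed

lemma tr_adjoint:
  assumes "lin_map f" "lin_map f'" "\<And>u v. killing (f u) v = killing u (f' v)"
  shows "tr f = tr f'"
proof -
  have "tr f = (\<Sum>b\<in>Basis. killing b (f' (dual_vec b)))"
    by (simp add: tr_killing assms)
  also have "\<dots> = (\<Sum>b\<in>Basis. killing (dual_vec b) (f' b))"
    by (rule contract_swap[of "\<lambda>x y. killing x (f' y)"]) (use assms(2) in \<open>auto simp: lin_form_def lin_map_def killing_add killing_scale\<close>)
  finally show ?thesis by (simp add: tr_killing killing_commute)
qed

lemma tr3_reverse: "tr3 a b c = - tr3 c b a"
proof -
  have "tr3 a b c = tr (\<lambda>v. (-1) *s brk c (brk b (brk a v)))"
    unfolding tr3_def
    by (rule tr_adjoint) (simp_all add: killing_skew killing_minus lin_map_def brk_add brk_scale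
        scale_right_distrib scale_left_commute)
  then show ?thesis by (simp only: tr_scale tr3_def) simp
qed

lemma tr4_reverse: "tr4 a b c d = tr4 d c b a"
  unfolding tr4_def
  by (rule tr_adjoint) (simp_all add: killing_skew lin_map_def brk_add brk_scale)

lemma tr5_reverse: "tr5 a b c d e = - tr5 e d c b a"
proof -
  have "tr5 a b c d e = tr (\<lambda>v. (-1) *s brk e (brk d (brk c (brk b (brk a v)))))"
    unfolding tr5_def
    by (rule tr_adjoint) (simp_all add: killing_skew killing_minus lin_map_def brk_add brk_scale
        scale_right_distrib scale_left_commute)
  then show ?thesis by (simp only: tr_scale tr5_def) simp
qed

text \<open>
  Reversing three skew operators changes the sign of the trace. So only the part that is skew
  in the last two arguments survives, and it is half the trace with their commutator.
\<close>

lemma tr3_eq: "tr3 a b c = killing a (brk b c) / 2"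
proof -
  have "tr3 b a c = - tr3 a b c"
    using tr3_reverse[of a b c] by (simp add: tr3_cyclic[of b a c] tr3_cyclic[of a c b])
  then show ?thesis
    using killing_brk1[of a b c] killing_invariant[of a b c] by simp
qed

lemma tr4_swap: "tr4 a b c d = tr4 b a c d + killing (brk a b) (brk c d) / 2"
  using tr3_brk1[of a b c d] unfolding tr3_eq by (simp add: field_simps)

end

section \<open>Quartic forms invariant under reflections\<close>

text \<open>
  The form \<open>Q\<close> is defined on the whole space, but its symmetry under reflections
  is only studied on the subspace \<open>V\<close>. In the application \<open>V\<close> is a
  Cartan subalgebra and \<open>\<kappa>\<close> is the Killing form.
\<close>

locale symmetric_quartic = vector_space scale
  for scale :: "complex \<Rightarrow> 'v::ab_group_add \<Rightarrow> 'v" (infixr "*s" 75) +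
  fixes V :: "'v set" and \<kappa> :: "'v \<Rightarrow> 'v \<Rightarrow> complex" and Q :: "'v \<Rightarrow> 'v \<Rightarrow> 'v \<Rightarrow> 'v \<Rightarrow> complex"
  assumes V: "subspace V"
    and form_add: "\<kappa> (x + y) z = \<kappa> x z + \<kappa> y z"
    and form_scale: "\<kappa> (c *s x) z = c * \<kappa> x z"
    and form_sym: "\<kappa> x y = \<kappa> y x"
    and Q_add: "Q (x + y) u v w = Q x u v w + Q y u v w"
    and Q_scale: "Q (c *s x) u v w = c * Q x u v w"
    and Q_swap: "Q x y u v = Q y x u v" "Q x y u v = Q x u y v" "Q x y u v = Q x y v u"
begin

lemma form_add_right: "\<kappa> x (y + z) = \<kappa> x y + \<kappa> x z"
  using form_add[of y z x] by (simp add: form_sym)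

lemma form_scale_right: "\<kappa> x (c *s y) = c * \<kappa> x y"
  using form_scale[of c y x] by (simp add: form_sym)

lemma form_diff: "\<kappa> (x - y) z = \<kappa> x z - \<kappa> y z"
  using form_add[of x "(-1) *s y" z] by (simp only: form_scale) simp

lemmas form_linear = form_add form_add_right form_scale form_scale_right form_diff

lemma Q_add_right:
  "Q u (x + y) v w = Q u x v w + Q u y v w"
  "Q u v (x + y) w = Q u v x w + Q u v y w"
  "Q u v w (x + y) = Q u v w x + Q u v w y"
proof -
  show 2: "Q u (x + y) v w = Q u x v w + Q u y v w" for u v w
    using Q_add[of x y u v w] by (simp only: Q_swap(1)[of u])
  show 3: "Q u v (x + y) w = Q u v x w + Q u v y w" for u v w
    using 2[of u v w] by (simp only: Q_swap(2)[of u v])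
  show "Q u v w (x + y) = Q u v w x + Q u v w y"
    using 3[of u v w] by (simp only: Q_swap(3)[of u v w])
qed

lemma Q_scale_right:
  "Q u (c *s x) v w = c * Q u x v w"
  "Q u v (c *s x) w = c * Q u v x w"
  "Q u v w (c *s x) = c * Q u v w x"
proof -
  show 2: "Q u (c *s x) v w = c * Q u x v w" for u v w
    using Q_scale[of c x u v w] by (simp only: Q_swap(1)[of u])
  show 3: "Q u v (c *s x) w = c * Q u v x w" for u v w
    using 2[of u v w] by (simp only: Q_swap(2)[of u v])
  show "Q u v w (c *s x) = c * Q u v w x"
    using 3[of u v w] by (simp only: Q_swap(3)[of u v w])
qed

lemmas Q_linear = Q_add Q_add_right Q_scale Q_scale_right

text \<open>
  Write an argument as \<open>x + a *s u\<close> with \<open>x\<close> orthogonal to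
  \<open>u\<close>. The quartic polynomial of \<open>Q\<close> is even in \<open>a\<close>
  exactly if its terms of degree one and three in \<open>u\<close> vanish.
\<close>

definition mirror :: "'v \<Rightarrow> bool" where
  "mirror u \<longleftrightarrow> u \<in> V \<and> \<kappa> u u \<noteq> 0 \<and>
     (\<forall>x\<in>V. \<forall>y\<in>V. \<forall>z\<in>V. \<kappa> x u = 0 \<longrightarrow> \<kappa> y u = 0 \<longrightarrow> \<kappa> z u = 0 \<longrightarrow> Q u x y z = 0) \<and>
     (\<forall>x\<in>V. \<kappa> x u = 0 \<longrightarrow> Q u u u x = 0)"

definition refl_at :: "'v \<Rightarrow> 'v \<Rightarrow> 'v" where
  "refl_at u x = x + (- 2 * \<kappa> x u / \<kappa> u u) *s u"

lemma mirror_V: "mirror u \<Longrightarrow> u \<in> V"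
  by (simp add: mirror_def)

lemma mirror_nonzero: "mirror u \<Longrightarrow> \<kappa> u u \<noteq> 0"
  by (simp add: mirror_def)

lemma mirror_one: 
  "mirror u \<Longrightarrow> x \<in> V \<Longrightarrow> y \<in> V \<Longrightarrow> z \<in> V \<Longrightarrow> \<kappa> x u = 0 \<Longrightarrow> \<kappa> y u = 0 \<Longrightarrow> \<kappa> z u = 0 \<Longrightarrow> Q u x y z = 0"
  by (simp add: mirror_def)

lemma mirror_three: "mirror u \<Longrightarrow> x \<in> V \<Longrightarrow> \<kappa> x u = 0 \<Longrightarrow> Q u u u x = 0"
  by (simp add: mirror_def)

lemma refl_at_V: "mirror u \<Longrightarrow> x \<in> V \<Longrightarrow> refl_at u x \<in> V"
  unfolding refl_at_def by (intro subspace_add[OF V] subspace_scale[OF V]) (auto intro: mirror_V)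

lemma refl_at_orth: "\<kappa> x u = 0 \<Longrightarrow> refl_at u x = x"
  by (simp add: refl_at_def)

lemma refl_at_twice: "mirror u \<Longrightarrow> refl_at u (refl_at u x) = x"
  unfolding refl_at_def
  by (simp add: form_linear mirror_nonzero field_simps scale_left_distrib[symmetric] add.assoc)

lemma orth_split:
  assumes "mirror u" "x \<in> V"
  obtains x0 where "x0 \<in> V" "\<kappa> x0 u = 0" "x = x0 + (\<kappa> x u / \<kappa> u u) *s u"
    "refl_at u x = x0 + (- (\<kappa> x u / \<kappa> u u)) *s u"
proof
  let ?x = "x + (- (\<kappa> x u / \<kappa> u u)) *s u"
  show "?x \<in> V" by (intro subspace_add[OF V] subspace_scale[OF V] mirror_V assms)
  show "\<kappa> ?x u = 0" using assms by (simp add: form_linear mirror_nonzero del: scale_minus_left)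
  show "x = ?x + (\<kappa> x u / \<kappa> u u) *s u" by simp
  show "refl_at u x = ?x + (- (\<kappa> x u / \<kappa> u u)) *s u"
    unfolding refl_at_def add.assoc scale_left_distrib[symmetric] by simp
qed

lemma Q_refl_at:
  assumes u: "mirror u" and "x \<in> V" "y \<in> V" "z \<in> V" "w \<in> V"
  shows "Q (refl_at u x) (refl_at u y) (refl_at u z) (refl_at u w) = Q x y z w"
proof -
  obtain x0 a where x: "x0 \<in> V" "\<kappa> x0 u = 0" "x = x0 + a *s u" "refl_at u x = x0 + (- a) *s u"
    using orth_split[OF u assms(2)] by metis
  obtain y0 b where y: "y0 \<in> V" "\<kappa> y0 u = 0" "y = y0 + b *s u" "refl_at u y = y0 + (- b) *s u"
    using orth_split[OF u assms(3)] by metis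
  obtain z0 c where z: "z0 \<in> V" "\<kappa> z0 u = 0" "z = z0 + c *s u" "refl_at u z = z0 + (- c) *s u"
    using orth_split[OF u assms(4)] by metis
  obtain w0 d where w: "w0 \<in> V" "\<kappa> w0 u = 0" "w = w0 + d *s u" "refl_at u w = w0 + (- d) *s u"
    using orth_split[OF u assms(5)] by metis
  note one = mirror_one[OF u] and three = mirror_three[OF u]
  have odd: "Q u y0 z0 w0 = 0" "Q x0 u z0 w0 = 0" "Q x0 y0 u w0 = 0" "Q x0 y0 z0 u = 0"
    "Q x0 u u u = 0" "Q u y0 u u = 0" "Q u u z0 u = 0" "Q u u u w0 = 0"
    using one[OF y(1) z(1) w(1)] one[OF x(1) z(1) w(1)] one[OF x(1) y(1) w(1)] one[OF x(1) y(1) z(1)]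
      three[OF x(1)] three[OF y(1)] three[OF z(1)] three[OF w(1)] x(2) y(2) z(2) w(2)
    by (metis Q_swap)+
  show ?thesis
    unfolding x(4) y(4) z(4) w(4) unfolding x(3) y(3) z(3) w(3)
    unfolding Q_linear odd by (simp add: algebra_simps)
qed

lemma Q4_refl_at: 
  "mirror u \<Longrightarrow> x \<in> V \<Longrightarrow> Q (refl_at u x) (refl_at u x) (refl_at u x) (refl_at u x) = Q x x x x"
  by (rule Q_refl_at)

text \<open>
  Two roots of equal length at an angle of 120 degrees.
\<close>

definition adj :: "'v \<Rightarrow> 'v \<Rightarrow> bool" where
  "adj u v \<longleftrightarrow> \<kappa> u u = \<kappa> v v \<and> 2 * \<kappa> u v = - \<kappa> u u"

lemma adj_sym: "adj u v \<Longrightarrow> adj v u"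
  by (simp add: adj_def form_sym)

lemma adj_form: "adj u v \<Longrightarrow> \<kappa> u v = - \<kappa> u u / 2" "adj u v \<Longrightarrow> \<kappa> v v = \<kappa> u u"
  by (auto simp: adj_def field_simps)

lemma refl_at_adj:
  assumes "adj u v" "mirror v" shows "refl_at v u = u + v"
  using assms mirror_nonzero[of v] by (simp add: refl_at_def adj_def)

lemma refl_at_adj_sum:
  assumes "adj u v" "mirror u" shows "refl_at u (u + v) = v"
  using assms mirror_nonzero[of u] adj_form[OF assms(1)]
  by (simp add: refl_at_def form_linear form_sym[of v u] scale_left_diff_distrib)

lemma adj_Q4:
  assumes "adj u v" "mirror u" "mirror v"
  shows "Q v v v v = Q u u u u"
  using Q4_refl_at[of v u] Q4_refl_at[of u "u + v"] assms V
  by (simp add: refl_at_adj refl_at_adj_sum mirror_V subspace_add)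

lemma Q3_zero:
  assumes "mirror u" "Q u u u u = 0" "x \<in> V"
  shows "Q u u u x = 0"
proof -
  obtain x0 a where x: "x0 \<in> V" "\<kappa> x0 u = 0" "x = x0 + a *s u"
    using orth_split[OF assms(1,3)] by metis
  then show ?thesis
    using assms mirror_three[OF assms(1) x(1,2)] by (simp add: Q_linear)
qed

text \<open>
  The reflection in \<open>v\<close> sends \<open>u\<close> to \<open>u + v\<close>, so the
  cubic vanishing \<open>Q3_zero\<close> also holds at \<open>u + v\<close>. The mixed term is
  what remains after expanding it.
\<close>

lemma adj_Q22:
  assumes "adj u v" "mirror u" "mirror v" "Q u u u u = 0"
  shows "Q u u v v = 0"
proof -
  note V' = mirror_V[OF assms(2)] mirror_V[OF assms(3)]
  have v4: "Q v v v v = 0" using adj_Q4 assms by simp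
  have "Q (u + v) (u + v) (u + v) v = Q u u u (refl_at v v)"
    using Q_refl_at[of v u u u "refl_at v v"] assms V'
    by (simp add: refl_at_adj refl_at_V refl_at_twice)
  also have "\<dots> = 0" by (rule Q3_zero) (use assms V' refl_at_V in auto)
  finally have "Q u u u v + Q v v v v + 3 * Q u u v v + 3 * Q v v v u = 0"
    by (simp add: Q_linear Q_swap algebra_simps)
  then show ?thesis
    using v4 Q3_zero[OF assms(2) assms(4) V'(2)] Q3_zero[OF assms(3) v4 V'(1)] by simp
qed

text \<open>
  Split \<open>x\<close> and \<open>y\<close> into multiples of \<open>u\<close> and
  \<open>v\<close> and a part orthogonal to both. Since \<open>Q\<close> is even in
  \<open>u\<close> and in \<open>v\<close>, only the terms in which each of them occurs twice
  contribute.
\<close>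

lemma Q_orth_pair:
  assumes u: "mirror u" and v: "mirror v" and uv: "\<kappa> u v = 0" and xy: "x \<in> V" "y \<in> V"
  shows "Q u v x y = (\<kappa> x u * \<kappa> y v + \<kappa> y u * \<kappa> x v) / (\<kappa> u u * \<kappa> v v) * Q u u v v"
proof -
  note V' = mirror_V[OF u] mirror_V[OF v]
  have vu: "\<kappa> v u = 0" using uv form_sym by simp
  have split: "\<exists>x0. x0 \<in> V \<and> \<kappa> x0 u = 0 \<and> \<kappa> x0 v = 0 \<and>
      x = x0 + (\<kappa> x u / \<kappa> u u) *s u + (\<kappa> x v / \<kappa> v v) *s v" if "x \<in> V" for x
  proof (intro exI conjI)
    let ?x = "x - (\<kappa> x u / \<kappa> u u) *s u - (\<kappa> x v / \<kappa> v v) *s v"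
    show "?x \<in> V" using V V' that by (auto intro!: subspace_diff subspace_scale)
    show "\<kappa> ?x u = 0" "\<kappa> ?x v = 0"
      using uv vu mirror_nonzero[OF u] mirror_nonzero[OF v] by (simp_all add: form_linear)
  qed (simp add: algebra_simps)
  obtain x0 where x0: "x0 \<in> V" "\<kappa> x0 u = 0" "\<kappa> x0 v = 0"
    and x: "x = x0 + (\<kappa> x u / \<kappa> u u) *s u + (\<kappa> x v / \<kappa> v v) *s v" using split[OF xy(1)] by blast
  obtain y0 where y0: "y0 \<in> V" "\<kappa> y0 u = 0" "\<kappa> y0 v = 0"
    and y: "y = y0 + (\<kappa> y u / \<kappa> u u) *s u + (\<kappa> y v / \<kappa> v v) *s v" using split[OF xy(2)] by blast
  have z: "Q u v x0 y0 = 0" "Q u v v y0 = 0" "Q u v x0 v = 0" "Q u v v v = 0"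
    using mirror_one[OF u] x0 y0 V' vu by blast+
  have z': "Q v u u y0 = 0" "Q v u x0 u = 0" "Q v u u u = 0"
    using mirror_one[OF v] x0 y0 V' uv by blast+
  have z'': "Q u v u y0 = 0" "Q u v x0 u = 0" "Q u v u u = 0" "Q u v u v = Q u u v v" "Q u v v u = Q u u v v"
    using z' by (metis Q_swap)+
  show ?thesis
    apply (subst x, subst y)
    unfolding Q_linear z z''
    by (simp add: field_simps mirror_nonzero u v)
qed

text \<open>
  The reflections in \<open>v'\<close> and then in \<open>v\<close> fix \<open>u\<close> and
  carry \<open>v\<close> to \<open>v'\<close>.
\<close>

lemma Q22_transport:
  assumes "adj v v'" "mirror v" "mirror v'" "u \<in> V" "\<kappa> u v = 0" "\<kappa> u v' = 0"
  shows "Q u u v v = Q u u v' v'"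
proof -
  have "Q u u v v = Q u u (v + v') (v + v')"
    using Q_refl_at[of v' u u v v] assms by (simp add: refl_at_adj refl_at_orth mirror_V)
  also have "\<dots> = Q u u v' v'"
    using Q_refl_at[of v u u "v + v'" "v + v'"] assms V
    by (simp add: refl_at_adj_sum refl_at_orth mirror_V subspace_add)
  finally show ?thesis .
qed

lemma Q4_binomial:
  "Q (x + y) (x + y) (x + y) (x + y) =
     Q x x x x + 4 * Q x x x y + 6 * Q x x y y + 4 * Q x y y y + Q y y y y"
  by (simp add: Q_linear Q_swap)

text \<open>
  The highest root \<open>2 *s c + b1 + b2 + b3\<close> is the image of \<open>c\<close> under
  four reflections, so \<open>Q\<close> vanishes at it. After expansion, the terms not killed
  by \<open>adj_Q22\<close> and \<open>Q3_zero\<close> are multiples of the values at the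
  three orthogonal pairs, by \<open>Q_orth_pair\<close>.
\<close>

lemma D4_relation:
  assumes m: "mirror c" "mirror b1" "mirror b2" "mirror b3"
    and a: "adj c b1" "adj c b2" "adj c b3"
    and o: "\<kappa> b1 b2 = 0" "\<kappa> b1 b3 = 0" "\<kappa> b2 b3 = 0"
    and c0: "Q c c c c = 0"
  shows "Q b1 b1 b2 b2 + Q b1 b1 b3 b3 + Q b2 b2 b3 b3 = 0"
proof -
  define N where "N = \<kappa> c c"
  have N: "N \<noteq> 0" using m(1) mirror_nonzero N_def by simp
  have cb: "\<kappa> c b1 = - N / 2" "\<kappa> c b2 = - N / 2" "\<kappa> c b3 = - N / 2" 
      "\<kappa> b1 c = - N / 2" "\<kappa> b2 c = - N / 2" "\<kappa> b3 c = - N / 2"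
    and bb: "\<kappa> b1 b1 = N" "\<kappa> b2 b2 = N" "\<kappa> b3 b3 = N" "\<kappa> c c = N"
    using adj_form[OF a(1)] adj_form[OF a(2)] adj_form[OF a(3)] form_sym[of b1 c] form_sym[of b2 c] form_sym[of b3 c]
    by (simp_all add: N_def)
  have o': "\<kappa> b2 b1 = 0" "\<kappa> b3 b1 = 0" "\<kappa> b3 b2 = 0" using o form_sym by auto
  note Vs = m[THEN mirror_V]
  let ?B = "b1 + b2 + b3" and ?C = "2 *s c"
  have theta: "refl_at c (refl_at b3 (refl_at b2 (refl_at b1 c))) = ?C + ?B"
  proof -
    have 1: "refl_at b1 c = c + b1"
      unfolding refl_at_def cb bb using N by simp
    have 2: "refl_at b2 (c + b1) = c + b1 + b2"
      unfolding refl_at_def form_linear cb bb o using N by simp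
    have 3: "refl_at b3 (c + b1 + b2) = c + b1 + b2 + b3"
      unfolding refl_at_def form_linear cb bb o using N by simp
    have 4: "refl_at c (c + b1 + b2 + b3) = ?C + ?B"
      unfolding refl_at_def form_linear cb bb o using N scale_left_distrib[of 1 1 c]
      by (simp add: field_simps)
    show ?thesis unfolding 1 2 3 4 ..
  qed
  have "Q (?C + ?B) (?C + ?B) (?C + ?B) (?C + ?B) = 0"
    unfolding theta[symmetric] using Vs m c0 by (simp add: Q4_refl_at refl_at_V)
  then have E: "16 * Q c c c c + 32 * Q c c c ?B + 24 * Q c c ?B ?B + 8 * Q c ?B ?B ?B + Q ?B ?B ?B ?B = 0"
    unfolding Q4_binomial Q_scale Q_scale_right by simp
  have b0: "Q b1 b1 b1 b1 = 0" "Q b2 b2 b2 b2 = 0" "Q b3 b3 b3 b3 = 0"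
    using adj_Q4 a m c0 by simp_all
  have cccB: "Q c c c ?B = 0"
    using Q3_zero[OF m(1) c0] Vs V by (auto intro: subspace_add)
  have b3x: "Q b1 b1 b1 x = 0" "Q b2 b2 b2 x = 0" "Q b3 b3 b3 x = 0" if "x \<in> V" for x
    using Q3_zero m b0 that by auto
  have cb3: "Q c b1 b1 b1 = 0" "Q c b2 b2 b2 = 0" "Q c b3 b3 b3 = 0"
    using b3x[of c] Vs(1) by (metis Q_swap)+
  have cbb: "Q c c b1 b1 = 0" "Q c c b2 b2 = 0" "Q c c b3 b3 = 0"
    using adj_Q22 a m c0 by auto
  note P12 = Q_orth_pair[OF m(2,3) o(1), unfolded bb] and P13 = Q_orth_pair[OF m(2,4) o(2), unfolded bb] 
    and P23 = Q_orth_pair[OF m(3,4) o(3), unfolded bb]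
  let ?z12 = "Q b1 b1 b2 b2" and ?z13 = "Q b1 b1 b3 b3" and ?z23 = "Q b2 b2 b3 b3"
  have ccbb: "Q c c b1 b2 = ?z12 / 2" "Q c c b1 b3 = ?z13 / 2" "Q c c b2 b3 = ?z23 / 2"
    using P12[of c c] P13[of c c] P23[of c c] Vs N by (simp_all add: cb Q_swap field_simps)
  have cbbb: "Q c b1 b1 b2 = - ?z12 / 2" "Q c b1 b2 b2 = - ?z12 / 2" "Q c b1 b1 b3 = - ?z13 / 2"
    "Q c b1 b3 b3 = - ?z13 / 2" "Q c b2 b2 b3 = - ?z23 / 2" "Q c b2 b3 b3 = - ?z23 / 2" "Q c b1 b2 b3 = 0"
    using P12[of c b1] P12[of c b2] P13[of c b1] P13[of c b3] P23[of c b2] P23[of c b3] P12[of c b3] Vs N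
    by (simp_all add: cb bb o o' Q_swap field_simps)
  have bbbb: "Q b1 b1 b2 b3 = 0" "Q b1 b2 b2 b3 = 0" "Q b1 b2 b3 b3 = 0"
      "Q b1 b1 b1 b2 = 0" "Q b1 b1 b1 b3 = 0" "Q b2 b2 b2 b3 = 0"
      "Q b1 b2 b2 b2 = 0" "Q b1 b3 b3 b3 = 0" "Q b2 b3 b3 b3 = 0"
    using P23[of b1 b1] P13[of b2 b2] P12[of b3 b3] b3x(1)[OF Vs(3)] b3x(1)[OF Vs(4)] b3x(2)[OF Vs(4)]
      b3x(2)[OF Vs(2)] b3x(3)[OF Vs(2)] b3x(3)[OF Vs(3)] Vs N
    by (simp_all add: o o' Q_swap)
  have ccBB: "Q c c ?B ?B = Q c c b1 b1 + Q c c b2 b2 + Q c c b3 b3 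
      + 2 * (Q c c b1 b2 + Q c c b1 b3 + Q c c b2 b3)"
    unfolding Q_linear by (simp add: Q_swap)
  have cBBB: "Q c ?B ?B ?B = Q c b1 b1 b1 + Q c b2 b2 b2 + Q c b3 b3 b3 
     + 3 * (Q c b1 b1 b2 + Q c b1 b2 b2 + Q c b1 b1 b3 + Q c b1 b3 b3 + Q c b2 b2 b3 + Q c b2 b3 b3)
     + 6 * Q c b1 b2 b3"
    unfolding Q_linear by (simp add: Q_swap)
  have BBBB: "Q ?B ?B ?B ?B = Q b1 b1 b1 b1 + Q b2 b2 b2 b2 + Q b3 b3 b3 b3 
     + 4 * (Q b1 b1 b1 b2 + Q b1 b1 b1 b3 + Q b2 b2 b2 b3 + Q b1 b2 b2 b2 + Q b1 b3 b3 b3 + Q b2 b3 b3 b3)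
     + 6 * (?z12 + ?z13 + ?z23) + 12 * (Q b1 b1 b2 b3 + Q b1 b2 b2 b3 + Q b1 b2 b3 b3)"
    unfolding Q_linear by (simp add: Q_swap)
  have "6 * (?z12 + ?z13 + ?z23) = (0 :: complex)"
    using E unfolding ccBB cBBB BBBB c0 cccB b0 cb3 cbb ccbb cbbb bbbb by (simp add: field_simps)
  then show ?thesis unfolding mult_eq_0_iff by simp
qed

text \<open>
  If two of the four arguments are orthogonal, \<open>Q_orth_pair\<close> applies. Otherwise
  the arguments are pairwise equal or adjacent. As the diagram has no triangle, at most two
  distinct roots occur, and these cases are covered by \<open>Q3_zero\<close> and
  \<open>adj_Q22\<close>.
\<close>

lemma tree_vanish:
  assumes S: "\<And>u. u \<in> S \<Longrightarrow> mirror u \<and> Q u u u u = 0"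
    and edge: "\<And>u v. u \<in> S \<Longrightarrow> v \<in> S \<Longrightarrow> u = v \<or> adj u v \<or> \<kappa> u v = 0 \<and> Q u u v v = 0"
    and tri: "\<And>u v w. u \<in> S \<Longrightarrow> v \<in> S \<Longrightarrow> w \<in> S \<Longrightarrow> \<not> (adj u v \<and> adj v w \<and> adj u w)"
    and abcd: "a \<in> S" "b \<in> S" "c \<in> S" "d \<in> S"
  shows "Q a b c d = 0"
proof -
  have orth: "Q u v x y = 0" if "u \<in> S" "v \<in> S" "x \<in> S" "y \<in> S" "\<kappa> u v = 0" for u v x y
  proof -
    have "Q u u v v = 0"
      using edge[OF that(1,2)] S[OF that(1)] S[OF that(2)] that(5) adj_form(1)[of u v] mirror_nonzero[of u]
      by auto
    then show ?thesis using Q_orth_pair[of u v x y] S that mirror_V by simp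
  qed
  have orth6: "Q a b c d = 0" if "\<kappa> a b = 0 \<or> \<kappa> a c = 0 \<or> \<kappa> a d = 0 \<or> \<kappa> b c = 0 \<or> \<kappa> b d = 0 \<or> \<kappa> c d = 0"
    using that abcd orth[of a b c d] orth[of a c b d] orth[of a d b c] orth[of b c a d] orth[of b d a c] orth[of c d a b]
    by (metis Q_swap)
  have three: "Q u u u v = 0" if "u \<in> S" "v \<in> S" for u v
    using Q3_zero S that mirror_V by blast
  have two: "Q u u v v = 0" if "u \<in> S" "v \<in> S" "adj u v" for u v
    using adj_Q22 S that by blast
  have perm: "Q u u u v = 0" "Q u u v u = 0" "Q u v u u = 0" "Q v u u u = 0"
    if "u \<in> S" "v \<in> S" for u v
    using three[OF that] by (metis Q_swap)+
  have perm2: "Q u u v v = 0" "Q u v u v = 0" "Q u v v u = 0"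
    if "u \<in> S" "v \<in> S" "adj u v" for u v
    using two[OF that] by (metis Q_swap)+
  show ?thesis
  proof (cases "\<kappa> a b = 0 \<or> \<kappa> a c = 0 \<or> \<kappa> a d = 0 \<or> \<kappa> b c = 0 \<or> \<kappa> b d = 0 \<or> \<kappa> c d = 0")
    case True then show ?thesis by (rule orth6)
  next
    case False
    then have e: "a = b \<or> adj a b" "a = c \<or> adj a c" "a = d \<or> adj a d" "b = c \<or> adj b c" "b = d \<or> adj b d" "c = d \<or> adj c d"
      using edge abcd by metis+
    show ?thesis
      using e tri[OF abcd(1,2,3)] tri[OF abcd(1,2,4)] tri[OF abcd(1,3,4)] tri[OF abcd(2,3,4)] abcd perm perm2
      by metis
  qed
qed

lemma vanish_span:
  assumes "\<And>a b c d. a \<in> S \<Longrightarrow> b \<in> S \<Longrightarrow> c \<in> S \<Longrightarrow> d \<in> S \<Longrightarrow> Q a b c d = 0"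
    and "a \<in> span S" "b \<in> span S" "c \<in> span S" "d \<in> span S"
  shows "Q a b c d = 0"
proof -
  have lin: "subspace {x. Q x b c d = 0}" for b c d
    using Q_scale[of 0 0 b c d] by (intro subspaceI) (auto simp: Q_linear)
  have step: "Q x b c d = 0" if "x \<in> span S" "\<And>x. x \<in> S \<Longrightarrow> Q x b c d = 0" for x b c d
    using span_minimal[OF _ lin[of b c d], of S] that by blast
  have 1: "Q a b c d = 0" if "a \<in> span S" "b \<in> S" "c \<in> S" "d \<in> S" for a b c d
    using step assms(1) that by blast
  have 2: "Q a b c d = 0" if "a \<in> span S" "b \<in> span S" "c \<in> S" "d \<in> S" for a b c d
    using step[OF that(2), of a c d] 1[of a _ c d] that by (metis Q_swap(1))
  have 3: "Q a b c d = 0" if "a \<in> span S" "b \<in> span S" "c \<in> span S" "d \<in> S" for a b c d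
    using step[OF that(3), of a b d] 2[of a b _ d] that by (metis Q_swap(1,2))
  show ?thesis
    using step[OF assms(5), of a b c] 3[of a b c] assms by (metis Q_swap)
qed

end

context symmetric_quartic
begin

lemma form_refl_at: "mirror u \<Longrightarrow> \<kappa> (refl_at u x) (refl_at u y) = \<kappa> x y"
  using mirror_nonzero[of u] unfolding refl_at_def form_linear
  by (simp add: field_simps form_sym[of u x] form_sym[of u y])

lemma mirror_refl_at:
  assumes w: "mirror w" and u: "mirror u"
  shows "mirror (refl_at w u)"
  unfolding mirror_def
proof (intro conjI ballI impI)
  have \<kappa>: "\<kappa> (refl_at w x) u = \<kappa> x (refl_at w u)" for x
    using form_refl_at[OF w, of "refl_at w x" u] by (simp add: refl_at_twice w)
  show "refl_at w u \<in> V" using u w refl_at_V mirror_V by blast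
  show "\<kappa> (refl_at w u) (refl_at w u) \<noteq> 0" using form_refl_at[OF w] mirror_nonzero[OF u] by simp
  fix x assume x: "x \<in> V" "\<kappa> x (refl_at w u) = 0"
  show "Q (refl_at w u) (refl_at w u) (refl_at w u) x = 0"
    using Q_refl_at[OF w, of u u u "refl_at w x"] mirror_three[OF u refl_at_V[OF w x(1)]] x \<kappa>
    by (simp add: refl_at_twice refl_at_V mirror_V u w)
  fix y z assume y: "y \<in> V" "\<kappa> y (refl_at w u) = 0" and z: "z \<in> V" "\<kappa> z (refl_at w u) = 0"
  show "Q (refl_at w u) x y z = 0"
    using Q_refl_at[OF w, of u "refl_at w x" "refl_at w y" "refl_at w z"] 
      mirror_one[OF u refl_at_V[OF w x(1)] refl_at_V[OF w y(1)] refl_at_V[OF w z(1)]] x y z \<kappa>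
    by (simp add: refl_at_twice refl_at_V mirror_V u w)
qed

lemma not_adj_self: "mirror u \<Longrightarrow> \<not> adj u u"
  using mirror_nonzero[of u] by (auto simp: adj_def)

lemma not_adj_orth: "mirror u \<Longrightarrow> \<kappa> u v = 0 \<Longrightarrow> \<not> adj u v"
  using mirror_nonzero[of u] by (auto simp: adj_def)

text \<open>
  The long root \<open>l\<close> and its image under the short reflection \<open>s\<close>
  form a base of the system \<open>A\<^sub>2\<close> of long roots, which spans the same
  plane.
\<close>

lemma G2_vanish:
  assumes m: "mirror s" "mirror l"
    and gram: "2 * \<kappa> s l = - \<kappa> l l" "2 * \<kappa> l s = - 3 * \<kappa> s s"
    and l0: "Q l l l l = 0"
    and abcd: "a \<in> {s, l}" "b \<in> {s, l}" "c \<in> {s, l}" "d \<in> {s, l}"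
  shows "Q a b c d = 0"
proof -
  define v where "v = refl_at s l"
  have v: "v = l + 3 *s s"
    unfolding v_def refl_at_def using gram(2) mirror_nonzero[OF m(1)] by simp
  have mv: "mirror v" unfolding v_def by (rule mirror_refl_at) fact+
  have vv: "\<kappa> v v = \<kappa> l l" unfolding v_def by (simp add: form_refl_at m)
  have lv: "2 * \<kappa> l v = - \<kappa> l l"
  proof -
    have "2 * \<kappa> l v = 2 * \<kappa> l l + 3 * (2 * \<kappa> s l)"
      unfolding v form_linear by (simp add: form_sym[of l s])
    then show ?thesis unfolding gram(1) by simp
  qed
  have adj: "adj l v" using vv lv by (simp add: adj_def)
  have v0: "Q v v v v = 0" using adj_Q4[OF adj m(2) mv] l0 by simp
  have "Q a b c d = 0" if "a \<in> {l, v}" "b \<in> {l, v}" "c \<in> {l, v}" "d \<in> {l, v}" for a b c d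
    by (rule tree_vanish[of "{l, v}"])
      (use that m mv l0 v0 adj adj_sym[OF adj] not_adj_self[OF m(2)] not_adj_self[OF mv] in auto)
  moreover have "x \<in> span {l, v}" if "x \<in> {s, l}" for x
  proof -
    have "l \<in> span {l, v}" "v \<in> span {l, v}" by (auto intro: span_base)
    moreover have "s = (1/3) *s (v - l)" unfolding v by simp
    ultimately show ?thesis using that by (metis insertE singletonD span_diff span_scale)
  qed
  ultimately show ?thesis using abcd vanish_span[of "{l, v}" a b c d] by blast
qed

text \<open>
  The long roots of \<open>F\<^sub>4\<close> form a system \<open>D\<^sub>4\<close> with
  centre \<open>t1\<close> and outer nodes \<open>t2\<close>, \<open>b2\<close> and
  \<open>b3\<close>. The reflections in the short roots \<open>t3\<close> and
  \<open>t4\<close> permute the outer nodes, so the three orthogonal pairs have the same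
  value, and \<open>D4_relation\<close> makes it zero.
\<close>

lemma F4_vanish:
  assumes m: "mirror t1" "mirror t2" "mirror t3" "mirror t4"
    and N: "\<kappa> t1 t1 = N" "\<kappa> t2 t2 = N" "\<kappa> t3 t3 = N / 2" "\<kappa> t4 t4 = N / 2"
    and gram: "\<kappa> t1 t2 = - N / 2" "\<kappa> t2 t3 = - N / 2" "\<kappa> t3 t4 = - N / 4"
      "\<kappa> t1 t3 = 0" "\<kappa> t1 t4 = 0" "\<kappa> t2 t4 = 0"
    and t0: "Q t1 t1 t1 t1 = 0"
    and abcd: "a \<in> {t1, t2, t3, t4}" "b \<in> {t1, t2, t3, t4}" "c \<in> {t1, t2, t3, t4}" "d \<in> {t1, t2, t3, t4}"
  shows "Q a b c d = 0"
proof -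
  have N0: "N \<noteq> 0" using N(1) mirror_nonzero[OF m(1)] by simp
  have gram': "\<kappa> t2 t1 = - N / 2" "\<kappa> t3 t2 = - N / 2" "\<kappa> t4 t3 = - N / 4"
      "\<kappa> t3 t1 = 0" "\<kappa> t4 t1 = 0" "\<kappa> t4 t2 = 0"
    using gram form_sym by auto
  define b2 where "b2 = refl_at t3 t2"
  define b3 where "b3 = refl_at t4 b2"
  have b2: "b2 = t2 + 2 *s t3"
    unfolding b2_def refl_at_def N gram using N0 by simp
  have b3: "b3 = t2 + 2 *s t3 + 2 *s t4"
    unfolding b3_def b2 refl_at_def form_linear N gram using N0 by simp
  have mb: "mirror b2" "mirror b3" unfolding b3_def b2_def by (intro mirror_refl_at m)+
  note fl = form_linear N gram gram'
  have adj: "adj t1 t2" "adj t1 b2" "adj t1 b3"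
    unfolding adj_def b3 b2 fl by (auto simp: field_simps)
  have o: "\<kappa> t2 b2 = 0" "\<kappa> t2 b3 = 0" "\<kappa> b2 b3 = 0"
    unfolding b3 b2 fl by (auto simp: field_simps)
  have o': "\<kappa> b2 t2 = 0" "\<kappa> b3 t2 = 0" "\<kappa> b3 b2 = 0" using o form_sym by metis+
  have V': "t2 \<in> V" "b2 \<in> V" "b3 \<in> V" using m mb mirror_V by auto
  have r: "refl_at t4 t2 = t2" "refl_at t3 b3 = b3" "refl_at t3 b2 = t2"
    using gram(6) refl_at_twice[OF m(3), of t2]
    unfolding b3 by (auto simp: refl_at_orth fl b2_def)
  have z1: "Q t2 t2 b2 b2 = Q t2 t2 b3 b3"
    using Q_refl_at[OF m(4) V'(1,1,2,2)] by (simp add: r b3_def)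
  have z2: "Q t2 t2 b3 b3 = Q b2 b2 b3 b3"
    using Q_refl_at[OF m(3) V'(1,1,3,3)] by (simp add: r b2_def[symmetric])
  have "3 * Q t2 t2 b2 b2 = 0"
    using D4_relation[OF m(1,2) mb adj o t0] z1 z2 by simp
  then have z: "Q t2 t2 b2 b2 = 0" "Q t2 t2 b3 b3 = 0" "Q b2 b2 b3 b3 = 0"
    using z1 z2 by simp_all
  then have z': "Q b2 b2 t2 t2 = 0" "Q b3 b3 t2 t2 = 0" "Q b3 b3 b2 b2 = 0"
    by (metis Q_swap)+
  have b0: "Q t2 t2 t2 t2 = 0" "Q b2 b2 b2 b2 = 0" "Q b3 b3 b3 b3 = 0"
    using adj_Q4 adj m mb t0 by simp_all
  let ?S = "{t1, t2, b2, b3}"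
  have na: "\<not> adj t2 b2" "\<not> adj t2 b3" "\<not> adj b2 b3" "\<not> adj b2 t2" "\<not> adj b3 t2" "\<not> adj b3 b2"
      "\<not> adj t1 t1" "\<not> adj t2 t2" "\<not> adj b2 b2" "\<not> adj b3 b3"
    using not_adj_orth not_adj_self o o' m mb by auto
  have van: "Q a b c d = 0" if "a \<in> ?S" "b \<in> ?S" "c \<in> ?S" "d \<in> ?S" for a b c d
  proof (rule tree_vanish[OF _ _ _ that])
    show "mirror u \<and> Q u u u u = 0" if "u \<in> ?S" for u
      using that m mb t0 b0 by auto
    show "u = v \<or> adj u v \<or> \<kappa> u v = 0 \<and> Q u u v v = 0" if "u \<in> ?S" "v \<in> ?S" for u v
      using that adj adj[THEN adj_sym] o o' z z' by auto
    show "\<not> (adj u v \<and> adj v w \<and> adj u w)" if "u \<in> ?S" "v \<in> ?S" "w \<in> ?S" for u v w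
      using that na by auto
  qed
  have sp: "x \<in> span ?S" if "x \<in> {t1, t2, t3, t4}" for x
  proof -
    have b: "t1 \<in> span ?S" "t2 \<in> span ?S" "b2 \<in> span ?S" "b3 \<in> span ?S" by (auto intro: span_base)
    have "t3 = (1/2) *s (b2 - t2)" "t4 = (1/2) *s (b3 - b2)"
      unfolding b3 b2 by simp_all
    then have "t3 \<in> span ?S" "t4 \<in> span ?S" using b by (metis span_diff span_scale)+
    then show ?thesis using that b by auto
  qed
  show ?thesis using vanish_span[of ?S a b c d] van sp abcd by blast
qed

text \<open>
  By \<open>Q22_transport\<close> the value at a pair of orthogonal nodes does not change if
  one of them moves along an edge of the diagram and stays orthogonal to the other. In this
  way all pairs are connected to the pair of the nodes 1 and 2, and \<open>D4_relation\<close>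
  at the branch node 3 makes the common value zero. Nodes are counted from 0.
\<close>

lemma E_vanish:
  assumes r: "r = 6 \<or> r = 7 \<or> r = (8::nat)"
    and m: "\<And>i. i < r \<Longrightarrow> mirror (t i)"
    and gram: "\<And>i j. i < r \<Longrightarrow> j < r \<Longrightarrow> 2 * \<kappa> (t i) (t j) = of_int (cartan_E8 ! i ! j) * \<kappa> (t j) (t j)"
    and t0: "Q (t 0) (t 0) (t 0) (t 0) = 0"
    and ijkl: "i < r" "j < r" "k < r" "l < r"
  shows "Q (t i) (t j) (t k) (t l) = 0"
proof -
  define Z where "Z i j = Q (t i) (t i) (t j) (t j)" for i j
  have Zsym: "Z i j = Z j i" for i j unfolding Z_def by (metis Q_swap)
  have six: "0 < r" "1 < r" "Suc 0 < r" "2 < r" "3 < r" "4 < r" "5 < r" using r by auto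
  have adj: "adj (t i) (t j)" if "i < r" "j < r" "cartan_E8 ! i ! j = -1" "cartan_E8 ! j ! i = -1" for i j
    using gram[OF that(1,2)] gram[OF that(2,1)] that(3,4) by (simp add: adj_def form_sym)
  have orth: "\<kappa> (t i) (t j) = 0" if "i < r" "j < r" "cartan_E8 ! i ! j = 0" for i j
    using gram[OF that(1,2)] that(3) by simp
  have T: "Z i j = Z i j'" if "i < r" "j < r" "j' < r" "cartan_E8 ! i ! j = 0" "cartan_E8 ! i ! j' = 0"
    "cartan_E8 ! j ! j' = -1" "cartan_E8 ! j' ! j = -1" for i j j'
    unfolding Z_def by (intro Q22_transport adj m mirror_V orth that)
  note E8 = cartan_E8_def
  have "Z 1 2 = Z 1 0" "Z 0 1 = Z 0 3" "Z 0 3 = Z 0 4" "Z 4 0 = Z 4 2" "Z 0 4 = Z 0 5" "Z 1 4 = Z 1 5"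
    "Z 5 1 = Z 5 3" "Z 5 3 = Z 5 2" "Z 2 5 = Z 2 4"
    by (intro T six; simp add: E8)+
  then have E6: "Z 0 1 = Z 1 2" "Z 0 3 = Z 1 2" "Z 0 4 = Z 1 2" "Z 0 5 = Z 1 2" "Z 1 4 = Z 1 2"
    "Z 1 5 = Z 1 2" "Z 2 4 = Z 1 2" "Z 2 5 = Z 1 2" "Z 3 5 = Z 1 2"
    using Zsym by metis+
  have edge0: "adj (t i) (t j) \<and> Q (t j) (t j) (t j) (t j) = 0" if "i < r" "j < r"
    "cartan_E8 ! i ! j = -1" "cartan_E8 ! j ! i = -1" "Q (t i) (t i) (t i) (t i) = 0" for i j
    using adj[OF that(1-4)] adj_Q4 m that by simp
  have q6: "Q (t 2) (t 2) (t 2) (t 2) = 0" "Q (t 3) (t 3) (t 3) (t 3) = 0" "Q (t 1) (t 1) (t 1) (t 1) = 0"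
     "Q (t 4) (t 4) (t 4) (t 4) = 0" "Q (t 5) (t 5) (t 5) (t 5) = 0"
  proof -
    show 2: "Q (t 2) (t 2) (t 2) (t 2) = 0" using edge0[of 0 2] six t0 by (simp add: E8)
    show 3: "Q (t 3) (t 3) (t 3) (t 3) = 0" using edge0[of 2 3] six 2 by (simp add: E8)
    show "Q (t 1) (t 1) (t 1) (t 1) = 0" using edge0[of 3 1] six 3 by (simp add: E8)
    show 4: "Q (t 4) (t 4) (t 4) (t 4) = 0" using edge0[of 3 4] six 3 by (simp add: E8)
    show "Q (t 5) (t 5) (t 5) (t 5) = 0" using edge0[of 4 5] six 4 by (simp add: E8)
  qed
  have "Z 1 2 + Z 1 4 + Z 2 4 = 0"
    unfolding Z_def
    by (rule D4_relation[of "t 3"]; (intro m adj orth six q6)?; simp add: E8)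
  then have z12: "Z 1 2 = 0" using E6 by simp
  have q7: "Q (t 6) (t 6) (t 6) (t 6) = 0" if "6 < r"
    using edge0[of 5 6] six q6 that by (simp add: E8)
  have q8: "Q (t 7) (t 7) (t 7) (t 7) = 0" if "7 < r"
    using edge0[of 6 7] six q7 that by (simp add: E8)
  have E7: "Z 0 6 = 0" "Z 1 6 = 0" "Z 2 6 = 0" "Z 3 6 = 0" "Z 4 6 = 0" if 6: "6 < r"
  proof -
    have "Z 0 5 = Z 0 6" "Z 1 5 = Z 1 6" "Z 2 5 = Z 2 6" "Z 3 5 = Z 3 6" "Z 6 3 = Z 6 4"
      by (intro T six 6; simp add: E8)+
    then show "Z 0 6 = 0" "Z 1 6 = 0" "Z 2 6 = 0" "Z 3 6 = 0" "Z 4 6 = 0"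
      using E6 z12 Zsym by metis+
  qed
  have E8': "Z 0 7 = 0" "Z 1 7 = 0" "Z 2 7 = 0" "Z 3 7 = 0" "Z 4 7 = 0" "Z 5 7 = 0" if 7: "7 < r"
  proof -
    have 6: "6 < r" using 7 by simp
    have "Z 0 6 = Z 0 7" "Z 1 6 = Z 1 7" "Z 2 6 = Z 2 7" "Z 3 6 = Z 3 7" "Z 4 6 = Z 4 7" "Z 7 4 = Z 7 5"
      by (intro T six 6 7; simp add: E8)+
    then show "Z 0 7 = 0" "Z 1 7 = 0" "Z 2 7 = 0" "Z 3 7 = 0" "Z 4 7 = 0" "Z 5 7 = 0"
      using E7[OF 6] Zsym by metis+
  qed
  have lt8: "i \<in> {0..<8}" if "i < r" for i using that r by auto
  have pairs: "\<forall>i\<in>{0..<8}. \<forall>j\<in>{0..<8}. cartan_E8 ! i ! j = 0 \<and> i < j \<longrightarrow>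
      (i, j) \<in> {(0,1),(0,3),(0,4),(0,5),(1,2),(1,4),(1,5),(2,4),(2,5),(3,5),
        (0,6),(1,6),(2,6),(3,6),(4,6),(0,7),(1,7),(2,7),(3,7),(4,7),(5,7)}"
    by code_simp
  have Z0: "Z i j = 0" if ij: "i < r" "j < r" "cartan_E8 ! i ! j = 0" "i < j" for i j
    using pairs[rule_format, OF lt8[OF ij(1)] lt8[OF ij(2)] conjI[OF ij(3,4)]] ij(2) E6 E7 E8' z12
    by auto
  have Z0': "Z i j = 0" if ij: "i < r" "j < r" "cartan_E8 ! i ! j = 0" "cartan_E8 ! j ! i = 0" "i \<noteq> j" for i j
    using Z0[of i j] Z0[of j i] ij Zsym by (metis nat_neq_iff)
  have q: "Q (t i) (t i) (t i) (t i) = 0" if "i < r" for i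
  proof -
    have "i = 0 \<or> i = 1 \<or> i = 2 \<or> i = 3 \<or> i = 4 \<or> i = 5 \<or> i = 6 \<or> i = 7"
      using that r by auto
    then show ?thesis using that q6 q7 q8 t0 by auto
  qed
  have entries: "\<forall>i\<in>{0..<8}. \<forall>j\<in>{0..<8}. i = j \<or> 
      cartan_E8 ! i ! j = -1 \<and> cartan_E8 ! j ! i = -1 \<or> cartan_E8 ! i ! j = 0 \<and> cartan_E8 ! j ! i = 0"
    by code_simp
  have edges: "\<forall>i\<in>{0..<8}. \<forall>j\<in>{0..<8}. cartan_E8 ! i ! j = -1 \<longrightarrow>
      (i, j) \<in> {(0,2),(2,0),(2,3),(3,2),(1,3),(3,1),(3,4),(4,3),(4,5),(5,4),(5,6),(6,5),(6,7),(7,6)}"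
    by code_simp
  \<comment> \<open>A tree is bipartite, and a bipartite graph has no triangle.\<close>
  have bipartite: "(i \<in> {0, 3, 5, 7}) \<noteq> (j \<in> {0, 3, 5, 7})"
    if "i < r" "j < r" "cartan_E8 ! i ! j = -1" for i j
    using edges[rule_format, OF lt8[OF that(1)] lt8[OF that(2)] that(3)] by auto
  have adjD: "cartan_E8 ! i ! j = -1" if "i < r" "j < r" "adj (t i) (t j)" for i j
  proof -
    have "of_int (cartan_E8 ! i ! j) * \<kappa> (t j) (t j) = - \<kappa> (t j) (t j)"
      using gram[OF that(1,2)] that(3) by (simp add: adj_def)
    then have "(of_int (cartan_E8 ! i ! j) + 1) * \<kappa> (t j) (t j) = 0"
      by (simp add: algebra_simps)
    then have "of_int (cartan_E8 ! i ! j) = (-1 :: complex)"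
      using mirror_nonzero[OF m[OF that(2)]] by (simp add: eq_neg_iff_add_eq_0)
    then show ?thesis by (metis of_int_eq_iff of_int_minus of_int_1)
  qed
  let ?S = "t ` {..<r}"
  have index: "\<exists>i<r. u = t i" if "u \<in> ?S" for u using that by auto
  show ?thesis
  proof (rule tree_vanish[of ?S])
    show "mirror u \<and> Q u u u u = 0" if "u \<in> ?S" for u
      using that m q by auto
    show "u = v \<or> adj u v \<or> \<kappa> u v = 0 \<and> Q u u v v = 0" if "u \<in> ?S" "v \<in> ?S" for u v
    proof -
      obtain i where i: "i < r" "u = t i" using index[OF \<open>u \<in> ?S\<close>] by blast
      obtain j where j: "j < r" "v = t j" using index[OF \<open>v \<in> ?S\<close>] by blast
      note ij = i(1) j(1) i(2) j(2)
      consider "i = j" | "cartan_E8 ! i ! j = -1" "cartan_E8 ! j ! i = -1"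
        | "i \<noteq> j" "cartan_E8 ! i ! j = 0" "cartan_E8 ! j ! i = 0"
        using entries[rule_format, OF lt8[OF ij(1)] lt8[OF ij(2)]] by argo
      then show ?thesis
      proof cases
        case 2 then show ?thesis using adj[OF ij(1,2)] ij by simp
      next
        case 3 then show ?thesis using orth[OF ij(1,2)] Z0'[OF ij(1,2)] ij by (simp add: Z_def)
      qed (simp add: ij)
    qed
    show "\<not> (adj u v \<and> adj v w \<and> adj u w)" if "u \<in> ?S" "v \<in> ?S" "w \<in> ?S" for u v w
    proof -
      obtain i where i: "i < r" "u = t i" using index[OF \<open>u \<in> ?S\<close>] by blast
      obtain j where j: "j < r" "v = t j" using index[OF \<open>v \<in> ?S\<close>] by blast
      obtain k where k: "k < r" "w = t k" using index[OF \<open>w \<in> ?S\<close>] by blast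
      note ijk = i(1) j(1) k(1) i(2) j(2) k(2)
      show ?thesis
      proof
        assume "adj u v \<and> adj v w \<and> adj u w"
        then have a: "adj (t i) (t j)" "adj (t j) (t k)" "adj (t i) (t k)"
          by (simp_all only: ijk(4-6))
        show False
          using bipartite[OF ijk(1,2) adjD[OF ijk(1,2) a(1)]]
            bipartite[OF ijk(2,3) adjD[OF ijk(2,3) a(2)]]
            bipartite[OF ijk(1,3) adjD[OF ijk(1,3) a(3)]]
          by blast
      qed
    qed
  qed (use ijkl in auto)
qed

text \<open>
  The root at which quartic forms are normalised. It has to be long, since the subsystems
  \<open>A\<^sub>2\<close> and \<open>D\<^sub>4\<close> above consist of long roots.
\<close>

definition (in -) long_root_index :: "exceptional \<Rightarrow> nat" where
  "long_root_index X = (if X = G2 then 1 else 0)"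

lemma exceptional_vanish:
  fixes t :: "nat \<Rightarrow> 'v"
  assumes A_def: "A = cartan_matrix X"
    and m: "\<And>i. i < length A \<Longrightarrow> mirror (t i)"
    and gram: "\<And>i j. i < length A \<Longrightarrow> j < length A \<Longrightarrow> 2 * \<kappa> (t i) (t j) = of_int (A ! i ! j) * \<kappa> (t j) (t j)"
    and long: "\<And>l. l = long_root_index X \<Longrightarrow> Q (t l) (t l) (t l) (t l) = 0"
    and ijkl: "i < length A" "j < length A" "k < length A" "l < length A"
  shows "Q (t i) (t j) (t k) (t l) = 0"
proof (cases "X = G2 \<or> X = F4")
  case False
  let ?r = "length A"
  have len8: "length cartan_E8 = 8" by (simp add: cartan_E8_def)
  have r: "?r = 6 \<or> ?r = 7 \<or> ?r = 8" using False by (cases X) (auto simp: A_def len8)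
  have A: "A ! i ! j = cartan_E8 ! i ! j" if "i < ?r" "j < ?r" for i j
    using that False by (cases X) (auto simp: A_def len8)
  show ?thesis
  proof (rule E_vanish[OF r])
    show "2 * \<kappa> (t i) (t j) = of_int (cartan_E8 ! i ! j) * \<kappa> (t j) (t j)" if "i < ?r" "j < ?r" for i j
      using gram[OF that] unfolding A[OF that] .
    show "Q (t 0) (t 0) (t 0) (t 0) = 0"
      using long False by (simp add: long_root_index_def)
  qed (fact m ijkl)+
next
  case True
  then show ?thesis
  proof
    assume X: "X = G2"
    have len: "length A = 2" using X by (simp add: A_def)
    have in2: "t n \<in> {t 0, t 1}" if "n < length A" for n using that len by (auto simp: less_2_cases_iff)
    have g: "2 * \<kappa> (t 0) (t 1) = - \<kappa> (t 1) (t 1)" "2 * \<kappa> (t 1) (t 0) = - 3 * \<kappa> (t 0) (t 0)"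
      using gram[of 0 1] gram[of 1 0] X len by (simp_all add: A_def)
    show ?thesis
      by (rule G2_vanish[OF m m g _ in2 in2 in2 in2])
        (use long[of 1] X len ijkl in \<open>auto simp: long_root_index_def\<close>)
  next
    assume X: "X = F4"
    have len: "length A = 4" using X by (simp add: A_def)
    have four: "n < 4 \<longleftrightarrow> n = 0 \<or> n = 1 \<or> n = 2 \<or> n = 3" for n :: nat by auto
    have s: "\<kappa> (t 1) (t 0) = \<kappa> (t 0) (t 1)" "\<kappa> (t 2) (t 1) = \<kappa> (t 1) (t 2)" "\<kappa> (t 3) (t 2) = \<kappa> (t 2) (t 3)"
      using form_sym by auto
    have g: "2 * \<kappa> (t 0) (t 1) = - \<kappa> (t 1) (t 1)" "2 * \<kappa> (t 0) (t 1) = - \<kappa> (t 0) (t 0)" 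
      "2 * \<kappa> (t 1) (t 2) = - 2 * \<kappa> (t 2) (t 2)" "2 * \<kappa> (t 1) (t 2) = - \<kappa> (t 1) (t 1)" 
      "2 * \<kappa> (t 2) (t 3) = - \<kappa> (t 3) (t 3)" "2 * \<kappa> (t 2) (t 3) = - \<kappa> (t 2) (t 2)" 
      "\<kappa> (t 0) (t 2) = 0" "\<kappa> (t 0) (t 3) = 0" "\<kappa> (t 1) (t 3) = 0"
      using gram[of 0 1] gram[of 1 0] gram[of 1 2] gram[of 2 1] gram[of 2 3] gram[of 3 2]
        gram[of 0 2] gram[of 0 3] gram[of 1 3] X len unfolding s by (simp_all add: A_def)
    let ?N = "\<kappa> (t 0) (t 0)"
    have 1: "\<kappa> (t 0) (t 1) = - ?N / 2" using g(2) by (simp add: field_simps)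
    have 2: "\<kappa> (t 1) (t 1) = ?N" using g(1,2) by simp
    have 3: "\<kappa> (t 1) (t 2) = - ?N / 2" using g(4) 2 by (simp add: field_simps)
    have 4: "\<kappa> (t 2) (t 2) = ?N / 2" using g(3) 3 by (simp add: field_simps)
    have 5: "\<kappa> (t 2) (t 3) = - ?N / 4" using g(6) 4 by (simp add: field_simps)
    have 6: "\<kappa> (t 3) (t 3) = ?N / 2" using g(5) 5 by (simp add: field_simps)
    have in4: "t i \<in> {t 0, t 1, t 2, t 3}" if "i < 4" for i using that four by auto
    show ?thesis
      by (rule F4_vanish[OF m m m m HOL.refl 2 4 6 1 3 5 g(7,8,9)])
        (use long[of 0] X len ijkl in4 in \<open>simp_all add: long_root_index_def\<close>)
  qed
qed

end

section \<open>Weight vectors for a Cartan subalgebra\<close>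

context complex_lie_algebra
begin

text \<open>
  Subtracting \<open>\<nu>\<close> times the sum from its image under \<open>brk k\<close>
  removes the component with eigenvalue \<open>\<nu>\<close>.
\<close>

lemma eigenvectors_independent:
  assumes "finite M" "\<forall>\<mu>\<in>M. brk k (f \<mu>) = \<mu> *s f \<mu>" "(\<Sum>\<mu>\<in>M. f \<mu>) = 0"
  shows "\<forall>\<mu>\<in>M. f \<mu> = 0"
  using assms
proof (induction M arbitrary: f rule: finite_induct)
  case (insert \<nu> M)
  have zero: "f \<nu> + (\<Sum>\<mu>\<in>M. f \<mu>) = 0"
    using insert.prems(2) insert.hyps by simp
  have "brk k (f \<nu> + (\<Sum>\<mu>\<in>M. f \<mu>)) - \<nu> *s (f \<nu> + (\<Sum>\<mu>\<in>M. f \<mu>)) = 0"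
    unfolding zero by (simp add: brk_0)
  moreover have "brk k (f \<nu>) = \<nu> *s f \<nu>" "(\<Sum>\<mu>\<in>M. brk k (f \<mu>)) = (\<Sum>\<mu>\<in>M. \<mu> *s f \<mu>)"
    using insert.prems(1) by (auto intro: sum.cong)
  ultimately have "(\<Sum>\<mu>\<in>M. \<mu> *s f \<mu>) - \<nu> *s (\<Sum>\<mu>\<in>M. f \<mu>) = 0"
    by (simp add: brk_add brk_sum scale_right_distrib)
  then have "(\<Sum>\<mu>\<in>M. (\<mu> - \<nu>) *s f \<mu>) = 0"
    by (simp add: scale_left_diff_distrib sum_subtractf scale_sum_right)
  then have "\<forall>\<mu>\<in>M. (\<mu> - \<nu>) *s f \<mu> = 0"
    using insert.prems(1)
    by (intro insert.IH) (auto simp: brk_scale scale_left_commute)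
  then have M0: "\<forall>\<mu>\<in>M. f \<mu> = 0"
    using insert.hyps by auto
  then have "f \<nu> = 0" using zero by simp
  with M0 show ?case by simp
qed simp

lemma eigen_decomposition:
  assumes "x \<in> span {y. \<exists>c. brk k y = c *s y}"
  shows "\<exists>M f. finite M \<and> (\<forall>\<mu>\<in>M. brk k (f \<mu>) = \<mu> *s f \<mu>) \<and> x = (\<Sum>\<mu>\<in>M. f \<mu>)"
  using assms
proof (induction rule: span_induct_alt)
  case base
  show ?case by (rule exI[of _ "{}"]) simp
next
  case (step c y z)
  then obtain M f \<nu> where M: "finite M" "\<forall>\<mu>\<in>M. brk k (f \<mu>) = \<mu> *s f \<mu>" "z = (\<Sum>\<mu>\<in>M. f \<mu>)"
    and y: "brk k y = \<nu> *s y" by blast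
  define f0 where "f0 \<mu> = (if \<mu> \<in> M then f \<mu> else 0)" for \<mu>
  define f' where "f' \<mu> = f0 \<mu> + (if \<mu> = \<nu> then c *s y else 0)" for \<mu>
  have "(\<Sum>\<mu>\<in>insert \<nu> M. f' \<mu>) = (\<Sum>\<mu>\<in>insert \<nu> M. f0 \<mu>) + c *s y"
    unfolding f'_def using M(1) by (simp add: sum.distrib)
  also have "(\<Sum>\<mu>\<in>insert \<nu> M. f0 \<mu>) = (\<Sum>\<mu>\<in>M. f \<mu>)"
    using M(1) by (intro sum.mono_neutral_cong_right) (auto simp: f0_def)
  finally have "c *s y + z = (\<Sum>\<mu>\<in>insert \<nu> M. f' \<mu>)" using M(3) by simp
  moreover have "\<forall>\<mu>\<in>insert \<nu> M. brk k (f' \<mu>) = \<mu> *s f' \<mu>"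
    using M(2) y unfolding f'_def f0_def
    by (auto simp: brk_add brk_scale brk_0 scale_right_distrib scale_left_commute)
  ultimately show ?case using M(1) by (intro exI[of _ "insert \<nu> M"] exI[of _ f']) simp
qed

definition weight_vec :: "'g set \<Rightarrow> 'g \<Rightarrow> bool" where
  "weight_vec F x \<longleftrightarrow> (\<forall>h\<in>F. \<exists>c. brk h x = c *s x)"

text \<open>
  Decompose \<open>x\<close> into eigenvectors of \<open>k\<close>. An operator that commutes
  with \<open>brk k\<close> and has \<open>x\<close> as an eigenvector acts on every component
  by the same scalar, by independence.
\<close>

lemma weight_vec_insert:
  assumes comm: "\<And>h. h \<in> F \<Longrightarrow> brk k h = 0"
    and diag: "span {y. \<exists>c. brk k y = c *s y} = UNIV"
    and x: "weight_vec F x"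
  shows "x \<in> span {x. weight_vec (insert k F) x}"
proof -
  obtain M f where M: "finite M" "\<forall>\<mu>\<in>M. brk k (f \<mu>) = \<mu> *s f \<mu>" "x = (\<Sum>\<mu>\<in>M. f \<mu>)"
    using eigen_decomposition[of x k] diag by blast
  have "weight_vec (insert k F) (f \<mu>)" if "\<mu> \<in> M" for \<mu>
    unfolding weight_vec_def
  proof
    fix h assume "h \<in> insert k F"
    then consider "h = k" | "h \<in> F" by blast
    then show "\<exists>c. brk h (f \<mu>) = c *s f \<mu>"
    proof cases
      case 1 then show ?thesis using M(2) that by blast
    next
      case 2
      obtain c where c: "brk h x = c *s x" using x 2 by (auto simp: weight_vec_def)
      have kh: "brk k (brk h y) = brk h (brk k y)" for y
        using brk_brk_left[of k h y] comm[OF 2] by (simp add: brk_0)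
      have "\<forall>\<mu>\<in>M. brk h (f \<mu>) - c *s f \<mu> = 0"
      proof (rule eigenvectors_independent[OF M(1), of k])
        show "\<forall>\<mu>\<in>M. brk k (brk h (f \<mu>) - c *s f \<mu>) = \<mu> *s (brk h (f \<mu>) - c *s f \<mu>)"
          using M(2) by (simp add: brk_diff brk_scale kh scale_right_diff_distrib scale_left_commute)
        show "(\<Sum>\<mu>\<in>M. brk h (f \<mu>) - c *s f \<mu>) = 0"
          using c unfolding M(3) by (simp add: sum_subtractf brk_sum scale_sum_right)
      qed
      then show ?thesis using that by (intro exI[of _ c]) simp
    qed
  qed
  then show ?thesis unfolding M(3) by (intro span_sum span_base) simp
qed

text \<open>
  The elements of \<open>H\<close> are diagonalised one after the other, along a basis of
  \<open>H\<close>.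
\<close>

lemma weight_vectors_span:
  assumes "cartan_subalgebra H"
  shows "span {x. weight_vec H x} = UNIV"
proof -
  have comm: "brk h h' = 0" if "h \<in> H" "h' \<in> H" for h h'
    using assms that unfolding cartan_subalgebra_def by blast
  have diag: "span {y. \<exists>c. brk h y = c *s y} = UNIV" if "h \<in> H" for h
    using assms that unfolding cartan_subalgebra_def by blast
  obtain S where S: "S \<subseteq> H" "independent S" "H \<subseteq> span S"
    by (rule basis_exists[of H])
  have fin: "span {x. weight_vec F x} = UNIV" if "finite F" "F \<subseteq> H" for F
    using that
  proof (induction F rule: finite_induct)
    case empty
    show ?case by (simp add: weight_vec_def)
  next
    case (insert k F)
    have "{x. weight_vec F x} \<subseteq> span {x. weight_vec (insert k F) x}"
      using weight_vec_insert[of F k] comm diag insert.prems by blast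
    then have "span {x. weight_vec F x} \<subseteq> span {x. weight_vec (insert k F) x}"
      by (rule span_minimal) (rule subspace_span)
    moreover have "span {x. weight_vec F x} = UNIV" using insert.IH insert.prems by blast
    ultimately show ?case by blast
  qed
  have US: "span {x. weight_vec S x} = UNIV"
    by (rule fin[OF finiteI_independent[OF S(2)] S(1)])
  have "weight_vec H x" if "weight_vec S x" for x
  proof -
    have "subspace {h. \<exists>c. brk h x = c *s x}"
    proof (rule subspaceI)
      show "0 \<in> {h. \<exists>c. brk h x = c *s x}" by (auto simp: brk_0 intro: exI[of _ 0])
      show "y + z \<in> {h. \<exists>c. brk h x = c *s x}"
        if "y \<in> {h. \<exists>c. brk h x = c *s x}" "z \<in> {h. \<exists>c. brk h x = c *s x}" for y z
        using that by (auto simp: brk_add scale_left_distrib[symmetric])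
      show "a *s y \<in> {h. \<exists>c. brk h x = c *s x}" if "y \<in> {h. \<exists>c. brk h x = c *s x}" for a y
        using that by (auto simp: brk_scale)
    qed
    then have "span S \<subseteq> {h. \<exists>c. brk h x = c *s x}"
      using that by (intro span_minimal) (auto simp: weight_vec_def)
    then show ?thesis using S by (auto simp: weight_vec_def)
  qed
  then have "span {x. weight_vec S x} \<subseteq> span {x. weight_vec H x}"
    by (intro span_mono) blast
  then show ?thesis using US by blast
qed

end

locale simple_roots = killing_lie_algebra scale Basis brk
  for scale :: "complex \<Rightarrow> 'g::ab_group_add \<Rightarrow> 'g" (infixr "*s" 75)
    and Basis :: "'g set" and brk :: "'g \<Rightarrow> 'g \<Rightarrow> 'g" +
  fixes H :: "'g set" and r :: nat and \<alpha> :: "nat \<Rightarrow> 'g \<Rightarrow> complex" and t :: "nat \<Rightarrow> 'g"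
  assumes cartan: "cartan_subalgebra H"
    and base: "root_base H r \<alpha>"
    and t_H: "i < r \<Longrightarrow> t i \<in> H"
    and t_\<alpha>: "i < r \<Longrightarrow> h \<in> H \<Longrightarrow> killing (t i) h = \<alpha> i h"
    and t_norm: "i < r \<Longrightarrow> killing (t i) (t i) \<noteq> 0"
begin

lemma subspace_H: "subspace H"
  using cartan unfolding cartan_subalgebra_def by blast

lemma brk_H: "h \<in> H \<Longrightarrow> h' \<in> H \<Longrightarrow> brk h h' = 0"
  using cartan unfolding cartan_subalgebra_def by blast

lemma centralizer_H: "(\<And>h. h \<in> H \<Longrightarrow> brk h x = 0) \<Longrightarrow> x \<in> H"
  using cartan unfolding cartan_subalgebra_def by blast

text \<open>
  A weight vector that all of \<open>H\<close> annihilates lies in \<open>H\<close>. So it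
  suffices to treat \<open>H\<close> and the vectors with a nonzero weight.
\<close>

lemma weight_induct:
  assumes "subspace S" "\<And>h. h \<in> H \<Longrightarrow> h \<in> S"
    and "\<And>x h c. weight_vec H x \<Longrightarrow> h \<in> H \<Longrightarrow> brk h x = c *s x \<Longrightarrow> c \<noteq> 0 \<Longrightarrow> x \<in> S"
  shows "x \<in> S"
proof -
  have "{x. weight_vec H x} \<subseteq> S"
  proof
    fix x assume "x \<in> {x. weight_vec H x}"
    then have x: "weight_vec H x" by simp
    show "x \<in> S"
    proof (cases "\<forall>h\<in>H. brk h x = 0")
      case True
      then show ?thesis using centralizer_H assms(2) by blast
    next
      case False
      then obtain h where "h \<in> H" "brk h x \<noteq> 0" by blast
      moreover then obtain c where "brk h x = c *s x" using x by (auto simp: weight_vec_def)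
      ultimately show ?thesis using assms(3)[OF x] by (metis scale_zero_left)
    qed
  qed
  then show ?thesis using span_minimal[OF _ assms(1)] weight_vectors_span[OF cartan] by blast
qed

lemma weight_root:
  assumes x: "weight_vec H x" "x \<noteq> 0" and h: "h \<in> H" "brk h x = c *s x" "c \<noteq> 0"
  shows "\<exists>\<beta>\<in>roots H. \<forall>h\<in>H. brk h x = \<beta> h *s x"
proof -
  obtain l where l: "\<And>h. h \<in> H \<Longrightarrow> brk h x = l h *s x"
    using bchoice[OF x(1)[unfolded weight_vec_def]] by blast
  have add: "h + h' \<in> H" if "h \<in> H" "h' \<in> H" for h h'
    by (rule subspace_add[OF subspace_H that])
  have scl: "a *s h \<in> H" if "h \<in> H" for h a
    by (rule subspace_scale[OF subspace_H that])
  have "l (h + h') = l h + l h'" if "h \<in> H" "h' \<in> H" for h h'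
  proof -
    have "l (h + h') *s x = (l h + l h') *s x"
      using l[OF that(1)] l[OF that(2)] l[OF add[OF that]] by (simp add: brk_add scale_left_distrib)
    then show ?thesis using x(2) by simp
  qed
  moreover have "l (a *s h) = a * l h" if "h \<in> H" for a h
  proof -
    have "l (a *s h) *s x = brk (a *s h) x" by (rule l[OF scl[OF that], symmetric])
    also have "\<dots> = (a * l h) *s x" by (simp add: brk_scale l[OF that])
    finally have "l (a *s h) *s x = (a * l h) *s x" .
    then show ?thesis using x(2) by simp
  qed
  ultimately have "lin_on scale (*) H (restrict l H)"
    using add scl by (simp add: lin_on_def)
  moreover have "l h \<noteq> 0" using l[OF h(1)] h x(2) by auto
  moreover have "x \<in> root_space H (restrict l H)"
    using l by (simp add: root_space_def)
  ultimately have "restrict l H \<in> roots H"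
    using h(1) x(2) by (auto simp: roots_def)
  then show ?thesis using l by (intro bexI[of _ "restrict l H"]) auto
qed

text \<open>
  Every root is a combination of simple roots, so \<open>h\<close> is central. A central
  element is orthogonal to everything for the Killing form.
\<close>

lemma separate_H:
  assumes h: "h \<in> H" "\<And>i. i < r \<Longrightarrow> \<alpha> i h = 0"
  shows "h = 0"
proof -
  have "x \<in> {x. brk h x = 0}" for x
  proof (rule weight_induct)
    show "subspace {x. brk h x = 0}"
      by (rule subspaceI) (auto simp: brk_0 brk_add brk_scale)
    show "h' \<in> {x. brk h x = 0}" if "h' \<in> H" for h' using brk_H h that by simp
    show "x \<in> {x. brk h x = 0}" if x: "weight_vec H x" "h' \<in> H" "brk h' x = c *s x" "c \<noteq> 0" for x h' c
    proof (cases "x = 0")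
      case False
      obtain \<beta> where \<beta>: "\<beta> \<in> roots H" "\<forall>h\<in>H. brk h x = \<beta> h *s x"
        using weight_root[OF x(1) False x(2-4)] by blast
      obtain k :: "nat \<Rightarrow> int" where "\<forall>h\<in>H. \<beta> h = (\<Sum>i<r. of_int (k i) * \<alpha> i h)"
        using base \<beta>(1) unfolding root_base_def by blast
      then have "\<beta> h = 0" using h by simp
      then show ?thesis using \<beta>(2) h(1) by simp
    qed (simp add: brk_0)
  qed
  then have "brk h = (\<lambda>_. 0)" by auto
  then have "killing h y = 0" for y
    using lin_form_0[OF lin_form_coord] by (simp add: killing_tr tr_def)
  then show ?thesis by (rule nondegenerate)
qed

lemma H_orthogonal_root:
  assumes "z \<in> H" "h \<in> H" "brk h x = c *s x" "c \<noteq> 0"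
  shows "killing z x = 0"
proof -
  have "c * killing z x = killing z (brk h x)" by (simp add: assms(3) killing_scale)
  also have "\<dots> = killing (brk z h) x" by (rule killing_invariant[symmetric])
  also have "\<dots> = 0" using brk_H assms by (simp add: killing_0)
  finally show ?thesis using assms(4) by simp
qed

lemma killing_eq_on_H:
  assumes "z \<in> H" "z' \<in> H" "\<And>h. h \<in> H \<Longrightarrow> killing z h = killing z' h"
  shows "z = z'"
proof (rule killing_eqI)
  fix x
  have "x \<in> {x. killing z x = killing z' x}"
  proof (rule weight_induct)
    show "subspace {x. killing z x = killing z' x}"
      by (rule subspaceI) (auto simp: killing_0 killing_add killing_scale)
    show "x \<in> {x. killing z x = killing z' x}" if "weight_vec H x" "h \<in> H" "brk h x = c *s x" "c \<noteq> 0" for x h c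
      using H_orthogonal_root[OF assms(1) that(2-4)] H_orthogonal_root[OF assms(2) that(2-4)] by simp
  qed (use assms(3) in simp)
  then show "killing z x = killing z' x" by simp
qed

text \<open>
  A weight vector \<open>f\<close> that pairs nontrivially with a root vector \<open>e\<close>
  has the opposite weight. Normalise the pairing to 1. Then \<open>brk e f\<close> and
  \<open>t i\<close> are elements of \<open>H\<close> with the same Killing products.
\<close>

lemma sl2_triple:
  assumes i: "i < r"
  shows "\<exists>e f. brk e f = t i \<and> (\<forall>h\<in>H. brk h e = \<alpha> i h *s e \<and> brk h f = (- \<alpha> i h) *s f)"
proof -
  have \<alpha>: "\<alpha> i \<in> roots H" using base i unfolding root_base_def by blast
  then have "root_space H (\<alpha> i) \<noteq> {0}" unfolding roots_def by blast
  moreover have "0 \<in> root_space H (\<alpha> i)" by (simp add: root_space_def brk_0)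
  ultimately obtain e where "e \<in> root_space H (\<alpha> i)" "e \<noteq> 0" by blast
  then have e: "brk h e = \<alpha> i h *s e" if "h \<in> H" for h using that by (simp add: root_space_def)
  have "\<not> (\<forall>x. x \<in> {x. killing e x = 0})" using \<open>e \<noteq> 0\<close> nondegenerate by blast
  moreover have "subspace {x. killing e x = 0}"
    by (rule subspaceI) (auto simp: killing_0 killing_add killing_scale)
  ultimately have "\<not> {x. weight_vec H x} \<subseteq> {x. killing e x = 0}"
    using span_minimal[of "{x. weight_vec H x}" "{x. killing e x = 0}"] weight_vectors_span[OF cartan] by blast
  then obtain f0 where f0: "weight_vec H f0" "killing e f0 \<noteq> 0" by blast
  define f where "f = (1 / killing e f0) *s f0"
  have ef: "killing e f = 1" using f0 by (simp add: f_def killing_scale)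
  have f: "brk h f = (- \<alpha> i h) *s f" if h: "h \<in> H" for h
  proof -
    obtain c where c: "brk h f0 = c *s f0" using f0(1) h unfolding weight_vec_def by blast
    have cf: "brk h f = c *s f" unfolding f_def by (simp add: brk_scale c scale_left_commute)
    have "killing (brk h e) f = - killing e (brk h f)" by (rule killing_skew)
    then have "c = - \<alpha> i h" unfolding e[OF that] cf by (simp add: killing_scale ef)
    then show ?thesis using cf by simp
  qed
  have "brk e f \<in> H"
  proof (rule centralizer_H)
    fix h assume h: "h \<in> H"
    have "brk h (brk e f) = brk (brk h e) f + brk e (brk h f)" by (simp add: brk_brk_left)
    also have "\<dots> = 0" unfolding e[OF h] f[OF h] by (simp add: brk_scale brk_minus)
    finally show "brk h (brk e f) = 0" .
  qed
  then have "brk e f = t i"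
  proof (rule killing_eq_on_H[OF _ t_H[OF i]])
    fix h assume h: "h \<in> H"
    have "killing (brk e f) h = killing e (brk f h)" by (rule killing_invariant)
    also have "brk f h = \<alpha> i h *s f" using brk_skew[of f h] f[OF h] by simp
    finally show "killing (brk e f) h = killing (t i) h" using ef t_\<alpha>[OF i h] by (simp add: killing_scale)
  qed
  with e f show ?thesis by blast
qed

text \<open>
  The map \<open>L\<close> from \<open>H\<close> to the span of the \<open>t i\<close> is
  injective: an element of its kernel gives a linear relation among the simple roots, so all
  simple roots vanish on it. Compare dimensions.
\<close>

lemma H_eq_span: "H = span (t ` {..<r})"
proof -
  define L where "L v = (\<Sum>i<r. killing (t i) v *s t i)" for v
  have linL: "Vector_Spaces.linear scale scale L"
    unfolding lin_map_iff[symmetric] lin_map_def L_def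
    by (auto simp: killing_add killing_scale scale_left_distrib sum.distrib scale_sum_right)
  have tspan: "span (t ` {..<r}) \<subseteq> H"
    by (rule span_minimal[OF _ subspace_H]) (auto intro: t_H)
  have Lspan: "L v \<in> span (t ` {..<r})" for v
    unfolding L_def by (intro span_sum span_scale span_base) auto
  have inj: "inj_on L H"
  proof (rule inj_onI)
    fix x y assume xy: "x \<in> H" "y \<in> H" "L x = L y"
    have "\<forall>h\<in>H. (\<Sum>i<r. killing (t i) (x - y) * \<alpha> i h) = 0"
    proof
      fix h assume h: "h \<in> H"
      have "(\<Sum>i<r. killing (t i) (x - y) * \<alpha> i h) = killing (\<Sum>i<r. killing (t i) (x - y) *s t i) h"
        using h by (simp add: killing_sum killing_scale t_\<alpha>)
      also have "(\<Sum>i<r. killing (t i) (x - y) *s t i) = L x - L y"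
        unfolding L_def by (simp add: killing_diff scale_left_diff_distrib sum_subtractf)
      finally show "(\<Sum>i<r. killing (t i) (x - y) * \<alpha> i h) = 0" using xy(3) by (simp add: killing_0)
    qed
    then have "\<forall>i<r. killing (t i) (x - y) = 0"
      using conjunct1[OF conjunct2[OF base[unfolded root_base_def]], rule_format, of "\<lambda>i. killing (t i) (x - y)"]
      by simp
    moreover have "x - y \<in> H" using xy subspace_H by (intro subspace_diff)
    ultimately have "x - y = 0" using t_\<alpha> by (intro separate_H) auto
    then show "x = y" by simp
  qed
  have pair: "finite_dimensional_vector_space_pair_1 scale Basis scale"
    by unfold_locales
  have spanH: "span H = H" using subspace_H by (simp only: span_eq_iff)
  have "dim H = dim (L ` H)"
    using finite_dimensional_vector_space_pair_1.dim_image_eq[OF pair linL, of H] inj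
    unfolding spanH by simp
  also have "\<dots> \<le> dim (span (t ` {..<r}))"
    using Lspan by (intro dim_subset) blast
  finally have "span (t ` {..<r}) = H"
    using tspan subspace_H by (intro subspace_dim_equal) auto
  then show ?thesis ..
qed

end

section \<open>Invariant quartic forms on the Lie algebra\<close>

locale invariant_quartic = simple_roots scale Basis brk H r \<alpha> t
  for scale :: "complex \<Rightarrow> 'g::ab_group_add \<Rightarrow> 'g" (infixr "*s" 75)
    and Basis :: "'g set" and brk :: "'g \<Rightarrow> 'g \<Rightarrow> 'g" and H r \<alpha> t +
  fixes Q :: "'g \<Rightarrow> 'g \<Rightarrow> 'g \<Rightarrow> 'g \<Rightarrow> complex"
  assumes quartic_add: "Q (x + y) u v w = Q x u v w + Q y u v w"
    and quartic_scale: "Q (c *s x) u v w = c * Q x u v w"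
    and quartic_swap: "Q x y u v = Q y x u v" "Q x y u v = Q x u y v" "Q x y u v = Q x y v u"
    and quartic_invariant:
      "Q (brk x y) u v w + Q y (brk x u) v w + Q y u (brk x v) w + Q y u v (brk x w) = 0"
begin

sublocale symmetric_quartic scale H killing Q
proof unfold_locales
  show "subspace H" by (rule subspace_H)
  show "killing x y = killing y x" for x y by (rule killing_commute)
  show "Q x y u v = Q y x u v" "Q x y u v = Q x u y v" "Q x y u v = Q x y v u" for x y u v
    by (rule quartic_swap)+
qed (simp_all only: killing_add killing_scale quartic_add quartic_scale)

lemma Q_0: "Q 0 u v w = 0" "Q u 0 v w = 0" "Q u v 0 w = 0" "Q u v w 0 = 0"
  using Q_scale[of 0] Q_scale_right[where c = 0] by simp_all

text \<open>
  Let \<open>e\<close>, \<open>f\<close> be as in \<open>sl2_triple\<close>. For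
  \<open>x\<close>, \<open>y\<close>, \<open>z\<close> annihilated by \<open>e\<close>,
  invariance under \<open>e\<close> at the arguments \<open>f, x, y, z\<close> gives \<open>Q
  (t i) x y z = 0\<close>. At \<open>f, t i, t i, x\<close> and at \<open>e, f, f, x\<close>
  it gives the cubic condition.
\<close>

lemma mirror_simple_root:
  assumes i: "i < r" shows "mirror (t i)"
proof -
  obtain e f where ef: "brk e f = t i" and wt: "\<And>h. h \<in> H \<Longrightarrow> brk h e = \<alpha> i h *s e \<and> brk h f = (- \<alpha> i h) *s f"
    using sl2_triple[OF i] by blast
  have e0: "brk e x = 0" if "x \<in> H" "killing x (t i) = 0" for x
  proof -
    have "\<alpha> i x = 0" using that t_\<alpha>[OF i that(1)] by (simp add: killing_commute)
    then have "brk x e = 0" using wt[OF that(1)] by simp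
    then show ?thesis by (subst brk_skew) simp
  qed
  define a where "a = killing (t i) (t i)"
  have et: "brk e (t i) = (- a) *s e"
  proof -
    have "brk (t i) e = a *s e" using wt[OF t_H[OF i]] t_\<alpha>[OF i t_H[OF i]] by (simp add: a_def)
    then show ?thesis by (subst brk_skew) simp
  qed
  have one: "Q (t i) x y z = 0"
    if "x \<in> H" "y \<in> H" "z \<in> H" "killing x (t i) = 0" "killing y (t i) = 0" "killing z (t i) = 0" for x y z
    using quartic_invariant[of e f x y z] e0 that by (simp add: ef Q_0)
  have three: "Q (t i) (t i) (t i) x = 0" if x: "x \<in> H" "killing x (t i) = 0" for x
  proof -
    have "Q (t i) (t i) (t i) x + Q f ((- a) *s e) (t i) x + Q f (t i) ((- a) *s e) x = 0"
      using quartic_invariant[of e f "t i" "t i" x] e0[OF x] by (simp only: ef et Q_0) simp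
    then have 1: "Q (t i) (t i) (t i) x = a * Q f e (t i) x + a * Q f (t i) e x"
      by (simp only: Q_scale_right) (simp add: algebra_simps)
    have "Q e (t i) f x + Q e f (t i) x = 0"
      using quartic_invariant[of e e f f x] e0[OF x] by (simp add: ef brk_alt Q_0)
    moreover have "Q e (t i) f x = Q f e (t i) x" "Q e f (t i) x = Q f e (t i) x" "Q f (t i) e x = Q f e (t i) x"
      by (metis Q_swap)+
    ultimately show ?thesis using 1 by simp
  qed
  show ?thesis
    unfolding mirror_def using t_H[OF i] t_norm[OF i] one three by blast
qed

text \<open>
  Polarisation at a point \<open>h0\<close> with \<open>l h0 \<noteq> 0\<close>: first all
  arguments are equal to \<open>h0\<close>, then they are replaced one at a time. The next two
  lemmas do the same for more arguments.
\<close>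

lemma descend1:
  assumes l: "l h0 \<noteq> (0::complex)" "h0 \<in> H" "h1 \<in> H"
    and R: "\<And>a b. a \<in> H \<Longrightarrow> b \<in> H \<Longrightarrow> l a * R b + l b * R a = 0"
  shows "R h1 = (0::complex)"
proof -
  have "R h0 = 0" using R[of h0 h0] l by simp
  then show ?thesis using R[of h0 h1] l by simp
qed

lemma descend2:
  assumes l: "l h0 \<noteq> (0::complex)" "h0 \<in> H" "h1 \<in> H" "h2 \<in> H"
    and R: "\<And>a b c. a \<in> H \<Longrightarrow> b \<in> H \<Longrightarrow> c \<in> H \<Longrightarrow> l a * R b c + l b * R a c + l c * R a b = 0"
    and sym: "\<And>a b. R a b = R b a"
  shows "R h1 h2 = (0::complex)"
proof -
  have 0: "R h0 h0 = 0" using R[of h0 h0 h0] l by simp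
  have 1: "R h0 h = 0" if "h \<in> H" for h
    using R[of h0 h0 h] 0 l that by simp
  show ?thesis using R[of h0 h1 h2] 1[OF l(3)] 1[OF l(4)] l by simp
qed

lemma descend3:
  assumes l: "l h0 \<noteq> (0::complex)" "h0 \<in> H" "h1 \<in> H" "h2 \<in> H" "h3 \<in> H"
    and R: "\<And>a b c d. a \<in> H \<Longrightarrow> b \<in> H \<Longrightarrow> c \<in> H \<Longrightarrow> d \<in> H \<Longrightarrow>
      l a * R b c d + l b * R a c d + l c * R a b d + l d * R a b c = 0"
    and sym: "\<And>a b c. R a b c = R b a c" "\<And>a b c. R a b c = R a c b"
  shows "R h1 h2 h3 = (0::complex)"
proof -
  have 0: "R h0 h0 h0 = 0" using R[of h0 h0 h0 h0] l by simp
  have 1: "R h0 h0 h = 0" if "h \<in> H" for h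
    using R[of h0 h0 h0 h] 0 l that by simp
  have 2: "R h0 h h' = 0" if "h \<in> H" "h' \<in> H" for h h'
    using R[of h0 h0 h h'] 1[OF that(1)] 1[OF that(2)] l that by simp
  show ?thesis using R[of h0 h1 h2 h3] 2[OF l(3,4)] 2[OF l(3,5)] 2[OF l(4,5)] l by simp
qed

text \<open>
  By induction on the number of arguments outside \<open>H\<close>. Let \<open>x\<close> be a
  vector of nonzero weight. Invariance under \<open>x\<close>, with one more argument in
  \<open>H\<close>, turns the terms in which \<open>x\<close> acts on the other free arguments
  into values that are already known to vanish. The terms in which \<open>x\<close> acts on
  \<open>H\<close> are multiples of values with \<open>x\<close> itself as an argument, and
  the \<open>descend\<close> lemmas apply to them.
\<close>

lemma vanish_from_H:
  assumes H4: "\<And>a b c d. a \<in> H \<Longrightarrow> b \<in> H \<Longrightarrow> c \<in> H \<Longrightarrow> d \<in> H \<Longrightarrow> Q a b c d = 0"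
  shows "Q a b c d = 0"
proof -
  have lin: "subspace {x. Q x b c d = 0}" for b c d
    by (rule subspaceI) (auto simp: Q_0 Q_add Q_scale)
  have weight: "\<exists>l. (\<forall>h\<in>H. brk x h = (- l h) *s x) \<and> l h0 \<noteq> 0"
    if x: "weight_vec H x" "h0 \<in> H" "brk h0 x = c *s x" "c \<noteq> 0" for x h0 c
  proof (cases "x = 0")
    case True
    then show ?thesis by (intro exI[of _ "\<lambda>_. 1"]) (simp add: brk_0)
  next
    case False
    obtain l where l: "\<And>h. h \<in> H \<Longrightarrow> brk h x = l h *s x"
      using bchoice[OF x(1)[unfolded weight_vec_def]] by blast
    have "l h0 = c" using l[OF x(2)] x(3) False by (metis scale_right_imp_eq)
    moreover have "brk x h = (- l h) *s x" if "h \<in> H" for h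
      using brk_skew[of h x] l[OF that] by (simp add: minus_equation_iff)
    ultimately show ?thesis using x(4) by blast
  qed
  have H3: "Q x b c d = 0" if H: "b \<in> H" "c \<in> H" "d \<in> H" for x b c d
  proof -
    have "x \<in> {x. Q x b c d = 0}"
    proof (rule weight_induct[OF lin])
      fix x h0 k assume x: "weight_vec H x" "h0 \<in> H" "brk h0 x = k *s x" "k \<noteq> 0"
      obtain l where l: "\<And>h. h \<in> H \<Longrightarrow> brk x h = (- l h) *s x" "l h0 \<noteq> 0" using weight[OF x] by blast
      have "l a * Q x b c d + l b * Q x a c d + l c * Q x a b d + l d * Q x a b c = 0"
        if "a \<in> H" "b \<in> H" "c \<in> H" "d \<in> H" for a b c d
      proof -
        have "l a * Q x b c d + l b * Q a x c d + l c * Q a b x d + l d * Q a b c x = 0"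
          using quartic_invariant[of x a b c d] unfolding l(1)[OF that(1)] l(1)[OF that(2)] l(1)[OF that(3)] l(1)[OF that(4)]
          by (simp only: Q_scale Q_scale_right) (simp add: algebra_simps add_eq_0_iff)
        moreover have "Q a x c d = Q x a c d" "Q a b x d = Q x a b d" "Q a b c x = Q x a b c"
          by (metis Q_swap)+
        ultimately show ?thesis by simp
      qed
      then have "Q x b c d = 0"
        by (rule descend3[where l = l and R = "Q x", OF l(2) x(2) H]) (assumption | rule Q_swap)+
      then show "x \<in> {x. Q x b c d = 0}" by simp
    qed (use H4 H in simp)
    then show ?thesis by simp
  qed
  have H2: "Q x y c d = 0" if H: "c \<in> H" "d \<in> H" for x y c d
  proof -
    have "x \<in> {x. Q x y c d = 0}"
    proof (rule weight_induct[OF lin])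
      fix x h0 k assume x: "weight_vec H x" "h0 \<in> H" "brk h0 x = k *s x" "k \<noteq> 0"
      obtain l where l: "\<And>h. h \<in> H \<Longrightarrow> brk x h = (- l h) *s x" "l h0 \<noteq> 0" using weight[OF x] by blast
      have "l a * Q x y b c + l b * Q x y a c + l c * Q x y a b = 0"
        if "a \<in> H" "b \<in> H" "c \<in> H" for a b c
      proof -
        have "l a * Q y x b c + l b * Q y a x c + l c * Q y a b x = 0"
          using quartic_invariant[of x y a b c] H3[OF that, of "brk x y"]
          unfolding l(1)[OF that(1)] l(1)[OF that(2)] l(1)[OF that(3)]
          by (simp only: Q_scale Q_scale_right) (simp add: algebra_simps add_eq_0_iff)
        moreover have "Q y x b c = Q x y b c" "Q y a x c = Q x y a c" "Q y a b x = Q x y a b"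
          by (metis Q_swap)+
        ultimately show ?thesis by simp
      qed
      then have "Q x y c d = 0"
        by (rule descend2[where l = l and R = "Q x y", OF l(2) x(2) H]) (assumption | rule Q_swap)+
      then show "x \<in> {x. Q x y c d = 0}" by simp
    next
      fix x assume "x \<in> H"
      then have "Q y x c d = 0" using H3 H by blast
      then show "x \<in> {x. Q x y c d = 0}" by (simp add: Q_swap(1)[of x y])
    qed
    then show ?thesis by simp
  qed
  have H1: "Q x y z d = 0" if H: "d \<in> H" for x y z d
  proof -
    have "x \<in> {x. Q x y z d = 0}"
    proof (rule weight_induct[OF lin])
      fix x h0 k assume x: "weight_vec H x" "h0 \<in> H" "brk h0 x = k *s x" "k \<noteq> 0"
      obtain l where l: "\<And>h. h \<in> H \<Longrightarrow> brk x h = (- l h) *s x" "l h0 \<noteq> 0" using weight[OF x] by blast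
      have "l a * Q x y z b + l b * Q x y z a = 0" if "a \<in> H" "b \<in> H" for a b
      proof -
        have "l a * Q y z x b + l b * Q y z a x = 0"
          using quartic_invariant[of x y z a b] H2[OF that, of "brk x y" z] H2[OF that, of y "brk x z"]
          unfolding l(1)[OF that(1)] l(1)[OF that(2)]
          by (simp only: Q_scale Q_scale_right) (simp add: algebra_simps add_eq_0_iff)
        moreover have "Q y z x b = Q x y z b" "Q y z a x = Q x y z a"
          by (metis Q_swap)+
        ultimately show ?thesis by simp
      qed
      then have "Q x y z d = 0"
        by (rule descend1[where l = l and R = "Q x y z", OF l(2) x(2) H])
      then show "x \<in> {x. Q x y z d = 0}" by simp
    next
      fix x assume "x \<in> H"
      then have "Q y z x d = 0" using H2 H by blast
      then show "x \<in> {x. Q x y z d = 0}" by simp (metis Q_swap)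
    qed
    then show ?thesis by simp
  qed
  have "a \<in> {x. Q x b c d = 0}"
  proof (rule weight_induct[OF lin])
    fix x h0 k assume x: "weight_vec H x" "h0 \<in> H" "brk h0 x = k *s x" "k \<noteq> 0"
    obtain l where l: "\<And>h. h \<in> H \<Longrightarrow> brk x h = (- l h) *s x" "l h0 \<noteq> 0" using weight[OF x] by blast
    have "l h0 * Q b c d x = 0"
      using quartic_invariant[of x b c d h0] H1[OF x(2), of "brk x b" c d] H1[OF x(2), of b "brk x c" d]
        H1[OF x(2), of b c "brk x d"] unfolding l(1)[OF x(2)]
      by (simp only: Q_scale_right) simp
    then have "Q b c d x = 0" using l(2) by simp
    then show "x \<in> {x. Q x b c d = 0}" by simp (metis Q_swap)
  next
    fix x assume "x \<in> H"
    then have "Q b c d x = 0" using H1 by blast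
    then show "x \<in> {x. Q x b c d = 0}" by simp (metis Q_swap)
  qed
  then show ?thesis by simp
qed

lemma exceptional_quartic_zero:
  assumes A: "A = cartan_matrix X" "length A = r"
    and gram: "\<And>i j. i < r \<Longrightarrow> j < r \<Longrightarrow>
      2 * killing (t i) (t j) = of_int (A ! i ! j) * killing (t j) (t j)"
    and long: "\<And>l. l = long_root_index X \<Longrightarrow> Q (t l) (t l) (t l) (t l) = 0"
  shows "Q a b c d = 0"
proof (rule vanish_from_H)
  have van: "Q a b c d = 0" if abcd: "a \<in> t ` {..<r}" "b \<in> t ` {..<r}" "c \<in> t ` {..<r}" "d \<in> t ` {..<r}" for a b c d
  proof -
    have index: "\<exists>i<r. u = t i" if "u \<in> t ` {..<r}" for u using that by auto
    obtain i where i: "i < r" "a = t i" using index[OF abcd(1)] by blast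
    obtain j where j: "j < r" "b = t j" using index[OF abcd(2)] by blast
    obtain k where k: "k < r" "c = t k" using index[OF abcd(3)] by blast
    obtain l where l: "l < r" "d = t l" using index[OF abcd(4)] by blast
    show ?thesis
      unfolding i(2) j(2) k(2) l(2)
      by (rule exceptional_vanish[OF A(1), unfolded A(2), OF mirror_simple_root gram long i(1) j(1) k(1) l(1)])
  qed
  show "Q a b c d = 0" if "a \<in> H" "b \<in> H" "c \<in> H" "d \<in> H" for a b c d
    by (rule vanish_span[OF van]) (use that H_eq_span in auto)
qed

end

section \<open>The quartic identity and its consequences\<close>

context killing_lie_algebra
begin

lemma tr_0: "tr (\<lambda>_. 0) = 0"
  using lin_form_0[OF lin_form_coord] by (simp add: tr_def)

lemma tr_sum: "tr (\<lambda>v. \<Sum>i\<in>A. f i v) = (\<Sum>i\<in>A. tr (f i))"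
  by (induction A rule: infinite_finite_induct) (simp_all add: tr_0 tr_add)

lemma killing_brk_permute:
  "killing b (brk c a) = killing a (brk b c)" "killing c (brk a b) = killing a (brk b c)"
  "killing a (brk c b) = - killing a (brk b c)" "killing b (brk a c) = - killing a (brk b c)"
  "killing c (brk b a) = - killing a (brk b c)"
proof -
  have rot: "killing v (brk w u) = killing u (brk v w)" for u v w
    unfolding killing_invariant[symmetric, of v] by (rule killing_commute)
  have skew: "killing u (brk w v) = - killing u (brk v w)" for u v w
    by (subst brk_skew) (simp add: killing_minus)
  show 1: "killing b (brk c a) = killing a (brk b c)" by (rule rot)
  show 2: "killing c (brk a b) = killing a (brk b c)" by (rule rot[symmetric])
  show "killing a (brk c b) = - killing a (brk b c)" by (rule skew)
  show "killing b (brk a c) = - killing a (brk b c)" by (simp only: skew[of b a c] 1)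
  show "killing c (brk b a) = - killing a (brk b c)" by (simp only: skew[of c b a] 2)
qed

text \<open>
  Pairing the left side with \<open>z\<close> gives the trace of \<open>brk x \<circ> brk
  z\<close>.
\<close>

lemma casimir: "(\<Sum>b\<in>Basis. brk b (brk (dual_vec b) x)) = x"
proof (rule killing_eqI)
  fix z
  have *: "killing (brk b (brk b' x)) z = killing b' (brk x (brk z b))" for b b'
  proof -
    have "killing (brk b (brk b' x)) z = - killing (brk b' x) (brk b z)" by (rule killing_skew)
    also have "\<dots> = - killing b' (brk x (brk b z))" by (simp only: killing_invariant)
    also have "\<dots> = killing b' (brk x (brk z b))" by (subst brk_skew[of b z]) (simp add: brk_minus killing_minus)
    finally show ?thesis .
  qed
  have "killing (\<Sum>b\<in>Basis. brk b (brk (dual_vec b) x)) z = (\<Sum>b\<in>Basis. killing (brk x (brk z b)) (dual_vec b))"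
    unfolding killing_sum * by (simp only: killing_commute)
  then show "killing (\<Sum>b\<in>Basis. brk b (brk (dual_vec b) x)) z = killing x z"
    unfolding killing_tr[of x z] tr_killing .
qed

lemma tr4_add: "tr4 (x + y) u v w = tr4 x u v w + tr4 y u v w"
  unfolding tr4_def by (simp add: brk_add tr_add)

lemma tr4_scale: "tr4 (c *s x) u v w = c * tr4 x u v w"
  unfolding tr4_def by (simp add: brk_scale tr_scale)

lemma tr4_flip: "tr4 a b c d = tr4 a d c b"
  unfolding tr4_reverse[of a b c d] tr4_cyclic[of a d c b] ..

lemma tr4_brk2: "tr4 a (brk x b) c d = tr5 a x b c d - tr5 a b x c d"
  unfolding tr4_cyclic[of a] tr4_brk1 tr5_cyclic[of a] ..

lemma tr4_brk3: "tr4 a b (brk x c) d = tr5 a b x c d - tr5 a b c x d"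
  unfolding tr4_cyclic[of a] tr4_brk2 tr5_cyclic[of a] ..

lemma tr4_brk4: "tr4 a b c (brk x d) = tr5 a b c x d - tr5 a b c d x"
  unfolding tr4_cyclic[of a] tr4_brk3 tr5_cyclic[of a] ..

lemma tr4_invariant:
  "tr4 (brk x a) b c d + tr4 a (brk x b) c d + tr4 a b (brk x c) d + tr4 a b c (brk x d) = 0"
  unfolding tr4_brk1 tr4_brk2 tr4_brk3 tr4_brk4 using tr5_cyclic[of x a b c d] by simp

text \<open>
  The trace of four skew operators is unchanged by cyclic rotation and by reversal. So the 24
  orderings of the arguments have only three different values, and this is their sum.
\<close>

definition sym_tr4 :: "'g \<Rightarrow> 'g \<Rightarrow> 'g \<Rightarrow> 'g \<Rightarrow> complex" where
  "sym_tr4 a b c d = tr4 a b c d + tr4 a c b d + tr4 a b d c"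

definition sym_killing :: "'g \<Rightarrow> 'g \<Rightarrow> 'g \<Rightarrow> 'g \<Rightarrow> complex" where
  "sym_killing a b c d = killing a b * killing c d + killing a c * killing b d + killing a d * killing b c"

lemma sym_tr4_swap:
  "sym_tr4 a b c d = sym_tr4 b a c d" "sym_tr4 a b c d = sym_tr4 a c b d" "sym_tr4 a b c d = sym_tr4 a b d c"
proof -
  have 1: "tr4 b a c d = tr4 a b d c"
    by (subst tr4_cyclic, subst tr4_flip) (rule HOL.refl)
  have 2: "tr4 b c a d = tr4 a c b d"
    by (subst tr4_cyclic, subst tr4_cyclic, subst tr4_flip) (rule HOL.refl)
  have 3: "tr4 b a d c = tr4 a b c d"
    by (subst tr4_cyclic, subst tr4_flip) (rule HOL.refl)
  have 4: "tr4 a c d b = tr4 a b d c" by (rule tr4_flip)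
  have 5: "tr4 a d b c = tr4 a c b d" by (rule tr4_flip)
  show "sym_tr4 a b c d = sym_tr4 b a c d" "sym_tr4 a b c d = sym_tr4 a c b d" "sym_tr4 a b c d = sym_tr4 a b d c"
    unfolding sym_tr4_def 1 2 3 4 5 by simp_all
qed

lemma sym_killing_swap:
  "sym_killing a b c d = sym_killing b a c d" "sym_killing a b c d = sym_killing a c b d"
  "sym_killing a b c d = sym_killing a b d c"
  by (simp_all add: sym_killing_def killing_commute[of b a] killing_commute[of c b] killing_commute[of d c])

lemma sym_tr4_invariant:
  "sym_tr4 (brk x a) b c d + sym_tr4 a (brk x b) c d + sym_tr4 a b (brk x c) d + sym_tr4 a b c (brk x d) = 0"
proof -
  let ?I = "\<lambda>a b c d. tr4 (brk x a) b c d + tr4 a (brk x b) c d + tr4 a b (brk x c) d + tr4 a b c (brk x d)"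
  have "sym_tr4 (brk x a) b c d + sym_tr4 a (brk x b) c d + sym_tr4 a b (brk x c) d + sym_tr4 a b c (brk x d)
      = ?I a b c d + ?I a c b d + ?I a b d c"
    unfolding sym_tr4_def by simp
  then show ?thesis unfolding tr4_invariant by simp
qed

lemma sym_killing_invariant:
  "sym_killing (brk x a) b c d + sym_killing a (brk x b) c d + sym_killing a b (brk x c) d + sym_killing a b c (brk x d) = 0"
  unfolding sym_killing_def killing_skew[of x] by (simp add: algebra_simps)

text \<open>
  In the first and third summand the contracted operators are neighbours and form the Casimir
  operator. In the second they are separated by \<open>x\<close>, and moving them together by
  \<open>tr4_swap\<close> costs half of the result.
\<close>

lemma contract_sym_tr4: "(\<Sum>b\<in>Basis. sym_tr4 b (dual_vec b) x y) = 5 / 2 * killing x y"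
proof -
  have 1: "(\<Sum>b\<in>Basis. tr4 b (dual_vec b) x y) = killing x y" for x y
    unfolding tr4_def tr_sum[symmetric] casimir killing_tr ..
  have swap: "tr4 b x b' y = tr4 b b' y x + killing (brk b x) (brk b' y) / 2" for b b'
    by (subst tr4_swap, subst tr4_cyclic) (rule HOL.refl)
  have kb: "killing (brk b x) (brk b' y) = - killing b (brk x (brk y b'))" for b b'
    by (subst killing_invariant, subst brk_skew[of b' y]) (simp add: brk_minus killing_minus)
  have "(\<Sum>b\<in>Basis. killing b (brk x (brk y (dual_vec b)))) = (\<Sum>b\<in>Basis. killing (dual_vec b) (brk x (brk y b)))"
    by (rule contract_swap[of "\<lambda>u v. killing u (brk x (brk y v))"])
      (simp_all add: lin_form_def killing_add killing_scale brk_add brk_scale)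
  also have "\<dots> = killing x y"
    unfolding killing_tr[of x y] tr_killing by (simp only: killing_commute)
  finally have 2: "(\<Sum>b\<in>Basis. tr4 b x (dual_vec b) y) = killing y x - killing x y / 2"
    unfolding swap kb by (simp add: sum.distrib 1 sum_divide_distrib[symmetric] sum_negf sum_subtractf)
  show ?thesis
    unfolding sym_tr4_def by (simp add: sum.distrib 1 2 killing_commute[of y x])
qed

lemma contract_sym_killing:
  "(\<Sum>b\<in>Basis. sym_killing b (dual_vec b) x y) = (of_nat (card Basis) + 2) * killing x y"
proof -
  have 1: "(\<Sum>b\<in>Basis. killing b x * killing (dual_vec b) y) = killing x y" for x y
    using contract_left[OF lin_form_killing_left, of x y] by (simp only: killing_commute[of _ x])
  have 2: "(\<Sum>b\<in>Basis. killing b (dual_vec b)) = of_nat (card Basis)"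
    by (simp add: killing_dual_vec)
  show ?thesis
    unfolding sym_killing_def sum.distrib 1 sum_distrib_right[symmetric] 2
    by (simp add: algebra_simps killing_commute[of y x])
qed

end

text \<open>
  For equal arguments the identity expresses the trace of the fourth power of an adjoint
  operator by the square of the trace of its square.
\<close>

locale quartic_lie_algebra = killing_lie_algebra scale Basis brk
  for scale :: "complex \<Rightarrow> 'g::ab_group_add \<Rightarrow> 'g" (infixr "*s" 75)
    and Basis :: "'g set" and brk :: "'g \<Rightarrow> 'g \<Rightarrow> 'g" +
  fixes \<delta> :: complex
  assumes \<delta>: "\<delta> = of_nat (card Basis)"
    and quartic: "sym_tr4 a b c d = 5 / (2 * (\<delta> + 2)) * sym_killing a b c d"
begin

lemma \<delta>_nonzero: "\<delta> + 2 \<noteq> 0"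
proof -
  have "\<delta> + 2 = of_nat (card Basis + 2)" unfolding \<delta> by simp
  then show ?thesis by (metis add_eq_0_iff_both_eq_0 of_nat_eq_0_iff zero_neq_numeral)
qed

text \<open>
  Each of the other two summands of \<open>sym_tr4 a b c d\<close> differs from \<open>tr4 a b
  c d\<close> by one exchange of neighbours.
\<close>

lemma box:
  "tr4 a b c d = 1/6 * (killing (brk a b) (brk c d) + killing (brk b c) (brk d a))
     + 5 / (6 * (\<delta> + 2)) * sym_killing a b c d"
proof -
  have 1: "tr4 a b c d = tr4 a c b d + killing (brk b c) (brk d a) / 2"
    unfolding tr4_cyclic[of a] by (rule tr4_swap)
  have 2: "tr4 a b c d = tr4 a b d c + killing (brk a b) (brk c d) / 2"
    unfolding tr4_cyclic[of a] tr4_cyclic[of b] 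
    using tr4_swap[of c d a b] by (simp only: killing_commute)
  have "3 * tr4 a b c d = sym_tr4 a b c d + (killing (brk b c) (brk d a) / 2 + killing (brk a b) (brk c d) / 2)"
    using 1 2 by (simp add: sym_tr4_def)
  moreover define D where "D = \<delta> + 2"
  moreover have "D \<noteq> 0" unfolding D_def by (rule \<delta>_nonzero)
  ultimately show ?thesis
    unfolding quartic D_def[symmetric] by (simp add: field_simps)
qed

text \<open>
  Four exchanges of neighbours turn \<open>a b c d e\<close> into \<open>c b a e d\<close>.
  This is a rotation of the reversed product \<open>e d c b a\<close>, whose trace has the
  opposite sign.
\<close>

lemma pentagon_aux:
  "2 * tr5 a b c d e = tr4 (brk a b) c d e + tr4 b (brk a c) d e + tr4 (brk b c) a d e + tr4 c b a (brk d e)"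
proof -
  have "tr5 c b a e d = tr5 e d c b a"
    unfolding tr5_cyclic[of e] tr5_cyclic[of d] ..
  then have "tr5 c b a e d = - tr5 a b c d e"
    using tr5_reverse[of a b c d e] by simp
  then show ?thesis
    unfolding tr4_brk1 tr4_brk2 tr4_brk4 by simp
qed

text \<open>
  By \<open>box\<close> the right side of \<open>pentagon_aux\<close> becomes a sum of Killing
  products of brackets. It remains to compare two such sums. This is done modulo the Jacobi
  identity in the part \<open>?trees\<close>, and by the alternating symmetry of
  \<open>killing a (brk b c)\<close> in the part \<open>?prods\<close>.
\<close>

lemma pentagon:
  "tr5 y r q p x = 1/12 * (killing (brk (brk q (brk p x)) y) r + killing (brk (brk q p) (brk x y)) r
      + killing (brk q (brk p (brk x y))) r + killing (brk (brk q (brk p y)) x) r)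
    + 5 / (12 * (\<delta> + 2)) *
      (killing x y * killing (brk q p) r + killing x p * killing (brk q y) r + killing (brk p x) q * killing y r
       + killing p q * killing (brk x y) r + killing (brk x y) p * killing q r + killing p r * killing (brk x y) q
       + killing (brk p x) r * killing y q + killing q x * killing (brk p y) r
       + killing (brk p y) q * killing x r + killing y p * killing (brk q x) r)"
proof -
  let ?trees = "killing (brk (brk q (brk p x)) y) r + killing (brk (brk q p) (brk x y)) r
      + killing (brk q (brk p (brk x y))) r + killing (brk (brk q (brk p y)) x) r"
  let ?prods = "killing x y * killing (brk q p) r + killing x p * killing (brk q y) r + killing (brk p x) q * killing y r
       + killing p q * killing (brk x y) r + killing (brk x y) p * killing q r + killing p r * killing (brk x y) q
       + killing (brk p x) r * killing y q + killing q x * killing (brk p y) r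
       + killing (brk p y) q * killing x r + killing y p * killing (brk q x) r"
  note triples = killing_brk_permute[where a = x and b = y and c = p] killing_brk_permute[where a = x and b = y and c = q] killing_brk_permute[where a = x and b = y and c = r]
    killing_brk_permute[where a = x and b = p and c = q] killing_brk_permute[where a = x and b = p and c = r] killing_brk_permute[where a = x and b = q and c = r]
    killing_brk_permute[where a = y and b = p and c = q] killing_brk_permute[where a = y and b = p and c = r] killing_brk_permute[where a = y and b = q and c = r]
    killing_brk_permute[where a = p and b = q and c = r]
  have c: "killing y x = killing x y" "killing p x = killing x p" "killing r y = killing y r" "killing q p = killing p q"
    "killing r q = killing q r" "killing r p = killing p r" "killing q y = killing y q" "killing q x = killing x q"
    "killing r x = killing x r" "killing p y = killing y p" by (rule killing_commute)+
  have prods: "sym_killing (brk y r) q p x + sym_killing r (brk y q) p x + sym_killing (brk r q) y p x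
      + sym_killing q r y (brk p x) = ?prods"
    unfolding sym_killing_def killing_invariant
    by (simp only: triples c) (simp add: algebra_simps)
  \<comment> \<open>The rules below move \<open>y\<close> to the front and \<open>x\<close> to the end. Their normal forms are \<open>killing y (brk u (brk v (brk w x)))\<close> with \<open>u, v, w\<close> a permutation of \<open>p, q, r\<close>.\<close>
  have x_last: "brk x z = - brk z x" for z by (rule brk_skew)
  have y_first: "brk z y = - brk y z" for z by (rule brk_skew)
  have y2: "killing u (brk y w) = - killing y (brk u w)" for u w
    unfolding killing_invariant[symmetric] by (subst brk_skew) (simp add: killing_minus)
  have y3: "killing u (brk v (brk y w)) = killing y (brk (brk v u) w)" for u v w
    using killing_skew[of v u "brk y w"] y2[of "brk v u" w] by simp
  have y4: "killing u (brk v (brk w (brk y z))) = - killing y (brk (brk w (brk v u)) z)" for u v w z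
    using killing_skew[of v u "brk w (brk y z)"] y3[of "brk v u" w z] by simp
  have trees: "killing (brk (brk y r) q) (brk p x) + killing (brk q p) (brk x (brk y r))
      + (killing (brk r (brk y q)) (brk p x) + killing (brk (brk y q) p) (brk x r))
      + (killing (brk (brk r q) y) (brk p x) + killing (brk y p) (brk x (brk r q)))
      + (killing (brk q r) (brk y (brk p x)) + killing (brk r y) (brk (brk p x) q)) = ?trees"
    by (simp only: killing_invariant brk_brk_left x_last y_first y2 y3 y4 brk_minus killing_minus brk_diff killing_diff)
      (simp add: algebra_simps)
  define D where "D = \<delta> + 2"
  define k where "k = 5 / (12 * D)"
  have k: "5 / (6 * D) = 2 * k" unfolding k_def by simp
  have "2 * tr5 y r q p x = 1/6 * ?trees + 2 * k * ?prods"
    unfolding pentagon_aux box D_def[symmetric] k prods[symmetric] trees[symmetric] by (simp only: distrib_left add_ac)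
  then show ?thesis unfolding D_def[symmetric] k_def[symmetric] by (simp add: field_simps)
qed

end

context simple_roots
begin

text \<open>
  The factor \<open>k\<close> is chosen such that the difference of the two sides vanishes at
  a long simple root.
\<close>

lemma sym_tr4_exceptional:
  assumes A: "A = cartan_matrix X" "length A = r"
    and gram: "\<And>i j. i < r \<Longrightarrow> j < r \<Longrightarrow>
      2 * killing (t i) (t j) = of_int (A ! i ! j) * killing (t j) (t j)"
  shows "\<exists>k. \<forall>a b c d. sym_tr4 a b c d = k * sym_killing a b c d"
proof -
  let ?u = "t (long_root_index X)"
  have "long_root_index X < r"
    unfolding A(2)[symmetric] A(1) long_root_index_def by (cases X) (simp_all add: cartan_E8_def)
  then have u: "killing ?u ?u \<noteq> 0" by (rule t_norm)
  define k where "k = sym_tr4 ?u ?u ?u ?u / sym_killing ?u ?u ?u ?u"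
  let ?Q = "\<lambda>a b c d. sym_tr4 a b c d - k * sym_killing a b c d"
  interpret Q: invariant_quartic scale Basis brk H r \<alpha> t ?Q
  proof unfold_locales
    show "?Q (x + y) u v w = ?Q x u v w + ?Q y u v w" for x y u v w
      by (simp add: sym_tr4_def sym_killing_def tr4_add killing_add algebra_simps)
    show "?Q (c *s x) u v w = c * ?Q x u v w" for c x u v w
      by (simp add: sym_tr4_def sym_killing_def tr4_scale killing_scale algebra_simps)
    show "?Q x y u v = ?Q y x u v" for x y u v
      by (simp only: sym_tr4_swap(1)[of x y] sym_killing_swap(1)[of x y])
    show "?Q x y u v = ?Q x u y v" for x y u v
      by (simp only: sym_tr4_swap(2)[of x y] sym_killing_swap(2)[of x y])
    show "?Q x y u v = ?Q x y v u" for x y u v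
      by (simp only: sym_tr4_swap(3)[of x y] sym_killing_swap(3)[of x y])
    show "?Q (brk x y) u v w + ?Q y (brk x u) v w + ?Q y u (brk x v) w + ?Q y u v (brk x w) = 0" for x y u v w
    proof -
      have "?Q (brk x y) u v w + ?Q y (brk x u) v w + ?Q y u (brk x v) w + ?Q y u v (brk x w) =
         (sym_tr4 (brk x y) u v w + sym_tr4 y (brk x u) v w + sym_tr4 y u (brk x v) w + sym_tr4 y u v (brk x w))
         - k * (sym_killing (brk x y) u v w + sym_killing y (brk x u) v w + sym_killing y u (brk x v) w + sym_killing y u v (brk x w))"
        by (simp add: algebra_simps)
      then show ?thesis unfolding sym_tr4_invariant sym_killing_invariant by simp
    qed
  qed
  have "?Q ?u ?u ?u ?u = 0"
    using u unfolding k_def sym_killing_def by simp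
  then have "?Q a b c d = 0" for a b c d
    using Q.exceptional_quartic_zero[OF A gram] by blast
  then show ?thesis by (intro exI[of _ k]) simp
qed

text \<open>
  Contracting two arguments on both sides determines the factor.
\<close>

lemma exceptional_quartic_lie_algebra:
  assumes A: "A = cartan_matrix X" "length A = r" "0 < r"
    and gram: "\<And>i j. i < r \<Longrightarrow> j < r \<Longrightarrow>
      2 * killing (t i) (t j) = of_int (A ! i ! j) * killing (t j) (t j)"
  shows "quartic_lie_algebra scale Basis brk (of_nat (card Basis))"
proof unfold_locales
  let ?\<delta> = "of_nat (card Basis) :: complex"
  obtain k where k: "\<And>a b c d. sym_tr4 a b c d = k * sym_killing a b c d"
    using sym_tr4_exceptional[OF A(1,2) gram] by blast
  have nz: "killing (t 0) (t 0) \<noteq> 0" by (rule t_norm[OF A(3)])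
  define D where "D = ?\<delta> + 2"
  have "D = of_nat (card Basis + 2)" unfolding D_def by simp
  then have D: "D \<noteq> 0" by (simp only: of_nat_eq_0_iff)
  have "5 / 2 * killing (t 0) (t 0) = k * (D * killing (t 0) (t 0))"
    unfolding D_def contract_sym_tr4[symmetric] contract_sym_killing[symmetric] k sum_distrib_left ..
  then have "k = 5 / (2 * D)" using nz D by (simp add: field_simps)
  then show "sym_tr4 a b c d = 5 / (2 * (?\<delta> + 2)) * sym_killing a b c d" for a b c d
    unfolding D_def k by simp
qed (rule HOL.refl)

end

context complex_lie_algebra
begin

text \<open>
  The radical of the Killing form is an ideal.
\<close>

lemma killing_lie_algebra_if_simple:
  assumes simple and u: "killing u v \<noteq> 0"
  shows "killing_lie_algebra scale Basis brk"
proof unfold_locales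
  let ?J = "{x. \<forall>y. killing x y = 0}"
  have sub: "subspace ?J"
    by (rule subspaceI) (auto simp: killing_0 killing_add killing_scale)
  have ideal: "\<forall>x. \<forall>y\<in>?J. brk x y \<in> ?J"
    using killing_skew by simp
  have "?J = {0} \<or> ?J = UNIV"
    using conjunct2[OF assms(1)[unfolded simple_def], rule_format, OF conjI[OF sub ideal]] .
  moreover have "u \<notin> ?J" using u by blast
  ultimately have "?J = {0}" by blast
  then show "x = 0" if "\<And>y. killing x y = 0" for x using that by blast
qed

theorem exceptional_is_quartic:
  assumes simple and "has_cartan_matrix (cartan_matrix X)"
  shows "quartic_lie_algebra scale Basis brk (of_nat (card Basis))"
proof -
  let ?A = "cartan_matrix X"
  obtain H \<alpha> t where H: "cartan_subalgebra H" "root_base H (length ?A) \<alpha>"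
    and t: "\<forall>i<length ?A. t i \<in> H \<and> (\<forall>h\<in>H. killing (t i) h = \<alpha> i h)"
    and A: "\<forall>i<length ?A. \<forall>j<length ?A. of_int (?A ! i ! j) = 2 * killing (t i) (t j) / killing (t j) (t j)"
    using assms(2) unfolding has_cartan_matrix_def by blast
  have pos: "0 < length ?A" by (cases X) (simp_all add: cartan_E8_def)
  have diag: "?A ! i ! i = 2" if "i < length ?A" for i
  proof -
    have "\<forall>X\<in>{G2, F4, E6, E7, E8}. \<forall>i\<in>{0..<length (cartan_matrix X)}. cartan_matrix X ! i ! i = 2"
      by code_simp
    moreover have "X \<in> {G2, F4, E6, E7, E8}" by (cases X) simp_all
    ultimately show ?thesis using that by (meson atLeastLessThan_iff zero_le)
  qed
  have norm: "killing (t i) (t i) \<noteq> 0" if "i < length ?A" for i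
  proof
    assume "killing (t i) (t i) = 0"
    then have "of_int (?A ! i ! i) = (0 :: complex)" using A that by simp
    then show False unfolding diag[OF that] by simp
  qed
  interpret killing_lie_algebra scale Basis brk
    by (rule killing_lie_algebra_if_simple[OF assms(1) norm[OF pos]])
  interpret simple_roots scale Basis brk H "length ?A" \<alpha> t
    by unfold_locales (use H t norm in blast)+
  show ?thesis
    by (rule exceptional_quartic_lie_algebra[OF HOL.refl HOL.refl pos]) (use A norm in \<open>simp add: field_simps\<close>)
qed

end

section \<open>Multilinear semantics of diagrams\<close>

context complex_lie_algebra
begin

definition mlin :: "nat \<Rightarrow> ('g list \<Rightarrow> complex) \<Rightarrow> bool" where
  "mlin n F \<longleftrightarrow> (\<forall>xs ys. Suc (length xs + length ys) = n \<longrightarrow> lin_form (\<lambda>v. F (xs @ v # ys)))"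

text \<open>
  The pullback of a function of the outputs to a function of the inputs. It is written in
  continuation-passing style, so a composite \<open>b \<cdot> a\<close> first pulls back along
  \<open>b\<close>. In a tensor product the outputs of \<open>a\<close> are collected before
  \<open>b\<close> is applied to the remaining inputs.
\<close>

primrec sem :: "tm \<Rightarrow> ('g list \<Rightarrow> complex) \<Rightarrow> 'g list \<Rightarrow> complex" where
  "sem (Id n) F xs = F xs"
| "sem GM F xs = F [brk (xs ! 0) (xs ! 1)]"
| "sem GS F xs = F [xs ! 1, xs ! 0]"
| "sem GEta F xs = (\<Sum>b\<in>Basis. F [b, dual_vec b])"
| "sem GEps F xs = killing (xs ! 0) (xs ! 1) * F []"
| "sem (Zero m n) F xs = 0"
| "sem (a \<boxplus> b) F xs = sem a F xs + sem b F xs"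
| "sem (c \<odot> a) F xs = c * sem a F xs"
| "sem (b \<cdot> a) F xs = sem a (sem b F) xs"
| "sem (a \<boxtimes> b) F xs = sem a (\<lambda>ys. sem b (\<lambda>zs. F (ys @ zs)) (drop (src a) xs)) (take (src a) xs)"

lemma sem_fun [simp]:
  "sem (Id n) F = F" "sem (b \<cdot> a) F = sem a (sem b F)"
  "sem (a \<boxplus> b) F = (\<lambda>xs. sem a F xs + sem b F xs)" "sem (c \<odot> a) F = (\<lambda>xs. c * sem a F xs)"
  "sem (Zero m n) F = (\<lambda>xs. 0)"
  by (rule ext, simp)+

text \<open>
  Evaluation of a function at a formal linear combination of words.
\<close>

definition combo :: "(complex \<times> 'g list) list \<Rightarrow> ('g list \<Rightarrow> complex) \<Rightarrow> complex" where
  "combo L F = (\<Sum>p\<leftarrow>L. fst p * F (snd p))"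

lemma combo_simps [simp]:
  "combo [] F = 0" "combo (p # L) F = fst p * F (snd p) + combo L F"
  "combo (L @ M) F = combo L F + combo M F"
  by (simp_all add: combo_def)

lemma combo_bind:
  "combo (concat (map (\<lambda>p. map (\<lambda>q. (fst p * fst q, f (snd p) (snd q))) (M (snd p))) L)) F =
   combo L (\<lambda>ys. combo (M ys) (\<lambda>zs. F (f ys zs)))"
proof (induction L)
  case (Cons p L)
  have "combo (map (\<lambda>q. (fst p * fst q, f (snd p) (snd q))) N) F = fst p * combo N (\<lambda>zs. F (f (snd p) zs))" for N
    by (induction N) (simp_all add: algebra_simps)
  then show ?case using Cons by simp
qed simp

lemma combo_cong: "(\<And>p. p \<in> set L \<Longrightarrow> F (snd p) = G (snd p)) \<Longrightarrow> combo L F = combo L G"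
  unfolding combo_def by (intro arg_cong[of _ _ sum_list] map_cong) auto

text \<open>
  A diagram sends a word of vectors to a formal combination of words, chosen independently of
  \<open>F\<close>. This makes \<open>sem\<close> linear in \<open>F\<close>, and it makes
  evaluations at different diagrams commute, which is what the interchange law needs.
\<close>

lemma sem_combo:
  assumes "wf_tm t" "length xs = src t"
  shows "\<exists>L. (\<forall>p\<in>set L. length (snd p) = tgt t) \<and> (\<forall>F. sem t F xs = combo L F)"
  using assms
proof (induction t arbitrary: xs)
  case (Id n) then show ?case by (intro exI[of _ "[(1, xs)]"]) simp
next
  case GM then show ?case by (intro exI[of _ "[(1, [brk (xs ! 0) (xs ! 1)])]"]) simp
next
  case GS then show ?case by (intro exI[of _ "[(1, [xs ! 1, xs ! 0])]"]) simp
next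
  case GEta
  obtain bs where bs: "set bs = Basis" "distinct bs" using finite_distinct_list[OF finite_Basis] by blast
  have "combo (map (\<lambda>b. (1, [b, dual_vec b])) bs) F = (\<Sum>b\<in>Basis. F [b, dual_vec b])" for F
    by (simp add: combo_def comp_def sum_list_distinct_conv_sum_set[OF bs(2)] bs(1))
  then show ?case by (intro exI[of _ "map (\<lambda>b. (1, [b, dual_vec b])) bs"]) auto
next
  case GEps then show ?case by (intro exI[of _ "[(killing (xs ! 0) (xs ! 1), [])]"]) simp
next
  case (Zero m n) then show ?case by (intro exI[of _ "[]"]) simp
next
  case (Add a b)
  obtain L where L: "\<forall>p\<in>set L. length (snd p) = tgt a" "\<forall>F. sem a F xs = combo L F"
    using Add.IH(1)[of xs] Add.prems by auto
  obtain M where M: "\<forall>p\<in>set M. length (snd p) = tgt b" "\<forall>F. sem b F xs = combo M F"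
    using Add.IH(2)[of xs] Add.prems by auto
  show ?case using L M Add.prems by (intro exI[of _ "L @ M"]) auto
next
  case (Scal c a)
  obtain L where L: "\<forall>p\<in>set L. length (snd p) = tgt a" "\<forall>F. sem a F xs = combo L F"
    using Scal.IH[of xs] Scal.prems by auto
  have "combo (map (\<lambda>p. (c * fst p, snd p)) L) F = c * combo L F" for F
    by (induction L) (simp_all add: algebra_simps)
  then show ?case using L by (intro exI[of _ "map (\<lambda>p. (c * fst p, snd p)) L"]) auto
next
  case (Comp b a)
  obtain L where L: "\<forall>p\<in>set L. length (snd p) = tgt a" "\<forall>F. sem a F xs = combo L F"
    using Comp.IH(2)[of xs] Comp.prems by auto
  have "\<forall>ys. \<exists>M. length ys = src b \<longrightarrow> (\<forall>p\<in>set M. length (snd p) = tgt b) \<and> (\<forall>F. sem b F ys = combo M F)"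
    using Comp.IH(1) Comp.prems by auto
  then obtain M where M: "\<And>ys. length ys = src b \<Longrightarrow> (\<forall>p\<in>set (M ys). length (snd p) = tgt b) \<and> (\<forall>F. sem b F ys = combo (M ys) F)"
    by metis
  let ?N = "concat (map (\<lambda>p. map (\<lambda>q. (fst p * fst q, snd q)) (M (snd p))) L)"
  have "sem (b \<cdot> a) F xs = combo ?N F" for F
  proof -
    have "sem (b \<cdot> a) F xs = combo L (sem b F)" using L by simp
    also have "\<dots> = combo L (\<lambda>ys. combo (M ys) F)"
      using L M Comp.prems by (intro combo_cong) simp
    finally show ?thesis using combo_bind[of "\<lambda>_ zs. zs" M L F] by simp
  qed
  moreover have "\<forall>p\<in>set ?N. length (snd p) = tgt b"
    using L M Comp.prems by fastforce
  ultimately show ?case by (intro exI[of _ ?N]) simp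
next
  case (Tens a b)
  obtain L where L: "\<forall>p\<in>set L. length (snd p) = tgt a" "\<forall>F. sem a F (take (src a) xs) = combo L F"
    using Tens.IH(1)[of "take (src a) xs"] Tens.prems by auto
  obtain M where M: "\<forall>p\<in>set M. length (snd p) = tgt b" "\<forall>F. sem b F (drop (src a) xs) = combo M F"
    using Tens.IH(2)[of "drop (src a) xs"] Tens.prems by auto
  let ?N = "concat (map (\<lambda>p. map (\<lambda>q. (fst p * fst q, snd p @ snd q)) M) L)"
  have "sem (a \<boxtimes> b) F xs = combo ?N F" for F
    using L M combo_bind[of "(@)" "\<lambda>_. M" L F] by simp
  moreover have "\<forall>p\<in>set ?N. length (snd p) = tgt a + tgt b"
    using L M by fastforce
  ultimately show ?case by (intro exI[of _ ?N]) simp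
qed

lemma combo_add: "combo L (\<lambda>ys. F ys + G ys) = combo L F + combo L G"
  by (induction L) (simp_all add: algebra_simps)

lemma combo_scale: "combo L (\<lambda>ys. c * F ys) = c * combo L F"
  by (induction L) (simp_all add: algebra_simps)

lemma combo_swap: "combo L (\<lambda>ys. combo M (G ys)) = combo M (\<lambda>zs. combo L (\<lambda>ys. G ys zs))"
proof (induction L)
  case Nil
  show ?case by (induction M) simp_all
next
  case (Cons p L)
  then show ?case by (simp add: combo_add combo_scale)
qed

context
  fixes t :: tm and xs :: "'g list" assumes t: "wf_tm t" "length xs = src t"
begin

lemma sem_cong: "(\<And>ys. length ys = tgt t \<Longrightarrow> F ys = G ys) \<Longrightarrow> sem t F xs = sem t G xs"
  using sem_combo[OF t] by (metis combo_cong)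

lemma sem_add: "sem t (\<lambda>ys. F ys + G ys) xs = sem t F xs + sem t G xs"
  using sem_combo[OF t] by (metis combo_add)

lemma sem_scale: "sem t (\<lambda>ys. c * F ys) xs = c * sem t F xs"
  using sem_combo[OF t] by (metis combo_scale)

lemma sem_0: "sem t (\<lambda>ys. 0) xs = 0"
  using sem_scale[of 0 "\<lambda>_. 0"] by simp

lemma sem_sum: "sem t (\<lambda>ys. \<Sum>i\<in>A. F i ys) xs = (\<Sum>i\<in>A. sem t (F i) xs)"
  by (induction A rule: infinite_finite_induct) (simp_all add: sem_0 sem_add)

lemma sem_lin:
  assumes "\<And>ys. length ys = tgt t \<Longrightarrow> lin_form (\<lambda>v. G v ys)"
  shows "lin_form (\<lambda>v. sem t (G v) xs)"
  unfolding lin_form_def sem_add[symmetric] sem_scale[symmetric]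
  using assms by (auto intro!: sem_cong simp: lin_form_def)

lemma sem_swap:
  assumes u: "wf_tm u" "length zs = src u"
  shows "sem t (\<lambda>ys. sem u (G ys) zs) xs = sem u (\<lambda>ws. sem t (\<lambda>ys. G ys ws) xs) zs"
proof -
  obtain L where L: "\<And>F. sem t F xs = combo L F" using sem_combo[OF t] by blast
  obtain M where M: "\<And>F. sem u F zs = combo M F" using sem_combo[OF u] by blast
  show ?thesis unfolding L M by (rule combo_swap)
qed

end

lemma length_2_cases: "length xs = 2 \<Longrightarrow> \<exists>a b. xs = [a, b]"
  by (auto simp: length_Suc_conv numeral_2_eq_2)

lemma length_1_cases: "length xs = Suc 0 \<Longrightarrow> \<exists>a. xs = [a]"
  by (auto simp: length_Suc_conv)

lemma mlinD: "mlin n F \<Longrightarrow> Suc (length xs + length ys) = n \<Longrightarrow> lin_form (\<lambda>v. F (xs @ v # ys))"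
  by (simp add: mlin_def)

lemma mlin1: "mlin (Suc 0) F \<Longrightarrow> lin_form (\<lambda>v. F [v])"
  using mlinD[of "Suc 0" F "[]" "[]"] by simp

lemma mlin2: "mlin 2 F \<Longrightarrow> lin_form (\<lambda>v. F [v, w])" "mlin 2 F \<Longrightarrow> lin_form (\<lambda>v. F [w, v])"
  using mlinD[of 2 F "[]" "[w]"] mlinD[of 2 F "[w]" "[]"] by simp_all

lemma mlin2I:
  assumes "\<And>w. lin_form (\<lambda>v. F [v, w])" "\<And>w. lin_form (\<lambda>v. F [w, v])"
  shows "mlin 2 F"
  unfolding mlin_def
proof (intro allI impI)
  fix xs ys :: "'g list" assume "Suc (length xs + length ys) = 2"
  then have "(xs = [] \<and> length ys = Suc 0) \<or> (length xs = Suc 0 \<and> ys = [])"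
    by (cases xs; cases ys) auto
  then show "lin_form (\<lambda>v. F (xs @ v # ys))"
    using length_1_cases assms by fastforce
qed

lemma mlin_append_left: "mlin (m + n) F \<Longrightarrow> length us = m \<Longrightarrow> mlin n (\<lambda>vs. F (us @ vs))"
  unfolding mlin_def
proof (intro allI impI)
  fix xs ys :: "'g list" assume *: "\<forall>xs ys. Suc (length xs + length ys) = m + n \<longrightarrow> lin_form (\<lambda>v. F (xs @ v # ys))"
    "length us = m" "Suc (length xs + length ys) = n"
  then have "lin_form (\<lambda>v. F ((us @ xs) @ v # ys))" by (intro *(1)[rule_format]) simp
  then show "lin_form (\<lambda>v. F (us @ xs @ v # ys))" by simp
qed

lemma sem_partial_mlin:
  assumes b: "wf_tm b" "length vs = src b" and F: "mlin (m + tgt b) F"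
  shows "mlin m (\<lambda>us. sem b (\<lambda>ws. F (us @ ws)) vs)"
  unfolding mlin_def
proof (intro allI impI)
  fix us us' :: "'g list" assume l: "Suc (length us + length us') = m"
  show "lin_form (\<lambda>v. sem b (\<lambda>ws. F ((us @ v # us') @ ws)) vs)"
  proof (rule sem_lin[OF b])
    fix ws :: "'g list" assume "length ws = tgt b"
    then have "lin_form (\<lambda>v. F (us @ v # (us' @ ws)))" using l by (intro mlinD[OF F]) simp
    then show "lin_form (\<lambda>v. F ((us @ v # us') @ ws))" by simp
  qed
qed

lemma sem_mlin:
  assumes "wf_tm t" "mlin (tgt t) F"
  shows "mlin (src t) (sem t F)"
  using assms
proof (induction t arbitrary: F)
  case (Id n) then show ?case by simp
next
  case GM
  then have "lin_form (\<lambda>v. F [v])" using mlin1 by simp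
  then have "mlin 2 (sem GM F)"
    by (intro mlin2I) (auto simp: lin_form_def brk_add brk_scale)
  then show ?case by (simp del: sem.simps)
next
  case GS
  then have "mlin 2 F" by simp
  then have "mlin 2 (sem GS F)"
    using mlin2[of F] by (intro mlin2I) simp_all
  then show ?case by (simp del: sem.simps)
next
  case GEta then show ?case by (simp add: mlin_def)
next
  case GEps
  have "mlin 2 (sem GEps F)"
    by (intro mlin2I) (auto simp: lin_form_def killing_add killing_scale algebra_simps)
  then show ?case by (simp del: sem.simps)
next
  case (Zero m n) then show ?case by (simp add: mlin_def lin_form_def)
next
  case (Add a b)
  then have "mlin (src a) (sem a F)" "mlin (src a) (sem b F)" by auto
  then show ?case by (auto simp: mlin_def lin_form_def algebra_simps)
next
  case (Scal c a)
  then have "mlin (src a) (sem a F)" by simp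
  then show ?case by (auto simp: mlin_def lin_form_def algebra_simps)
next
  case (Comp b a)
  then have "mlin (src b) (sem b F)" by simp
  moreover have "sem (b \<cdot> a) F = sem a (sem b F)" by (rule ext) simp
  ultimately show ?case using Comp by simp
next
  case (Tens a b)
  have wf: "wf_tm a" "wf_tm b" and F: "mlin (tgt a + tgt b) F" using Tens.prems by auto
  show ?case
    unfolding mlin_def
  proof (intro allI impI)
    fix xs ys :: "'g list" assume "Suc (length xs + length ys) = src (a \<boxtimes> b)"
    then have len: "Suc (length xs + length ys) = src a + src b" by simp
    show "lin_form (\<lambda>v. sem (a \<boxtimes> b) F (xs @ v # ys))"
    proof (cases "length xs < src a")
      case True
      let ?y1 = "take (src a - Suc (length xs)) ys" and ?y2 = "drop (src a - Suc (length xs)) ys"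
      let ?G = "\<lambda>us. sem b (\<lambda>vs. F (us @ vs)) ?y2"
      have td: "take (src a) (xs @ v # ys) = xs @ v # ?y1" "drop (src a) (xs @ v # ys) = ?y2" for v
        using True by (simp_all add: take_Cons' drop_Cons')
      have l2: "length ?y2 = src b" using len True by simp
      have "mlin (tgt a) ?G" by (rule sem_partial_mlin[OF wf(2) l2 F])
      then have "mlin (src a) (sem a ?G)" using Tens.IH(1) wf by blast
      then have "lin_form (\<lambda>v. sem a ?G (xs @ v # ?y1))" using len True by (intro mlinD) auto
      then show ?thesis by (simp only: sem.simps td)
    next
      case False
      let ?x1 = "take (src a) xs" and ?x2 = "drop (src a) xs"
      have td: "take (src a) (xs @ v # ys) = ?x1" "drop (src a) (xs @ v # ys) = ?x2 @ v # ys" for v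
        using False by simp_all
      have l1: "length ?x1 = src a" using False by simp
      have "lin_form (\<lambda>v. sem a (\<lambda>us. sem b (\<lambda>vs. F (us @ vs)) (?x2 @ v # ys)) ?x1)"
      proof (rule sem_lin[OF wf(1) l1])
        fix us :: "'g list" assume "length us = tgt a"
        then have "mlin (tgt b) (\<lambda>vs. F (us @ vs))" by (rule mlin_append_left[OF F])
        then have "mlin (src b) (sem b (\<lambda>vs. F (us @ vs)))" using Tens.IH(2) wf by blast
        moreover have "Suc (length ?x2 + length ys) = src b" using len False by simp
        ultimately show "lin_form (\<lambda>v. sem b (\<lambda>vs. F (us @ vs)) (?x2 @ v # ys))" by (rule mlinD)
      qed
      then show ?thesis by (simp only: sem.simps td)
    qed
  qed
qed

definition sem_eq :: "tm \<Rightarrow> tm \<Rightarrow> bool" where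
  "sem_eq a b \<longleftrightarrow> wf_tm a \<and> wf_tm b \<and> src a = src b \<and> tgt a = tgt b \<and>
     (\<forall>F xs. mlin (tgt a) F \<longrightarrow> length xs = src a \<longrightarrow> sem a F xs = sem b F xs)"

lemma sem_eqI: "a \<in> tms m n \<Longrightarrow> b \<in> tms m n \<Longrightarrow>
    (\<And>F xs. mlin n F \<Longrightarrow> length xs = m \<Longrightarrow> sem a F xs = sem b F xs) \<Longrightarrow> sem_eq a b"
  by (auto simp: sem_eq_def tms_def)

lemma tm_cong_sound:
  assumes "tm_cong R a b"
    and R: "\<And>l r F xs. (l, r) \<in> R \<Longrightarrow> mlin (tgt l) F \<Longrightarrow> length xs = src l \<Longrightarrow> sem l F xs = sem r F xs"
  shows "sem_eq a b"
  using assms(1)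
proof (induction rule: tm_cong.induct)
  case (base a b m n)
  show ?case
  proof (rule sem_eqI[OF base(2,3)])
    fix F and xs :: "'g list" assume "mlin n F" "length xs = m"
    moreover have "src a = m" "tgt a = n" using base(2) by (simp_all add: tms_def)
    ultimately have "mlin (tgt a) F" "length xs = src a" by simp_all
    then show "sem a F xs = sem b F xs" by (rule R[OF base(1)])
  qed
next
  case (comp_cong b b' a a')
  then have "mlin (tgt a) (sem b F)" if "mlin (tgt b) F" for F
    using sem_mlin[of b F] that by (auto simp: sem_eq_def)
  moreover have "sem a' (sem b F) xs = sem a' (sem b' F) xs" if "mlin (tgt b) F" "length xs = src a" for F xs
    using comp_cong that by (intro sem_cong) (auto simp: sem_eq_def)
  ultimately show ?case using comp_cong by (auto simp: sem_eq_def)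
next
  case (tens_cong a a' b b')
  show ?case
  proof (rule sem_eqI)
    show "a \<boxtimes> b \<in> tms (src a + src b) (tgt a + tgt b)" "a' \<boxtimes> b' \<in> tms (src a + src b) (tgt a + tgt b)"
      using tens_cong by (auto simp: sem_eq_def tms_def)
    fix F and xs :: "'g list" assume F: "mlin (tgt a + tgt b) F" and l: "length xs = src a + src b"
    have wf: "wf_tm a" "wf_tm a'" "wf_tm b" "wf_tm b'" "src a' = src a" "src b' = src b" "tgt a' = tgt a" "tgt b' = tgt b"
      using tens_cong by (auto simp: sem_eq_def)
    have len: "length (take (src a) xs) = src a" "length (drop (src a) xs) = src b" using l by auto
    let ?G = "\<lambda>ys. sem b (\<lambda>zs. F (ys @ zs)) (drop (src a) xs)"
    have "mlin (tgt a) ?G" by (rule sem_partial_mlin[OF wf(3) len(2) F])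
    then have "sem a ?G (take (src a) xs) = sem a' ?G (take (src a) xs)"
      using tens_cong.IH(1) len by (simp add: sem_eq_def)
    also have "\<dots> = sem a' (\<lambda>ys. sem b' (\<lambda>zs. F (ys @ zs)) (drop (src a) xs)) (take (src a) xs)"
    proof (rule sem_cong)
      fix ys :: "'g list" assume "length ys = tgt a'"
      then have "mlin (tgt b) (\<lambda>zs. F (ys @ zs))" using mlin_append_left[OF F] wf by simp
      then show "sem b (\<lambda>zs. F (ys @ zs)) (drop (src a) xs) = sem b' (\<lambda>zs. F (ys @ zs)) (drop (src a) xs)"
        using tens_cong.IH(2) len by (simp add: sem_eq_def)
    qed (use wf len in auto)
    finally show "sem (a \<boxtimes> b) F xs = sem (a' \<boxtimes> b') F xs" using wf by simp
  qed
next
  case (comp_add_left a m n b p b')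
  then show ?case by (auto simp: sem_eq_def tms_def sem_add)
next
  case (comp_scal_left a m n b p c)
  then show ?case by (auto simp: sem_eq_def tms_def sem_scale)
next
  case (tens_assoc a m n b p q c k l)
  then show ?case by (auto simp: sem_eq_def tms_def drop_take add.commute)
next
  case (interchange a m n b p c m' n' d p')
  have *: "sem c (\<lambda>zs. sem b (\<lambda>us. sem d (\<lambda>vs. F (us @ vs)) zs) ys) zs' = sem b (\<lambda>us. sem c (\<lambda>zs. sem d (\<lambda>vs. F (us @ vs)) zs) zs') ys"
    if "length ys = n" "length zs' = m'" for F ys zs'
    using interchange that by (intro sem_swap) (auto simp: tms_def)
  show ?case
  proof (rule sem_eqI)
    show "(b \<boxtimes> d) \<cdot> (a \<boxtimes> c) \<in> tms (m + m') (p + p')" "(b \<cdot> a) \<boxtimes> (d \<cdot> c) \<in> tms (m + m') (p + p')"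
      using interchange by (auto simp: tms_def)
    fix F and xs :: "'g list" assume l: "length xs = m + m'"
    have s: "src a = m" "src b = n" "wf_tm a" "tgt a = n" "wf_tm c" "src c = m'" "tgt c = n'" using interchange by (auto simp: tms_def)
    have "sem ((b \<boxtimes> d) \<cdot> (a \<boxtimes> c)) F xs =
      sem a (\<lambda>ys. sem c (\<lambda>zs. sem b (\<lambda>us. sem d (\<lambda>vs. F (us @ vs)) (drop n (ys @ zs))) (take n (ys @ zs))) (drop m xs)) (take m xs)"
      by (simp add: s)
    also have "\<dots> = sem a (\<lambda>ys. sem c (\<lambda>zs. sem b (\<lambda>us. sem d (\<lambda>vs. F (us @ vs)) zs) ys) (drop m xs)) (take m xs)"
      by (rule sem_cong) (use l s in auto)
    also have "\<dots> = sem a (\<lambda>ys. sem b (\<lambda>us. sem c (\<lambda>zs. sem d (\<lambda>vs. F (us @ vs)) zs) (drop m xs)) ys) (take m xs)"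
      by (rule sem_cong) (use l s * in auto)
    also have "\<dots> = sem ((b \<cdot> a) \<boxtimes> (d \<cdot> c)) F xs" by (simp add: s)
    finally show "sem ((b \<boxtimes> d) \<cdot> (a \<boxtimes> c)) F xs = sem ((b \<cdot> a) \<boxtimes> (d \<cdot> c)) F xs" .
  qed
next
  case (tens_add_right a m n b p q b')
  then show ?case by (auto simp: sem_eq_def tms_def sem_add)
next
  case (tens_scal_right a m n b p q c)
  then show ?case by (auto simp: sem_eq_def tms_def sem_scale)
next
  case (sym a b) then show ?case by (auto simp: sem_eq_def)
next
  case (trans a b c) then show ?case by (auto simp: sem_eq_def)
next
  case (add_cong a a' b b') then show ?case by (auto simp: sem_eq_def)
next
  case (scal_cong a a' c) then show ?case by (auto simp: sem_eq_def)
qed (auto simp: sem_eq_def tms_def algebra_simps)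

section \<open>Equivariance\<close>

text \<open>
  The infinitesimal diagonal action of \<open>x\<close> on the arguments of \<open>F\<close>,
  by the Leibniz rule.
\<close>

primrec der :: "'g \<Rightarrow> ('g list \<Rightarrow> complex) \<Rightarrow> 'g list \<Rightarrow> complex" where
  "der x F [] = 0"
| "der x F (v # vs) = F (brk x v # vs) + der x (\<lambda>ws. F (v # ws)) vs"

lemma der_append:
  "der x F (us @ vs) = der x (\<lambda>us. F (us @ vs)) us + der x (\<lambda>vs. F (us @ vs)) vs"
  by (induction us arbitrary: F) simp_all

lemma der_cong: "(\<And>ys. length ys = length xs \<Longrightarrow> F ys = G ys) \<Longrightarrow> der x F xs = der x G xs"
proof (induction xs arbitrary: F G)
  case (Cons v vs)
  have "der x (\<lambda>ws. F (v # ws)) vs = der x (\<lambda>ws. G (v # ws)) vs"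
    by (rule Cons.IH) (simp add: Cons.prems)
  then show ?case by (simp add: Cons.prems)
qed simp

lemma sem_der_swap:
  assumes "wf_tm t" "length xs = src t"
  shows "sem t (\<lambda>ys. der x (G ys) vs) xs = der x (\<lambda>vs. sem t (\<lambda>ys. G ys vs) xs) vs"
  by (induction vs arbitrary: G) (simp_all add: sem_add[OF assms] sem_0[OF assms])

end

context killing_lie_algebra
begin

text \<open>
  For the generators this is the Jacobi identity and the invariance of the Killing form and of
  its dual tensor. Composition and tensor product preserve the property.
\<close>

lemma sem_der:
  assumes "wf_tm t" "mlin (tgt t) F" "length xs = src t"
  shows "sem t (der x F) xs = der x (sem t F) xs"
  using assms
proof (induction t arbitrary: F xs)
  case GM
  then have "length xs = 2" by simp
  then obtain a b where xs: "xs = [a, b]" using length_2_cases by blast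
  have "lin_form (\<lambda>v. F [v])" using GM mlin1[of F] by simp
  then have "F [brk (brk x a) b + brk a (brk x b)] = F [brk (brk x a) b] + F [brk a (brk x b)]"
    unfolding lin_form_def by blast
  moreover have "brk x (brk a b) = brk (brk x a) b + brk a (brk x b)"
    by (simp add: brk_brk_left)
  ultimately show ?case by (simp add: xs)
next
  case GS
  then have "length xs = 2" by simp
  then obtain a b where xs: "xs = [a, b]" using length_2_cases by blast
  then show ?case by simp
next
  case GEta
  have F: "mlin 2 F" using GEta by simp
  have "(\<Sum>b\<in>Basis. F [brk x b, dual_vec b]) = (\<Sum>b\<in>Basis. F [b, - brk x (dual_vec b)])"
    by (rule contract_pair[of "\<lambda>u v. F [u, v]" "brk x" "\<lambda>v. - brk x v"])
      (use mlin2[OF F] in \<open>auto simp: lin_map_brk killing_skew killing_minus\<close>)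
  also have "\<dots> = (\<Sum>b\<in>Basis. - F [b, brk x (dual_vec b)])"
  proof (rule sum.cong[OF HOL.refl])
    fix b
    have "F [b, (-1) *s brk x (dual_vec b)] = (-1) * F [b, brk x (dual_vec b)]"
      using mlin2(2)[OF F, of b] by (simp only: lin_form_def)
    then show "F [b, - brk x (dual_vec b)] = - F [b, brk x (dual_vec b)]" by simp
  qed
  finally show ?case using GEta by (simp add: sum.distrib sum_negf)
next
  case GEps
  then have "length xs = 2" by simp
  then obtain a b where xs: "xs = [a, b]" using length_2_cases by blast
  then show ?case by (simp add: killing_skew)
next
  case (Id n) then show ?case by simp
next
  case (Zero m n)
  have "der x (\<lambda>_. 0) xs = 0" by (induction xs) simp_all
  then show ?case by simp
next
  case (Add a b)
  have "der x (\<lambda>ys. G ys + G' ys) xs = der x G xs + der x G' xs" for G G'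
    by (induction xs arbitrary: G G') simp_all
  then show ?case using Add by simp
next
  case (Scal c a)
  have "der x (\<lambda>ys. c * G ys) xs = c * der x G xs" for G
    by (induction xs arbitrary: G) (simp_all add: algebra_simps)
  then show ?case using Scal by simp
next
  case (Comp b a)
  have "sem a (sem b (der x F)) xs = sem a (der x (sem b F)) xs"
    by (rule sem_cong) (use Comp in auto)
  also have "\<dots> = der x (sem a (sem b F)) xs"
    using Comp sem_mlin[of b F] by simp
  finally show ?case by simp
next
  case (Tens a b)
  define us vs where uv: "us = take (src a) xs" "vs = drop (src a) xs"
  have xs: "xs = us @ vs" and lu: "length us = src a" and lv: "length vs = src b"
    using Tens.prems by (auto simp: uv)
  have wf: "wf_tm a" "wf_tm b" and F: "mlin (tgt a + tgt b) F" using Tens.prems by auto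
  have sab: "sem (a \<boxtimes> b) G (us' @ vs') = sem a (\<lambda>ys. sem b (\<lambda>zs. G (ys @ zs)) vs') us'"
    if "length us' = src a" for G us' vs' using that by simp
  let ?G = "\<lambda>ys. sem b (\<lambda>zs. F (ys @ zs)) vs"
  have G: "mlin (tgt a) ?G" by (rule sem_partial_mlin[OF wf(2) lv F])
  have 1: "sem b (\<lambda>zs. der x (\<lambda>ys. F (ys @ zs)) ys) vs = der x ?G ys" for ys
    by (rule sem_der_swap[OF wf(2) lv])
  have 2: "sem b (\<lambda>zs. der x (\<lambda>zs. F (ys @ zs)) zs) vs = der x (sem b (\<lambda>zs. F (ys @ zs))) vs"
    if "length ys = tgt a" for ys
    using Tens.IH(2)[of "\<lambda>zs. F (ys @ zs)" vs] mlin_append_left[OF F that] wf lv by simp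
  have "sem (a \<boxtimes> b) (der x F) xs = sem a (\<lambda>ys. sem b (\<lambda>zs. der x F (ys @ zs)) vs) us"
    unfolding xs by (rule sab[OF lu])
  also have "\<dots> = sem a (\<lambda>ys. der x ?G ys + der x (sem b (\<lambda>zs. F (ys @ zs))) vs) us"
    by (rule sem_cong[OF wf(1) lu]) (simp add: der_append sem_add[OF wf(2) lv] 1 2)
  also have "\<dots> = der x (sem a ?G) us + der x (\<lambda>vs. sem a (\<lambda>ys. sem b (\<lambda>zs. F (ys @ zs)) vs) us) vs"
    using Tens.IH(1)[of ?G us] wf lu G sem_der_swap[OF wf(1) lu, of x "\<lambda>ys. sem b (\<lambda>zs. F (ys @ zs))" vs]
    by (simp add: sem_add[OF wf(1) lu])
  also have "\<dots> = der x (sem (a \<boxtimes> b) F) xs"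
    unfolding xs der_append using lu
    by (intro arg_cong2[where f = "(+)"] der_cong) simp_all
  finally show ?case .
qed

end

section \<open>The defining relations hold\<close>

context killing_lie_algebra
begin

lemma sem_Sigma: "sem Sigma_tm F [x] = (\<Sum>b\<in>Basis. F [b, brk (dual_vec b) x])"
  by (simp add: Sigma_tm_def)

lemma Sigma_type [simp]: "src Sigma_tm = Suc 0" "tgt Sigma_tm = 2" "wf_tm Sigma_tm"
  by (simp_all add: Sigma_tm_def)

lemma sigma_symmetric:
  assumes "mlin 2 F"
  shows "(\<Sum>b\<in>Basis. F [b, brk (dual_vec b) x]) = (\<Sum>b\<in>Basis. F [brk x b, dual_vec b])"
proof -
  have "killing (brk x u) v = killing u (brk v x)" for u v
    unfolding killing_skew by (subst brk_skew) (simp add: killing_minus)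
  then show ?thesis
    by (intro contract_pair[of "\<lambda>u v. F [u, v]" "brk x" "\<lambda>v. brk v x", symmetric] mlin2[OF assms] lin_map_brk)
qed

lemma length_3_cases: "length xs = 3 \<Longrightarrow> \<exists>a b c. xs = [a, b, c]"
  by (auto simp: length_Suc_conv numeral_3_eq_3)

lemma T_rels_sound:
  assumes "(l, r) \<in> T_rels (of_nat (card Basis))" "mlin (tgt l) F" "length xs = src l"
  shows "sem l F xs = sem r F xs"
  using assms(1) unfolding T_rels_def
proof (elim insertE emptyE)
  assume "(l, r) = ((GEps \<boxtimes> I1) \<cdot> (I1 \<boxtimes> GEta), I1)"
  then have e: "l = (GEps \<boxtimes> I1) \<cdot> (I1 \<boxtimes> GEta)" "r = I1" by simp_all
  have "length xs = Suc 0" using assms(3) e by simp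
  then obtain x where xs: "xs = [x]" using length_1_cases by blast
  have F: "lin_form (\<lambda>v. F [v])" using assms(2) e by (intro mlin1) simp
  show ?thesis using e xs contract_left[OF F, of x] by simp
next
  assume "(l, r) = ((I1 \<boxtimes> GEps) \<cdot> (GEta \<boxtimes> I1), I1)"
  then have e: "l = (I1 \<boxtimes> GEps) \<cdot> (GEta \<boxtimes> I1)" "r = I1" by simp_all
  have "length xs = Suc 0" using assms(3) e by simp
  then obtain x where xs: "xs = [x]" using length_1_cases by blast
  have F: "lin_form (\<lambda>v. F [v])" using assms(2) e by (intro mlin1) simp
  show ?thesis using e xs contract_right[OF F, of x] by (simp add: killing_commute)
next
  assume "(l, r) = ((I1 \<boxtimes> GM) \<cdot> (GEta \<boxtimes> I1), (GM \<boxtimes> I1) \<cdot> (I1 \<boxtimes> GEta))"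
  then have e: "l = (I1 \<boxtimes> GM) \<cdot> (GEta \<boxtimes> I1)" "r = (GM \<boxtimes> I1) \<cdot> (I1 \<boxtimes> GEta)" by simp_all
  have "length xs = Suc 0" using assms(3) e by simp
  then obtain x where xs: "xs = [x]" using length_1_cases by blast
  have "mlin 2 F" using assms(2) e by (simp add: numeral_2_eq_2)
  from sigma_symmetric[OF this, of x] show ?thesis using e xs by simp
next
  assume "(l, r) = ((I1 \<boxtimes> GEps) \<cdot> (GS \<boxtimes> I1), (GEps \<boxtimes> I1) \<cdot> (I1 \<boxtimes> GS))"
  then have e: "l = (I1 \<boxtimes> GEps) \<cdot> (GS \<boxtimes> I1)" "r = (GEps \<boxtimes> I1) \<cdot> (I1 \<boxtimes> GS)" by simp_all
  have "length xs = 3" using assms(3) e by simp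
  then obtain x y z where xs: "xs = [x, y, z]" using length_3_cases by blast
  show ?thesis unfolding e xs by simp
next
  assume "(l, r) = (GS \<cdot> GS, I1 \<boxtimes> I1)"
  then have e: "l = GS \<cdot> GS" "r = I1 \<boxtimes> I1" by simp_all
  have "length xs = 2" using assms(3) e by simp
  then obtain x y where xs: "xs = [x, y]" using length_2_cases by blast
  show ?thesis unfolding e xs by simp
next
  assume "(l, r) = ((GS \<boxtimes> I1) \<cdot> (I1 \<boxtimes> GS) \<cdot> (GS \<boxtimes> I1), (I1 \<boxtimes> GS) \<cdot> (GS \<boxtimes> I1) \<cdot> (I1 \<boxtimes> GS))"
  then have e: "l = (GS \<boxtimes> I1) \<cdot> (I1 \<boxtimes> GS) \<cdot> (GS \<boxtimes> I1)" "r = (I1 \<boxtimes> GS) \<cdot> (GS \<boxtimes> I1) \<cdot> (I1 \<boxtimes> GS)" by simp_all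
  have "length xs = 3" using assms(3) e by simp
  then obtain x y z where xs: "xs = [x, y, z]" using length_3_cases by blast
  show ?thesis unfolding e xs by simp
next
  assume "(l, r) = ((I1 \<boxtimes> GM) \<cdot> (GS \<boxtimes> I1) \<cdot> (I1 \<boxtimes> GS), GS \<cdot> (GM \<boxtimes> I1))"
  then have e: "l = (I1 \<boxtimes> GM) \<cdot> (GS \<boxtimes> I1) \<cdot> (I1 \<boxtimes> GS)" "r = GS \<cdot> (GM \<boxtimes> I1)" by simp_all
  have "length xs = 3" using assms(3) e by simp
  then obtain x y z where xs: "xs = [x, y, z]" using length_3_cases by blast
  show ?thesis unfolding e xs by simp
next
  assume "(l, r) = ((I1 \<boxtimes> GS) \<cdot> (GS \<boxtimes> I1) \<cdot> (I1 \<boxtimes> Sigma_tm), (Sigma_tm \<boxtimes> I1) \<cdot> GS)"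
  then have e: "l = (I1 \<boxtimes> GS) \<cdot> (GS \<boxtimes> I1) \<cdot> (I1 \<boxtimes> Sigma_tm)" "r = (Sigma_tm \<boxtimes> I1) \<cdot> GS" by simp_all
  have "length xs = 2" using assms(3) e by simp
  then obtain x y where xs: "xs = [x, y]" using length_2_cases by blast
  show ?thesis unfolding e xs by (simp add: sem_Sigma)
next
  assume "(l, r) = (GEps \<cdot> GS, GEps)"
  then have e: "l = GEps \<cdot> GS" "r = GEps" by simp_all
  have "length xs = 2" using assms(3) e by simp
  then obtain x y where xs: "xs = [x, y]" using length_2_cases by blast
  show ?thesis unfolding e xs by (simp add: killing_commute)
next
  assume "(l, r) = (GM \<cdot> GS, (-1) \<odot> GM)"
  then have e: "l = GM \<cdot> GS" "r = (-1) \<odot> GM" by simp_all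
  have "length xs = 2" using assms(3) e by simp
  then obtain x y where xs: "xs = [x, y]" using length_2_cases by blast
  have F: "lin_form (\<lambda>v. F [v])" using assms(2) e by (intro mlin1) simp
  then have "F [(-1) *s brk x y] = (-1) * F [brk x y]" unfolding lin_form_def by blast
  moreover have "brk y x = (-1) *s brk x y" using brk_skew[of y x] by simp
  ultimately show ?thesis unfolding e xs by simp
next
  assume "(l, r) = (GM \<cdot> Sigma_tm, I1)"
  then have e: "l = GM \<cdot> Sigma_tm" "r = I1" by simp_all
  have "length xs = Suc 0" using assms(3) e by simp
  then obtain x where xs: "xs = [x]" using length_1_cases by blast
  have F: "lin_form (\<lambda>v. F [v])" using assms(2) e by (intro mlin1) simp
  from lin_form_sum[OF F, of "\<lambda>b. brk b (brk (dual_vec b) x)" Basis]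
  show ?thesis unfolding e xs by (simp add: sem_Sigma casimir)
next
  assume "(l, r) = (GEps \<cdot> GEta, of_nat (card Basis) \<odot> Id 0)"
  then have e: "l = GEps \<cdot> GEta" "r = of_nat (card Basis) \<odot> Id 0" by simp_all
  have xs: "xs = []" using assms(3) e by simp
  show ?thesis unfolding e xs by (simp add: killing_dual_vec)
qed

definition kform :: "'g list \<Rightarrow> 'g list \<Rightarrow> complex" where
  "kform ps ys = prod_list (map2 killing ps ys)"

lemma kform_simps [simp]: "kform [] ys = 1" "kform (p # ps) (y # ys) = killing p y * kform ps ys"
  by (simp_all add: kform_def)

definition words :: "nat \<Rightarrow> 'g list set" where
  "words n = {ws. set ws \<subseteq> Basis \<and> length ws = n}"

lemma finite_words: "finite (words n)"
  unfolding words_def by (rule finite_lists_length_eq[OF finite_Basis])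

lemma words_0: "words 0 = {[]}"
  by (auto simp: words_def)

lemma words_Suc: "words (Suc n) = (\<lambda>(b, ws). b # ws) ` (Basis \<times> words n)"
proof
  show "words (Suc n) \<subseteq> (\<lambda>(b, ws). b # ws) ` (Basis \<times> words n)"
  proof
    fix ws assume "ws \<in> words (Suc n)"
    then obtain b us where "ws = b # us" "b \<in> Basis" "us \<in> words n"
      unfolding words_def by (cases ws) auto
    then show "ws \<in> (\<lambda>(b, ws). b # ws) ` (Basis \<times> words n)" by (intro image_eqI[of _ _ "(b, us)"]) auto
  qed
qed (auto simp: words_def)

lemma sum_words_Suc: "(\<Sum>ws\<in>words (Suc n). f ws) = (\<Sum>b\<in>Basis. \<Sum>ws\<in>words n. f (b # ws))"
proof -
  have "inj_on (\<lambda>(b, ws). b # ws) (Basis \<times> words n)" by (auto simp: inj_on_def)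
  then have "(\<Sum>ws\<in>words (Suc n). f ws) = (\<Sum>p\<in>Basis \<times> words n. f (fst p # snd p))"
    unfolding words_Suc by (subst sum.reindex) (auto simp: case_prod_beta intro: sum.cong)
  then show ?thesis
    by (simp add: sum.cartesian_product case_prod_beta)
qed

lemma mlin_expand:
  assumes "mlin n F" "length ys = n"
  shows "F ys = (\<Sum>ws\<in>words n. kform (map dual_vec ws) ys * F ws)"
  using assms
proof (induction n arbitrary: F ys)
  case 0 then show ?case by (simp add: words_0)
next
  case (Suc n)
  then obtain y zs where ys: "ys = y # zs" "length zs = n" by (cases ys) auto
  have "lin_form (\<lambda>v. F (v # zs))" using mlinD[OF Suc.prems(1), of "[]" zs] ys by simp
  then have "F (y # zs) = (\<Sum>b\<in>Basis. killing y (dual_vec b) * F (b # zs))"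
    by (rule contract_right[symmetric])
  also have "\<dots> = (\<Sum>b\<in>Basis. killing y (dual_vec b) * (\<Sum>ws\<in>words n. kform (map dual_vec ws) zs * F (b # ws)))"
  proof (rule sum.cong[OF HOL.refl])
    fix b
    have "mlin n (\<lambda>zs. F (b # zs))" using mlin_append_left[of 1 n F "[b]"] Suc.prems by simp
    from Suc.IH[OF this ys(2)]
    show "killing y (dual_vec b) * F (b # zs) = killing y (dual_vec b) * (\<Sum>ws\<in>words n. kform (map dual_vec ws) zs * F (b # ws))"
      by simp
  qed
  also have "\<dots> = (\<Sum>ws\<in>words (Suc n). kform (map dual_vec ws) (y # zs) * F ws)"
    unfolding sum_words_Suc by (simp add: sum_distrib_left killing_commute mult_ac)
  finally show ?case using ys by simp
qed

text \<open>
  Products of the functionals \<open>killing p\<close> span the multilinear functions, by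
  \<open>mlin_expand\<close>.
\<close>

lemma sem_test:
  assumes wf: "l \<in> tms m n" "r \<in> tms m n" "length xs = m" and F: "mlin n F"
    and test: "\<And>ps. length ps = n \<Longrightarrow> sem l (kform ps) xs = sem r (kform ps) xs"
  shows "sem l F xs = sem r F xs"
proof -
  have expand: "sem t F xs = (\<Sum>ws\<in>words n. F ws * sem t (kform (map dual_vec ws)) xs)" if "t \<in> tms m n" for t
  proof -
    have t: "wf_tm t" "length xs = src t" "tgt t = n" using that wf(3) by (auto simp: tms_def)
    have "sem t F xs = sem t (\<lambda>ys. \<Sum>ws\<in>words n. F ws * kform (map dual_vec ws) ys) xs"
    proof (rule sem_cong[OF t(1,2)])
      fix ys :: "'g list" assume "length ys = tgt t"
      then show "F ys = (\<Sum>ws\<in>words n. F ws * kform (map dual_vec ws) ys)"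
        using mlin_expand[OF F, of ys] t(3) by (simp add: mult.commute)
    qed
    also have "\<dots> = (\<Sum>ws\<in>words n. F ws * sem t (kform (map dual_vec ws)) xs)"
      unfolding sem_sum[OF t(1,2)] sem_scale[OF t(1,2)] ..
    finally show ?thesis .
  qed
  show ?thesis
    unfolding expand[OF wf(1)] expand[OF wf(2)]
    by (rule sum.cong[OF HOL.refl]) (simp add: test words_def)
qed

lemma contract_killing [simp]:
  "(\<Sum>b\<in>Basis. killing p b * killing q (dual_vec b)) = killing p q"
  "(\<Sum>b\<in>Basis. killing p b * (killing q (dual_vec b) * c)) = killing p q * c"
  "(\<Sum>b\<in>Basis. killing p b * (c * killing q (dual_vec b))) = killing p q * c"
proof -
  show 1: "(\<Sum>b\<in>Basis. killing p b * killing q (dual_vec b)) = killing p q"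
    using contract_left[OF lin_form_killing, of p q] by (simp only: killing_commute[of q p])
  show "(\<Sum>b\<in>Basis. killing p b * (killing q (dual_vec b) * c)) = killing p q * c"
    unfolding mult.assoc[symmetric] sum_distrib_right[symmetric] 1 ..
  then show "(\<Sum>b\<in>Basis. killing p b * (c * killing q (dual_vec b))) = killing p q * c"
    by (simp only: mult.commute[of c])
qed

text \<open>
  Contraction at an output of \<open>\<sigma>\<close>, in the three positions in which it
  occurs inside a product.
\<close>

lemma contract_Sigma [simp]:
  "(\<Sum>b\<in>Basis. killing p b * killing q (brk (dual_vec b) x)) = killing q (brk p x)"
  "(\<Sum>b\<in>Basis. killing p b * (killing q (brk (dual_vec b) x) * c)) = killing q (brk p x) * c"
  "(\<Sum>b\<in>Basis. killing p b * (c * killing q (brk (dual_vec b) x))) = killing q (brk p x) * c"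
proof -
  show 1: "(\<Sum>b\<in>Basis. killing p b * killing q (brk (dual_vec b) x)) = killing q (brk p x)"
    by (rule contract_left[of "\<lambda>z. killing q (brk z x)"])
      (simp add: lin_form_def brk_add brk_scale killing_add killing_scale)
  show "(\<Sum>b\<in>Basis. killing p b * (killing q (brk (dual_vec b) x) * c)) = killing q (brk p x) * c"
    unfolding mult.assoc[symmetric] sum_distrib_right[symmetric] 1 ..
  then show "(\<Sum>b\<in>Basis. killing p b * (c * killing q (brk (dual_vec b) x))) = killing q (brk p x) * c"
    by (simp only: mult.commute[of c])
qed

lemma killing_flip: "killing p (brk x b) = killing (brk p x) b"
  by (rule killing_invariant[symmetric])

lemma killing_flip_right: "killing p (brk b y) = killing (brk y p) b"
  unfolding killing_commute[of "brk y p" b] by (rule killing_brk_permute(2))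

lemma sem_K: "sem K_tm (kform [p, q]) [x, y] = killing q (brk p (brk x y))"
  by (simp add: K_tm_def sem_Sigma)

lemma sem_H_general: "sem H_tm F [x, y] = (\<Sum>b\<in>Basis. F [brk x b, brk (dual_vec b) y])"
  by (simp add: H_tm_def sem_Sigma)

lemma sem_H: "sem H_tm (kform [p, q]) [x, y] = killing q (brk (brk p x) y)"
  by (simp add: sem_H_general killing_flip[of p x])

lemma sem_D: "sem D_tm (kform [p, q]) [x, y] = killing q (brk (brk y p) x)"
  by (simp add: D_tm_def sem_Sigma killing_flip_right[of p _ y])

lemma nth_pair: "[x, y] ! 0 = x" "[x, y] ! 1 = y"
  by simp_all

lemma sem_Sigma_left: "sem (Sigma_tm \<boxtimes> I1) (kform [p, q, r]) [u, v] = killing q (brk p u) * killing r v"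
  by (simp add: sem_Sigma)

lemma sem_Sigma_right: "sem (I1 \<boxtimes> Sigma_tm) (kform [p, q, r]) [u, v] = killing p u * killing r (brk q v)"
  by (simp add: sem_Sigma sum_distrib_left[symmetric])

lemma sem_T: "sem T_tm (kform [p, q, r]) [x, y] = killing r (brk (brk q (brk p x)) y)"
proof -
  have "sem T_tm (kform [p, q, r]) [x, y] =
      (\<Sum>b\<in>Basis. killing p b * (\<Sum>c\<in>Basis. killing q (brk (brk (dual_vec b) x) c) * killing r (brk (dual_vec c) y)))"
    by (simp add: T_tm_def sem_Sigma sum_distrib_left)
  also have "\<dots> = (\<Sum>b\<in>Basis. killing p b * killing r (brk (brk q (brk (dual_vec b) x)) y))"
    by (simp only: killing_flip[of q "brk _ x"] contract_Sigma)
  also have "\<dots> = killing r (brk (brk q (brk p x)) y)"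
    by (rule contract_left[of "\<lambda>z. killing r (brk (brk q (brk z x)) y)"])
      (simp add: lin_form_def brk_add brk_scale killing_add killing_scale)
  finally show ?thesis .
qed

lemma sem_tree_left:
  "sem ((Sigma_tm \<boxtimes> I1) \<cdot> Sigma_tm \<cdot> GM) (kform [p, q, r]) [x, y] = killing r (brk (brk q p) (brk x y))"
proof -
  have "sem ((Sigma_tm \<boxtimes> I1) \<cdot> Sigma_tm \<cdot> GM) (kform [p, q, r]) [x, y]
      = (\<Sum>b\<in>Basis. killing q (brk p b) * killing r (brk (dual_vec b) (brk x y)))"
    by (simp only: sem_fun sem.simps(1-9) sem_Sigma sem_Sigma_left nth_pair)
  then show ?thesis by (simp only: killing_flip[of q p] contract_Sigma)
qed

lemma sem_tree_right:
  "sem ((I1 \<boxtimes> Sigma_tm) \<cdot> Sigma_tm \<cdot> GM) (kform [p, q, r]) [x, y] = killing r (brk q (brk p (brk x y)))"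
proof -
  have "sem ((I1 \<boxtimes> Sigma_tm) \<cdot> Sigma_tm \<cdot> GM) (kform [p, q, r]) [x, y]
      = (\<Sum>b\<in>Basis. killing p b * killing r (brk q (brk (dual_vec b) (brk x y))))"
    by (simp only: sem_fun sem.simps(1-9) sem_Sigma sem_Sigma_right nth_pair)
  then show ?thesis by (simp only: killing_flip[of r q] contract_Sigma)
qed

lemma sem_tau: "sem (tau_tm \<cdot> GEps) (kform [p, q, r]) [x, y] = killing x y * killing r (brk q p)"
proof -
  have "sem (tau_tm \<cdot> GEps) (kform [p, q, r]) [x, y]
      = killing x y * (\<Sum>b\<in>Basis. killing p b * killing r (brk q (dual_vec b)))"
    by (simp only: tau_tm_def sem_fun sem.simps(1-9) sem_Sigma_right nth_pair)
  also have "(\<Sum>b\<in>Basis. killing p b * killing r (brk q (dual_vec b))) = killing r (brk q p)"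
    unfolding killing_flip[of r q] contract_killing by (rule killing_commute)
  finally show ?thesis .
qed

lemma sem_S: "sem S_tm (kform [p, q, r]) [x, y] =
   killing x y * killing r (brk q p) + killing p x * killing r (brk q y) + killing q (brk p x) * killing r y
   + killing p q * killing r (brk x y) + killing p (brk x y) * killing q r + killing p r * killing q (brk x y)
   + killing r (brk p x) * killing q y + killing q x * killing r (brk p y)
   + killing q (brk p y) * killing r x + killing p y * killing r (brk q x)"
proof -
  let ?F = "kform [p, q, r]"
  have 1: "sem (GEta \<boxtimes> GM) ?F [x, y] = killing p q * killing r (brk x y)"
    by simp
  have 2: "sem (GM \<boxtimes> GEta) ?F [x, y] = killing p (brk x y) * killing q r"
    by (simp add: sum_distrib_left[symmetric])
  have 3: "sem ((GS \<boxtimes> I1) \<cdot> (GM \<boxtimes> GEta)) ?F [x, y] = killing p r * killing q (brk x y)"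
    by simp
  have 4: "sem ((I1 \<boxtimes> GS) \<cdot> (Sigma_tm \<boxtimes> I1)) ?F [x, y] = killing r (brk p x) * killing q y"
    by (simp add: sem_Sigma)
  have 5: "sem ((GS \<boxtimes> I1) \<cdot> (I1 \<boxtimes> Sigma_tm)) ?F [x, y] = killing q x * killing r (brk p y)"
    by (simp add: sem_Sigma)
  have 6: "sem ((Sigma_tm \<boxtimes> I1) \<cdot> GS) ?F [x, y] = killing q (brk p y) * killing r x"
    by (simp only: sem_fun sem.simps(1-9) sem_Sigma_left nth_pair)
  have 7: "sem ((I1 \<boxtimes> Sigma_tm) \<cdot> GS) ?F [x, y] = killing p y * killing r (brk q x)"
    by (simp only: sem_fun sem.simps(1-9) sem_Sigma_right nth_pair)
  show ?thesis
    unfolding S_tm_def sem.simps(7) 1 2 3 4 5 6 7 sem_tau sem_Sigma_left sem_Sigma_right ..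
qed

lemma sem_HH: "sem (H_tm \<cdot> H_tm) (kform [p, q]) [x, y] = tr4 y q p x"
proof -
  have *: "killing q (brk (brk p (brk x b)) (brk b' y)) = killing (brk y (brk q (brk p (brk x b)))) b'" for b b'
    unfolding killing_flip[of q "brk p (brk x b)"] by (rule killing_flip_right)
  show ?thesis
    unfolding tr4_def tr_killing by (simp only: sem_fun sem_H_general[of "sem H_tm _"] sem_H *)
qed

lemma sem_TH: "sem (T_tm \<cdot> H_tm) (kform [p, q, r]) [x, y] = tr5 y r q p x"
proof -
  have *: "killing r (brk (brk q (brk p (brk x b))) (brk b' y)) = killing (brk y (brk r (brk q (brk p (brk x b))))) b'" for b b'
    unfolding killing_flip[of r "brk q (brk p (brk x b))"] by (rule killing_flip_right)
  show ?thesis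
    unfolding tr5_def tr_killing by (simp only: sem_fun sem_H_general sem_T *)
qed

lemma D_relation: "sem D_tm (kform [p, q]) [x, y] = sem (K_tm \<boxplus> (-1) \<odot> H_tm) (kform [p, q]) [x, y]"
proof -
  have "brk (brk y p) x = brk p (brk x y) - brk (brk p x) y"
    using brk_brk_left[of p x y] brk_skew[of "brk p y" x] brk_skew[of y p] by (simp add: brk_minus)
  then show ?thesis by (simp add: sem_D sem_K sem_H killing_diff)
qed

lemma EL_types:
  "D_tm \<in> tms 2 2" "K_tm \<boxplus> (-1) \<odot> H_tm \<in> tms 2 2" "H_tm \<cdot> H_tm \<in> tms 2 2"
  "c \<odot> (H_tm \<boxplus> K_tm) \<boxplus> d \<odot> (I1 \<boxtimes> I1 \<boxplus> GEta \<cdot> GEps \<boxplus> GS) \<in> tms 2 2"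
  "T_tm \<cdot> H_tm \<in> tms 2 3"
  "c \<odot> (T_tm \<boxplus> (Sigma_tm \<boxtimes> I1) \<cdot> Sigma_tm \<cdot> GM \<boxplus> (I1 \<boxtimes> Sigma_tm) \<cdot> Sigma_tm \<cdot> GM \<boxplus> T_tm \<cdot> GS)
      \<boxplus> d \<odot> S_tm \<in> tms 2 3"
  by (simp_all add: tms_def D_tm_def K_tm_def H_tm_def T_tm_def S_tm_def tau_tm_def)

end

context quartic_lie_algebra
begin

lemma H_relation:
  "sem (H_tm \<cdot> H_tm) (kform [p, q]) [x, y] = sem ((1/6) \<odot> (H_tm \<boxplus> K_tm)
      \<boxplus> (5 / (6 * (\<delta> + 2))) \<odot> (I1 \<boxtimes> I1 \<boxplus> GEta \<cdot> GEps \<boxplus> GS)) (kform [p, q]) [x, y]"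
proof -
  have 1: "killing (brk y q) (brk p x) = killing q (brk (brk p x) y)"
    unfolding killing_flip_right by (rule HOL.refl)
  have 2: "killing (brk q p) (brk x y) = killing q (brk p (brk x y))"
    by (rule killing_invariant)
  have 3: "sem (I1 \<boxtimes> I1) (kform [p, q]) [x, y] + sem (GEta \<cdot> GEps) (kform [p, q]) [x, y]
      + sem GS (kform [p, q]) [x, y] = sym_killing y q p x"
  proof -
    have "sem (I1 \<boxtimes> I1) (kform [p, q]) [x, y] + sem (GEta \<cdot> GEps) (kform [p, q]) [x, y]
        + sem GS (kform [p, q]) [x, y]
        = killing p x * killing q y + killing x y * killing p q + killing p y * killing q x"
      by simp
    then show ?thesis by (simp add: sym_killing_def killing_commute mult.commute)
  qed
  show ?thesis
    unfolding sem.simps(7,8) sem_HH 3 sem_H sem_K box 1 2 ..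
qed

lemma T_relation:
  "sem (T_tm \<cdot> H_tm) (kform [p, q, r]) [x, y] = sem (
      (1/12) \<odot> (T_tm \<boxplus> (Sigma_tm \<boxtimes> I1) \<cdot> Sigma_tm \<cdot> GM
                     \<boxplus> (I1 \<boxtimes> Sigma_tm) \<cdot> Sigma_tm \<cdot> GM \<boxplus> T_tm \<cdot> GS)
      \<boxplus> (5 / (12 * (\<delta> + 2))) \<odot> S_tm) (kform [p, q, r]) [x, y]"
proof -
  have s: "sem (T_tm \<cdot> GS) (kform [p, q, r]) [x, y] = killing r (brk (brk q (brk p y)) x)"
    by (simp add: sem_T)
  have c: "killing u r = killing r u" "killing (brk u v) q = killing q (brk u v)"
    "killing (brk u v) p = killing p (brk u v)" "killing x p = killing p x" "killing y q = killing q y"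
    "killing y p = killing p y" for u v by (rule killing_commute)+
  show ?thesis
    unfolding sem_TH sem.simps(7,8) s sem_T sem_tree_left sem_tree_right sem_S pentagon
    by (simp only: c)
qed

lemma EL_rels_sound:
  assumes "(l, l') \<in> EL_rels \<delta>" "mlin (tgt l) F" "length xs = src l"
  shows "sem l F xs = sem l' F xs"
  using assms(1) unfolding EL_rels_def
proof (elim insertE emptyE)
  assume e: "(l, l') = (D_tm, K_tm \<boxplus> (-1) \<odot> H_tm)"
  then have l: "l \<in> tms 2 2" "l' \<in> tms 2 2" "length xs = 2" "mlin 2 F"
    using EL_types(1)  EL_types(2) assms by (auto simp: tms_def)
  obtain x y where xs: "xs = [x, y]" using length_2_cases l(3) by blast
  show ?thesis
  proof (rule sem_test[OF l])
    fix ps :: "'g list" assume "length ps = 2"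
    then obtain p q where "ps = [p, q]" using length_2_cases by blast
    then show "sem l (kform ps) xs = sem l' (kform ps) xs" using e xs D_relation by blast
  qed
next
  assume e: "(l, l') = (H_tm \<cdot> H_tm, (1/6) \<odot> (H_tm \<boxplus> K_tm)
      \<boxplus> (5 / (6 * (\<delta> + 2))) \<odot> (I1 \<boxtimes> I1 \<boxplus> GEta \<cdot> GEps \<boxplus> GS))"
  then have l: "l \<in> tms 2 2" "l' \<in> tms 2 2" by (simp_all only: prod.inject EL_types)
  then have len: "length xs = 2" "mlin 2 F" using assms by (auto simp: tms_def)
  obtain x y where xs: "xs = [x, y]" using length_2_cases len(1) by blast
  show ?thesis
  proof (rule sem_test[OF l len])
    fix ps :: "'g list" assume "length ps = 2"
    then obtain p q where "ps = [p, q]" using length_2_cases by blast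
    then show "sem l (kform ps) xs = sem l' (kform ps) xs" using e xs H_relation by blast
  qed
next
  assume e: "(l, l') = (T_tm \<cdot> H_tm,
      (1/12) \<odot> (T_tm \<boxplus> (Sigma_tm \<boxtimes> I1) \<cdot> Sigma_tm \<cdot> GM
                     \<boxplus> (I1 \<boxtimes> Sigma_tm) \<cdot> Sigma_tm \<cdot> GM \<boxplus> T_tm \<cdot> GS)
      \<boxplus> (5 / (12 * (\<delta> + 2))) \<odot> S_tm)"
  then have l: "l \<in> tms 2 3" "l' \<in> tms 2 3" by (simp_all only: prod.inject EL_types)
  then have len: "length xs = 2" "mlin 3 F" using assms by (auto simp: tms_def)
  obtain x y where xs: "xs = [x, y]" using length_2_cases len(1) by blast
  show ?thesis
  proof (rule sem_test[OF l len])
    fix ps :: "'g list" assume "length ps = 3"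
    then obtain p q r where "ps = [p, q, r]" by (auto simp: length_Suc_conv numeral_eq_Suc)
    then show "sem l (kform ps) xs = sem l' (kform ps) xs" using e xs T_relation by blast
  qed
qed

end

section \<open>Tensor powers of the adjoint representation\<close>

lemma sum_fun_apply: "(\<Sum>i\<in>A. f i) l = (\<Sum>i\<in>A. f i l)"
  by (induction A rule: infinite_finite_induct) auto

abbreviation ten_linear :: "'i ten set \<Rightarrow> ('i ten \<Rightarrow> 'i ten) \<Rightarrow> bool" where
  "ten_linear \<equiv> lin_on ten_scale ten_scale"

lemma ten_subspace_eq:
  assumes "ten.subspace V" "ten_linear V f" "ten_linear V g"
  shows "ten.subspace {v \<in> V. f v = g v}"
proof (rule ten.subspaceI)
  have 0: "h 0 = 0" if "ten_linear V h" for h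
  proof -
    have "h (ten_scale 0 0) = ten_scale 0 (h 0)"
      using that ten.subspace_0[OF assms(1)] unfolding lin_on_def by blast
    then show ?thesis by simp
  qed
  show "0 \<in> {v \<in> V. f v = g v}" using 0[OF assms(2)] 0[OF assms(3)] ten.subspace_0[OF assms(1)] by simp
  fix x y assume xy: "x \<in> {v \<in> V. f v = g v}" "y \<in> {v \<in> V. f v = g v}"
  then have "f (x + y) = f x + f y" "g (x + y) = g x + g y"
    using assms(2,3) unfolding lin_on_def by blast+
  then show "x + y \<in> {v \<in> V. f v = g v}" using xy ten.subspace_add[OF assms(1)] by simp
next
  fix c x assume x: "x \<in> {v \<in> V. f v = g v}"
  then have "f (ten_scale c x) = ten_scale c (f x)" "g (ten_scale c x) = ten_scale c (g x)"
    using assms(2,3) unfolding lin_on_def by blast+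
  then show "ten_scale c x \<in> {v \<in> V. f v = g v}" using x ten.subspace_scale[OF assms(1)] by simp
qed

lemma lin_on_span_eq:
  assumes "ten_linear (ten.span S) f" "ten_linear (ten.span S) g"
    and "\<And>s. s \<in> S \<Longrightarrow> f s = g s" "v \<in> ten.span S"
  shows "f v = g v"
proof -
  have "ten.span S \<subseteq> {v \<in> ten.span S. f v = g v}"
    by (rule ten.span_minimal[OF _ ten_subspace_eq[OF ten.subspace_span assms(1,2)]])
      (use assms(3) ten.span_base in blast)
  then show ?thesis using assms(4) by blast
qed

lemma lin_on_add: "lin_on s1 s2 V f \<Longrightarrow> v \<in> V \<Longrightarrow> w \<in> V \<Longrightarrow> f (v + w) = f v + f w"
  by (simp add: lin_on_def)

lemma lin_on_scale: "lin_on s1 s2 V f \<Longrightarrow> v \<in> V \<Longrightarrow> f (s1 c v) = s2 c (f v)"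
  by (simp add: lin_on_def)

lemma lin_on_0:
  assumes "ten_linear V f" "ten.subspace V" shows "f 0 = 0"
  using lin_on_scale[OF assms(1) ten.subspace_0[OF assms(2)], of 0] by simp

lemma lin_on_sum:
  assumes f: "ten_linear V f" and V: "ten.subspace V" and "\<And>i. i \<in> A \<Longrightarrow> u i \<in> V"
  shows "f (\<Sum>i\<in>A. ten_scale (c i) (u i)) = (\<Sum>i\<in>A. ten_scale (c i) (f (u i)))"
  using assms(3)
proof (induction A rule: infinite_finite_induct)
  case (insert i A)
  have "ten_scale (c i) (u i) \<in> V" "(\<Sum>i\<in>A. ten_scale (c i) (u i)) \<in> V"
    using insert.prems V by (auto intro!: ten.subspace_sum ten.subspace_scale)
  moreover have "f (\<Sum>i\<in>A. ten_scale (c i) (u i)) = (\<Sum>i\<in>A. ten_scale (c i) (f (u i)))"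
    by (rule insert.IH) (use insert.prems in blast)
  moreover have "f (ten_scale (c i) (u i)) = ten_scale (c i) (f (u i))"
    by (rule lin_on_scale[OF f]) (use insert.prems in blast)
  ultimately show ?case
    by (simp only: sum.insert[OF insert.hyps] lin_on_add[OF f])
qed (simp_all add: lin_on_0[OF f V])

context complex_lie_algebra
begin

lemma emb_add: "emb (x + y) = emb x + emb y"
  by (rule ext) (auto simp: emb_def lin_form_iff[symmetric] lin_form_def split: list.splits)

lemma emb_scale: "emb (c *s x) = ten_scale c (emb x)"
  by (rule ext) (auto simp: emb_def ten_scale_def lin_form_iff[symmetric] lin_form_def split: list.splits)

lemma emb_coord: "emb x [coord b] = coord b x"
  using lin_form_coord[of b] by (simp add: emb_def lin_form_iff)

lemma unemb_emb [simp]: "unemb (emb x) = x"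
proof -
  have "inj emb"
  proof (rule injI)
    fix x y assume "emb x = emb y"
    then have "coord b x = coord b y" for b using emb_coord[of x b] emb_coord[of y b] by simp
    then have "(\<Sum>b\<in>Basis. coord b x *s b) = (\<Sum>b\<in>Basis. coord b y *s b)" by simp
    then show "x = y" unfolding sum_coord .
  qed
  then show ?thesis unfolding unemb_def by (rule inv_f_f)
qed

primrec embw :: "'g list \<Rightarrow> ('g \<Rightarrow> complex) ten" where
  "embw [] = ten_one"
| "embw (x # xs) = tprod 1 (emb x) (embw xs)"

lemma emb_length: "length l \<noteq> 1 \<Longrightarrow> emb x l = 0"
  by (auto simp: emb_def split: list.splits)

lemma embw_length: "length l \<noteq> length xs \<Longrightarrow> embw xs l = 0"
proof (induction xs arbitrary: l)
  case Nil then show ?case by (auto simp: ten_one_def)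
next
  case (Cons x xs)
  show ?case
  proof (cases l)
    case Nil then show ?thesis by (simp add: tprod_def emb_length)
  next
    case (Cons a l')
    then have "embw xs l' = 0" using Cons.prems Cons.IH[of l'] by simp
    then show ?thesis using Cons by (simp add: tprod_def)
  qed
qed

lemma tprod_one_left: "tprod 0 ten_one v = v"
  by (rule ext) (simp add: tprod_def ten_one_def)

lemma tprod_assoc: "tprod 1 u (tprod k v w) = tprod (Suc k) (tprod 1 u v) w"
  by (rule ext) (simp add: tprod_def take_drop min_def)

lemma embw_append: "embw (xs @ ys) = tprod (length xs) (embw xs) (embw ys)"
  by (induction xs) (simp_all add: tprod_one_left tprod_assoc[unfolded One_nat_def])

lemma embw_single: "embw [x] = emb x"
proof
  fix l show "embw [x] l = emb x l"
    by (cases l; cases "tl l") (auto simp: tprod_def ten_one_def emb_length)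
qed

lemma embw_mlin: "mlin n (\<lambda>xs. embw xs l)"
  unfolding mlin_def
proof (intro allI impI)
  fix xs ys :: "'g list"
  have "embw (xs @ v # ys) l = embw xs (take (length xs) l) * (emb v (take 1 (drop (length xs) l)) * embw ys (drop 1 (drop (length xs) l)))" for v
    by (simp add: embw_append tprod_def)
  then show "lin_form (\<lambda>v. embw (xs @ v # ys) l)"
    unfolding lin_form_def by (simp add: emb_add emb_scale ten_scale_def algebra_simps)
qed

definition Cn :: "nat \<Rightarrow> ('g \<Rightarrow> complex) ten set" where
  "Cn n = ten.span {embw xs | xs. length xs = n}"

lemma Cn_subspace: "ten.subspace (Cn n)"
  by (simp add: Cn_def)

lemma embw_Cn: "length xs = n \<Longrightarrow> embw xs \<in> Cn n"
  unfolding Cn_def by (rule ten.span_base) blast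

lemma lin_on_Cn_eq:
  assumes "ten_linear (Cn n) f" "ten_linear (Cn n) g"
    and "\<And>xs. length xs = n \<Longrightarrow> f (embw xs) = g (embw xs)" "v \<in> Cn n"
  shows "f v = g v"
  using assms(4) unfolding Cn_def
  by (rule lin_on_span_eq[OF assms(1,2)[unfolded Cn_def], rotated]) (use assms(3) in blast)

lemma lin_on_Cn_ext:
  assumes "f \<in> extensional (Cn n)" "g \<in> extensional (Cn n)"
    "ten_linear (Cn n) f" "ten_linear (Cn n) g"
    and "\<And>xs. length xs = n \<Longrightarrow> f (embw xs) = g (embw xs)"
  shows "f = g"
  by (rule extensionalityI[OF assms(1,2)]) (rule lin_on_Cn_eq[OF assms(3-5)])

lemma Cn_0: "Cn 0 = ten.span {ten_one}"
  unfolding Cn_def by (rule arg_cong[of _ _ ten.span]) auto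

lemma Cn_1: "Cn 1 = range emb"
proof
  have "ten.subspace (range emb)"
  proof (rule ten.subspaceI)
    have "emb 0 = 0" using emb_scale[of 0 0] by simp
    then show "0 \<in> range emb" by (metis rangeI)
    show "u + v \<in> range emb" if "u \<in> range emb" "v \<in> range emb" for u v
      using that emb_add[symmetric] by (auto simp del: plus_fun_apply)
    show "ten_scale c u \<in> range emb" if "u \<in> range emb" for c u
      using that emb_scale[symmetric] by auto
  qed
  then show "Cn 1 \<subseteq> range emb"
    unfolding Cn_def
  proof (rule ten.span_minimal[rotated])
    show "{embw xs |xs. length xs = 1} \<subseteq> range emb"
    proof
      fix v assume "v \<in> {embw xs |xs. length xs = 1}"
      then obtain xs where xs: "v = embw xs" "length xs = Suc 0" by auto
      then obtain x where "xs = [x]" using length_1_cases by blast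
      then show "v \<in> range emb" using xs(1) embw_single by blast
    qed
  qed
  show "range emb \<subseteq> Cn 1"
  proof
    fix v assume "v \<in> range emb"
    then obtain x where "v = embw [x]" using embw_single by auto
    then show "v \<in> Cn 1" using embw_Cn[of "[x]" 1] by simp
  qed
qed

lemma Cn_support: "v \<in> Cn n \<Longrightarrow> length l \<noteq> n \<Longrightarrow> v l = 0"
proof -
  assume v: "v \<in> Cn n" and l: "length l \<noteq> n"
  have "ten.subspace {v. v l = 0}" by (rule ten.subspaceI) (auto simp: ten_scale_def)
  then have "Cn n \<subseteq> {v. v l = 0}"
    unfolding Cn_def by (rule ten.span_minimal[rotated]) (use embw_length l in auto)
  then show "v l = 0" using v by blast
qed

lemma tprod_add_left: "tprod m (u + v) w = tprod m u w + tprod m v w"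
  by (rule ext) (simp add: tprod_def algebra_simps)

lemma tprod_add_right: "tprod m u (v + w) = tprod m u v + tprod m u w"
  by (rule ext) (simp add: tprod_def algebra_simps)

lemma tprod_scale_left: "tprod m (ten_scale c u) w = ten_scale c (tprod m u w)"
  by (rule ext) (simp add: tprod_def ten_scale_def algebra_simps)

lemma tprod_scale_right: "tprod m u (ten_scale c w) = ten_scale c (tprod m u w)"
  by (rule ext) (simp add: tprod_def ten_scale_def algebra_simps)

lemma tprod_0: "tprod m 0 w = 0" "tprod m v 0 = 0"
  by (rule ext, simp add: tprod_def)+

lemma tprod_Cn:
  assumes v: "v \<in> Cn m" and w: "w \<in> Cn n"
  shows "tprod m v w \<in> Cn (m + n)"
proof -
  note sub = ten.subspace_0[OF Cn_subspace] ten.subspace_add[OF Cn_subspace] ten.subspace_scale[OF Cn_subspace]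
  have 1: "ten.subspace {w. tprod m v w \<in> Cn (m + n)}" for v
    by (rule ten.subspaceI) (simp_all only: mem_Collect_eq tprod_0 tprod_add_right tprod_scale_right sub)
  have 2: "ten.subspace {v. tprod m v w \<in> Cn (m + n)}" for w
    by (rule ten.subspaceI) (simp_all only: mem_Collect_eq tprod_0 tprod_add_left tprod_scale_left sub)
  have 3: "tprod m (embw xs) w \<in> Cn (m + n)" if xs: "length xs = m" for xs
  proof -
    have "tprod m (embw xs) (embw ys) \<in> Cn (m + n)" if "length ys = n" for ys
      using embw_Cn[of "xs @ ys"] xs that by (simp add: embw_append)
    then have "Cn n \<subseteq> {w. tprod m (embw xs) w \<in> Cn (m + n)}"
      unfolding Cn_def[of n] by (intro ten.span_minimal 1) auto
    then show ?thesis using w by blast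
  qed
  have "Cn m \<subseteq> {v. tprod m v w \<in> Cn (m + n)}"
    unfolding Cn_def[of m] by (intro ten.span_minimal 2) (use 3 in auto)
  then show ?thesis using v by blast
qed

definition combo_ten :: "(complex \<times> 'g list) list \<Rightarrow> ('g \<Rightarrow> complex) ten" where
  "combo_ten L = (\<lambda>l. combo L (\<lambda>ys. embw ys l))"

lemma combo_ten_Cons: "combo_ten (p # L) = ten_scale (fst p) (embw (snd p)) + combo_ten L"
  by (rule ext) (simp add: combo_ten_def ten_scale_def)

lemma combo_ten_Nil: "combo_ten [] = 0"
  by (rule ext) (simp add: combo_ten_def)

lemma combo_ten_Cn: "(\<forall>p\<in>set L. length (snd p) = n) \<Longrightarrow> combo_ten L \<in> Cn n"
  by (induction L)
    (auto simp: combo_ten_Cons combo_ten_Nil intro!: ten.subspace_0 ten.subspace_add ten.subspace_scale Cn_subspace embw_Cn)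

lemma lin_on_combo:
  assumes f: "ten_linear (Cn n) f"
    and g: "\<And>xs. length xs = n \<Longrightarrow> f (embw xs) = (\<lambda>l. g l xs)"
    and L: "\<forall>p\<in>set L. length (snd p) = n"
  shows "f (combo_ten L) = (\<lambda>l. combo L (g l))"
  using L
proof (induction L)
  case Nil
  show ?case using lin_on_0[OF f Cn_subspace] by (simp add: combo_ten_Nil zero_fun_def)
next
  case (Cons p L)
  have "f (combo_ten (p # L)) = ten_scale (fst p) (f (embw (snd p))) + f (combo_ten L)"
    unfolding combo_ten_Cons using Cons.prems
    by (simp add: lin_on_add[OF f] lin_on_scale[OF f] ten.subspace_scale[OF Cn_subspace] embw_Cn combo_ten_Cn)
  then show ?case using Cons by (simp add: g ten_scale_def plus_fun_def)
qed

lemma der_combo: "\<exists>L. (\<forall>p\<in>set L. length (snd p) = length xs) \<and> (\<forall>F. der x F xs = combo L F)"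
proof (induction xs)
  case Nil show ?case by (intro exI[of _ "[]"]) simp
next
  case (Cons v vs)
  then obtain L where L: "\<forall>p\<in>set L. length (snd p) = length vs" "\<forall>F. der x F vs = combo L F" by blast
  have "combo (map (\<lambda>p. (fst p, v # snd p)) L) F = combo L (\<lambda>ws. F (v # ws))" for F
    by (induction L) simp_all
  then show ?case using L by (intro exI[of _ "(1, brk x v # vs) # map (\<lambda>p. (fst p, v # snd p)) L"]) simp
qed

text \<open>
  The representation on \<open>n\<close>-fold tensors, described without reference to a
  bracketing. There is only one such representation for each \<open>n\<close>. So tensor
  products of tensor powers are tensor powers on the nose, and the associativity and unit laws
  come for free.
\<close>

definition std :: "nat \<Rightarrow> ('g, 'g \<Rightarrow> complex) rep \<Rightarrow> bool" where
  "std n V \<longleftrightarrow> deg V = n \<and> car V = Cn n \<and> (\<forall>x. act V x \<in> extensional (Cn n) \<and>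
     ten_linear (Cn n) (act V x) \<and>
     (\<forall>xs. length xs = n \<longrightarrow> act V x (embw xs) = (\<lambda>l. der x (\<lambda>ys. embw ys l) xs)))"

lemma std_unique: assumes "std n V" "std n W" shows "V = W"
proof -
  have "act V x = act W x" for x
    by (rule lin_on_Cn_ext[of _ n]) (use assms in \<open>auto simp: std_def\<close>)
  then have "act V = act W" by blast
  then show ?thesis using assms by (cases V; cases W) (simp add: std_def)
qed

end

context killing_lie_algebra
begin

text \<open>
  A tensor is a function on words of linear functionals. Its values at words of coordinate
  functionals are its coordinates with respect to the tensors of basis words.
\<close>

lemma Cn_expand:
  assumes v: "v \<in> Cn n"
  shows "(\<Sum>ws\<in>words n. ten_scale (v (map coord ws)) (embw ws)) = v"
proof -
  define E where "E v = (\<Sum>ws\<in>words n. ten_scale (v (map coord ws)) (embw ws))" for v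
  have E_apply: "E v l = (\<Sum>ws\<in>words n. v (map coord ws) * embw ws l)" for v l
    by (simp add: E_def sum_fun_apply ten_scale_def)
  have coords: "embw xs (map coord ws) = kform (map dual_vec ws) xs"
    if "length xs = length ws" "set ws \<subseteq> Basis" for xs ws
    using that
  proof (induction xs ws rule: list_induct2)
    case (Cons x xs b ws)
    then show ?case by (simp add: tprod_def emb_coord coord_eq_killing killing_commute)
  qed (simp add: ten_one_def)
  have gen: "E (embw xs) = embw xs" if "length xs = n" for xs
  proof
    fix l
    have "embw xs l = (\<Sum>ws\<in>words n. kform (map dual_vec ws) xs * embw ws l)"
      using mlin_expand[OF embw_mlin[of n l] that] .
    also have "\<dots> = (\<Sum>ws\<in>words n. embw xs (map coord ws) * embw ws l)"
      by (rule sum.cong) (use that in \<open>auto simp: coords words_def\<close>)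
    finally show "E (embw xs) l = embw xs l" by (simp add: E_apply)
  qed
  have add: "E (x + y) = E x + E y" for x y
    by (rule ext) (simp add: E_apply sum.distrib algebra_simps)
  have scl: "E (ten_scale c x) = ten_scale c (E x)" for c x
    by (rule ext) (simp add: E_apply ten_scale_def sum_distrib_left mult.assoc)
  have sub: "ten.subspace {v. E v = v}"
  proof (rule ten.subspaceI)
    have "E 0 = 0" by (rule ext) (simp add: E_apply)
    then show "0 \<in> {v. E v = v}" by simp
  qed (simp_all only: mem_Collect_eq add scl)
  have "Cn n \<subseteq> {v. E v = v}"
    unfolding Cn_def by (rule ten.span_minimal[OF _ sub]) (use gen in blast)
  then show ?thesis using v unfolding E_def by blast
qed

lemma Cn_finite_span: "Cn n = ten.span (embw ` words n)"
proof
  show "Cn n \<subseteq> ten.span (embw ` words n)"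
  proof
    fix v assume "v \<in> Cn n"
    have "(\<Sum>ws\<in>words n. ten_scale (v (map coord ws)) (embw ws)) \<in> ten.span (embw ` words n)"
      by (intro ten.span_sum ten.span_scale ten.span_base imageI)
    then show "v \<in> ten.span (embw ` words n)" unfolding Cn_expand[OF \<open>v \<in> Cn n\<close>] .
  qed
  show "ten.span (embw ` words n) \<subseteq> Cn n"
    by (rule ten.span_minimal[OF _ Cn_subspace]) (auto intro: embw_Cn simp: words_def)
qed

definition bilin_Cn :: "nat \<Rightarrow> nat \<Rightarrow> (('g \<Rightarrow> complex) ten \<Rightarrow> ('g \<Rightarrow> complex) ten \<Rightarrow> ('g \<Rightarrow> complex) ten) \<Rightarrow> bool" where
  "bilin_Cn m n \<beta> \<longleftrightarrow> (\<forall>w\<in>Cn n. ten_linear (Cn m) (\<lambda>v. \<beta> v w)) \<and>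
     (\<forall>v\<in>Cn m. ten_linear (Cn n) (\<beta> v))"

lemma tens_car_Cn:
  assumes "deg V = m" "car V = Cn m" "car W = Cn n"
  shows "tens_car V W = Cn (m + n)"
proof
  show "tens_car V W \<subseteq> Cn (m + n)"
    unfolding tens_car_def assms by (rule ten.span_minimal[OF _ Cn_subspace]) (auto intro: tprod_Cn)
  have "embw zs \<in> {tprod m v w | v w. v \<in> Cn m \<and> w \<in> Cn n}" if "length zs = m + n" for zs
  proof -
    have "embw zs = tprod m (embw (take m zs)) (embw (drop m zs))"
      using embw_append[of "take m zs" "drop m zs"] that by simp
    moreover have "embw (take m zs) \<in> Cn m" "embw (drop m zs) \<in> Cn n" using that by (auto intro: embw_Cn)
    ultimately show ?thesis by blast
  qed
  then show "Cn (m + n) \<subseteq> tens_car V W"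
    unfolding tens_car_def assms Cn_def[of "m + n"] by (intro ten.span_mono) blast
qed

text \<open>
  The linear map induced by \<open>\<beta>\<close> is written down in the coordinates of
  \<open>Cn_expand\<close>. It is unique because tensors of words span.
\<close>

lemma lift_Cn:
  assumes V: "deg V = m" "car V = Cn m" and W: "car W = Cn n" and \<beta>: "bilin_Cn m n \<beta>"
  shows "lift V W \<beta> \<in> extensional (Cn (m + n))"
    "ten_linear (Cn (m + n)) (lift V W \<beta>)"
    "\<And>v w. v \<in> Cn m \<Longrightarrow> w \<in> Cn n \<Longrightarrow> lift V W \<beta> (tprod m v w) = \<beta> v w"
    "\<And>xs ys. length xs = m \<Longrightarrow> length ys = n \<Longrightarrow> lift V W \<beta> (embw (xs @ ys)) = \<beta> (embw xs) (embw ys)"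
proof -
  let ?P = "\<lambda>h. h \<in> extensional (tens_car V W) \<and> ten_linear (tens_car V W) h \<and>
        (\<forall>v\<in>car V. \<forall>w\<in>car W. h (tprod (deg V) v w) = \<beta> v w)"
  note tc = tens_car_Cn[OF V W]
  define h0 where "h0 v = (\<Sum>ws\<in>words m. \<Sum>us\<in>words n.
      ten_scale (v (map coord (ws @ us))) (\<beta> (embw ws) (embw us)))" for v
  have wordsC: "ws \<in> words k \<Longrightarrow> embw ws \<in> Cn k" for ws k by (simp add: words_def embw_Cn)
  have h0_add: "h0 (v + w) = h0 v + h0 w" for v w
    unfolding h0_def by (simp add: ten.scale_left_distrib sum.distrib)
  have h0_scale: "h0 (ten_scale c v) = ten_scale c (h0 v)" for c v
    unfolding h0_def ten.scale_sum_right by (simp add: ten_scale_def mult.assoc)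
  have h0_tprod: "h0 (tprod m v w) = \<beta> v w" if v: "v \<in> Cn m" and w: "w \<in> Cn n" for v w
  proof -
    have "\<beta> v w = (\<Sum>ws\<in>words m. ten_scale (v (map coord ws)) (\<beta> (embw ws) w))"
    proof -
      have "ten_linear (Cn m) (\<lambda>v. \<beta> v w)" using \<beta> w by (simp add: bilin_Cn_def)
      from lin_on_sum[OF this Cn_subspace, of "words m" embw "\<lambda>ws. v (map coord ws)"]
      show ?thesis using wordsC unfolding Cn_expand[OF v] by simp
    qed
    also have "\<dots> = (\<Sum>ws\<in>words m. ten_scale (v (map coord ws))
        (\<Sum>us\<in>words n. ten_scale (w (map coord us)) (\<beta> (embw ws) (embw us))))"
    proof (rule sum.cong[OF HOL.refl])
      fix ws assume "ws \<in> words m"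
      then have "ten_linear (Cn n) (\<beta> (embw ws))" using \<beta> wordsC by (simp add: bilin_Cn_def)
      from lin_on_sum[OF this Cn_subspace, of "words n" embw "\<lambda>us. w (map coord us)"]
      have "\<beta> (embw ws) w = (\<Sum>us\<in>words n. ten_scale (w (map coord us)) (\<beta> (embw ws) (embw us)))"
        using wordsC unfolding Cn_expand[OF w] by simp
      then show "ten_scale (v (map coord ws)) (\<beta> (embw ws) w) = ten_scale (v (map coord ws))
        (\<Sum>us\<in>words n. ten_scale (w (map coord us)) (\<beta> (embw ws) (embw us)))" by simp
    qed
    also have "\<dots> = h0 (tprod m v w)"
      unfolding h0_def ten.scale_sum_right
      by (intro sum.cong HOL.refl) (simp add: tprod_def words_def)
    finally show ?thesis ..
  qed
  let ?h = "restrict h0 (Cn (m + n))"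
  have ex: "?P ?h"
    unfolding tc V W
    using h0_add h0_scale h0_tprod tprod_Cn ten.subspace_add[OF Cn_subspace] ten.subspace_scale[OF Cn_subspace]
    by (simp add: lin_on_def)
  have un: "h = ?h" if "?P h" for h
  proof (rule lin_on_Cn_ext[of _ "m + n"])
    fix zs :: "'g list" assume zs: "length zs = m + n"
    have e: "embw zs = tprod m (embw (take m zs)) (embw (drop m zs))"
      using embw_append[of "take m zs" "drop m zs"] zs by simp
    have c: "embw (take m zs) \<in> Cn m" "embw (drop m zs) \<in> Cn n" using zs by (auto intro: embw_Cn)
    have "h (embw zs) = \<beta> (embw (take m zs)) (embw (drop m zs))"
      using that c unfolding V W e by blast
    moreover have "?h (embw zs) = \<beta> (embw (take m zs)) (embw (drop m zs))"
      using ex c unfolding V W e by blast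
    ultimately show "h (embw zs) = ?h (embw zs)" by simp
  qed (use that ex in \<open>simp_all add: tc\<close>)
  have P: "?P (lift V W \<beta>)"
    unfolding lift_def by (rule theI[of ?P, OF ex un])
  show "lift V W \<beta> \<in> extensional (Cn (m + n))" "ten_linear (Cn (m + n)) (lift V W \<beta>)"
    using P unfolding tc by blast+
  show 3: "lift V W \<beta> (tprod m v w) = \<beta> v w" if "v \<in> Cn m" "w \<in> Cn n" for v w
    using P that unfolding V W by blast
  show "lift V W \<beta> (embw (xs @ ys)) = \<beta> (embw xs) (embw ys)" if "length xs = m" "length ys = n" for xs ys
    using 3[OF embw_Cn[OF that(1)] embw_Cn[OF that(2)]] that by (simp add: embw_append)
qed

lemma std_unit: "std 0 unit_rep"
  unfolding std_def
proof (intro conjI allI impI)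
  show "deg unit_rep = 0" "car unit_rep = Cn 0" by (simp_all add: unit_rep_def Cn_0)
  fix x :: 'g
  show "act unit_rep x \<in> extensional (Cn 0)" by (simp add: unit_rep_def Cn_0)
  show "ten_linear (Cn 0) (act unit_rep x)"
    unfolding Cn_0 unit_rep_def by (simp add: lin_on_def ten.span_add ten.span_scale)
  fix xs :: "'g list" assume "length xs = 0"
  then show "act unit_rep x (embw xs) = (\<lambda>l. der x (\<lambda>ys. embw ys l) xs)"
    by (simp add: unit_rep_def ten.span_base zero_fun_def)
qed

lemma std_adj: "std 1 adj_rep"
  unfolding std_def
proof (intro conjI allI impI)
  show "deg adj_rep = 1" "car adj_rep = Cn 1" unfolding Cn_1 by (simp_all add: adj_rep_def)
  fix x
  show "act adj_rep x \<in> extensional (Cn 1)" unfolding Cn_1 by (simp add: adj_rep_def)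
  show "ten_linear (Cn 1) (act adj_rep x)"
    unfolding Cn_1 adj_rep_def
    by (auto simp: lin_on_def emb_add[symmetric] emb_scale[symmetric] brk_add brk_scale)
  fix xs :: "'g list" assume "length xs = 1"
  then obtain v where "xs = [v]" using length_1_cases by auto
  then show "act adj_rep x (embw xs) = (\<lambda>l. der x (\<lambda>ys. embw ys l) xs)"
    by (simp add: adj_rep_def embw_single del: embw.simps)
qed

lemma std_tens:
  assumes V: "std m V" and W: "std n W"
  shows "std (m + n) (tens_rep V W)"
proof -
  have v: "deg V = m" "car V = Cn m" and w: "deg W = n" "car W = Cn n" using V W by (simp_all add: std_def)
  let ?\<beta> = "\<lambda>x v w. tprod (deg V) (act V x v) w + tprod (deg V) v (act W x w)"
  have lV: "ten_linear (Cn m) (act V x)" for x using V by (simp add: std_def)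
  have lW: "ten_linear (Cn n) (act W x)" for x using W by (simp add: std_def)
  have bil: "bilin_Cn m n (?\<beta> x)" for x
    unfolding bilin_Cn_def lin_on_def
    by (simp add: lin_on_add[OF lV] lin_on_scale[OF lV] lin_on_add[OF lW] lin_on_scale[OF lW]
        tprod_add_left tprod_add_right tprod_scale_left tprod_scale_right ten.scale_right_distrib)
  note L = lift_Cn[OF v w(2) bil]
  show ?thesis
    unfolding std_def
  proof (intro conjI allI impI)
    show "deg (tens_rep V W) = m + n" using v w by (simp add: tens_rep_def)
    show "car (tens_rep V W) = Cn (m + n)" using tens_car_Cn[OF v w(2)] by (simp add: tens_rep_def)
    fix x
    have a: "act (tens_rep V W) x = lift V W (?\<beta> x)" by (simp add: tens_rep_def)
    show "act (tens_rep V W) x \<in> extensional (Cn (m + n))"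
      "ten_linear (Cn (m + n)) (act (tens_rep V W) x)" unfolding a by (rule L(1), rule L(2))
    fix zs :: "'g list" assume zs: "length zs = m + n"
    let ?xs = "take m zs" and ?ys = "drop m zs"
    have len: "length ?xs = m" "length ?ys = n" using zs by auto
    have "act (tens_rep V W) x (embw (?xs @ ?ys)) =
        tprod m (\<lambda>l. der x (\<lambda>us. embw us l) ?xs) (embw ?ys) + tprod m (embw ?xs) (\<lambda>l. der x (\<lambda>us. embw us l) ?ys)"
      unfolding a using L(4)[OF len] V W len v(1) by (simp add: std_def)
    also have "\<dots> = (\<lambda>l. der x (\<lambda>us. embw us l) (?xs @ ?ys))"
    proof
      fix l
      have 1: "der x (\<lambda>us. embw (us @ ?ys) l) ?xs = der x (\<lambda>us. embw us (take m l)) ?xs * embw ?ys (drop m l)"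
      proof -
        obtain L where L: "\<forall>p\<in>set L. length (snd p) = length ?xs" "\<And>F. der x F ?xs = combo L F"
          using der_combo[of ?xs x] by blast
        have "combo L (\<lambda>us. embw (us @ ?ys) l) = combo L (\<lambda>us. embw ?ys (drop m l) * embw us (take m l))"
          by (rule combo_cong) (use L(1) len in \<open>simp add: embw_append tprod_def\<close>)
        then show ?thesis unfolding L(2) combo_scale by simp
      qed
      have 2: "der x (\<lambda>us. embw (?xs @ us) l) ?ys = embw ?xs (take m l) * der x (\<lambda>us. embw us (drop m l)) ?ys"
      proof -
        obtain L where L: "\<forall>p\<in>set L. length (snd p) = length ?ys" "\<And>F. der x F ?ys = combo L F"
          using der_combo[of ?ys x] by blast
        have "combo L (\<lambda>us. embw (?xs @ us) l) = combo L (\<lambda>us. embw ?xs (take m l) * embw us (drop m l))"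
          by (rule combo_cong) (use len in \<open>simp add: embw_append tprod_def\<close>)
        then show ?thesis unfolding L(2) combo_scale .
      qed
      show "(tprod m (\<lambda>l. der x (\<lambda>us. embw us l) ?xs) (embw ?ys) + tprod m (embw ?xs) (\<lambda>l. der x (\<lambda>us. embw us l) ?ys)) l
          = der x (\<lambda>us. embw us l) (?xs @ ?ys)"
        unfolding der_append 1 2 by (simp add: tprod_def)
    qed
    finally show "act (tens_rep V W) x (embw zs) = (\<lambda>l. der x (\<lambda>us. embw us l) zs)" by simp
  qed
qed

lemma std_Phi_obj: "std n (Phi_obj n)"
proof (induction n)
  case 0
  show ?case using std_unit by (simp add: Phi_obj_def gmod_def)
next
  case (Suc n)
  then have "std (1 + n) (tens_rep adj_rep (Phi_obj n))" by (rule std_tens[OF std_adj])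
  then show ?case by (simp add: Phi_obj_def gmod_def)
qed

lemma car_Phi_obj [simp]: "car (Phi_obj n) = Cn n" "deg (Phi_obj n) = n"
  using std_Phi_obj[of n] by (simp_all add: std_def)

lemma tens_Phi_obj: "tens_rep (Phi_obj m) (Phi_obj n) = Phi_obj (m + n)"
  by (rule std_unique[OF std_tens[OF std_Phi_obj std_Phi_obj] std_Phi_obj])

lemma adj_Phi_obj: "adj_rep = Phi_obj 1"
  by (rule std_unique[OF std_adj std_Phi_obj])

lemma unit_Phi_obj: "unit_rep = Phi_obj 0"
  by (rule std_unique[OF std_unit std_Phi_obj])

end

context complex_lie_algebra
begin

lemma der_add: "der x (\<lambda>ys. F ys + G ys) xs = der x F xs + der x G xs"
  by (induction xs arbitrary: F G) simp_all

lemma der_brk: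
  assumes "mlin (length xs) F"
  shows "der (brk x y) F xs = der y (der x F) xs - der x (der y F) xs"
  using assms
proof (induction xs arbitrary: F)
  case (Cons v vs)
  have F: "mlin (length vs) (\<lambda>ws. F (v # ws))"
    using mlin_append_left[of 1 "length vs" F "[v]"] Cons.prems by simp
  have "lin_form (\<lambda>v. F (v # vs))"
    using mlinD[OF Cons.prems, of "[]" vs] by simp
  then have "F (brk x (brk y v) # vs) = F (brk (brk x y) v # vs) + F (brk y (brk x v) # vs)"
    using brk_brk_left[of x y v] unfolding lin_form_def by (metis diff_add_cancel)
  moreover have "der x (der y F) (v # vs) = F (brk y (brk x v) # vs) + der y (\<lambda>ws. F (brk x v # ws)) vs
      + der x (\<lambda>ws. F (brk y v # ws)) vs + der x (der y (\<lambda>ws. F (v # ws))) vs" for x y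
    by (simp add: der_add)
  ultimately show ?case using Cons.IH[OF F] by simp
qed simp

lemma lin_form_der: "mlin (length xs) F \<Longrightarrow> lin_form (\<lambda>x. der x F xs)"
proof (induction xs arbitrary: F)
  case (Cons v vs)
  have "mlin (length vs) (\<lambda>ws. F (v # ws))"
    using mlin_append_left[of 1 "length vs" F "[v]"] Cons.prems by simp
  then have 1: "lin_form (\<lambda>x. der x (\<lambda>ws. F (v # ws)) vs)" by (rule Cons.IH)
  have 2: "lin_form (\<lambda>v. F (v # vs))"
    using mlinD[OF Cons.prems, of "[]" vs] by simp
  show ?case using 1 2 by (simp add: lin_form_def brk_add brk_scale algebra_simps)
qed (simp add: lin_form_def)

lemma std_act_embw: "std n V \<Longrightarrow> length xs = n \<Longrightarrow> act V x (embw xs) = (\<lambda>l. der x (\<lambda>ys. embw ys l) xs)"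
  by (simp add: std_def)

lemma std_lin: "std n V \<Longrightarrow> ten_linear (Cn n) (act V x)"
  by (simp add: std_def)

lemma std_act_combo:
  assumes V: "std n V" and L: "\<forall>p\<in>set L. length (snd p) = n"
  shows "act V x (combo_ten L) = (\<lambda>l. combo L (der x (\<lambda>ys. embw ys l)))"
  by (rule lin_on_combo[OF std_lin[OF V] std_act_embw[OF V] L])

lemma maps_Cn:
  assumes f: "ten_linear (Cn m) f" and g: "\<And>xs. length xs = m \<Longrightarrow> f (embw xs) \<in> Cn n"
    and v: "v \<in> Cn m"
  shows "f v \<in> Cn n"
proof -
  have "ten.subspace {v \<in> Cn m. f v \<in> Cn n}"
  proof (rule ten.subspaceI)
    show "0 \<in> {v \<in> Cn m. f v \<in> Cn n}"
      using lin_on_0[OF f Cn_subspace] ten.subspace_0[OF Cn_subspace] by simp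
    show "x + y \<in> {v \<in> Cn m. f v \<in> Cn n}" if "x \<in> {v \<in> Cn m. f v \<in> Cn n}" "y \<in> {v \<in> Cn m. f v \<in> Cn n}" for x y
      using that lin_on_add[OF f] ten.subspace_add[OF Cn_subspace] by simp
    show "ten_scale c x \<in> {v \<in> Cn m. f v \<in> Cn n}" if "x \<in> {v \<in> Cn m. f v \<in> Cn n}" for c x
      using that lin_on_scale[OF f] ten.subspace_scale[OF Cn_subspace] by simp
  qed
  then have "Cn m \<subseteq> {v \<in> Cn m. f v \<in> Cn n}"
    unfolding Cn_def[of m] by (intro ten.span_minimal) (use g ten.span_base in \<open>auto simp: Cn_def[of m, symmetric] embw_Cn\<close>)
  then show ?thesis using v by blast
qed

lemma std_act_Cn:
  assumes V: "std n V" and v: "v \<in> Cn n"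
  shows "act V x v \<in> Cn n"
proof (rule maps_Cn[OF std_lin[OF V] _ v])
  fix xs :: "'g list" assume xs: "length xs = n"
  obtain L where L: "\<forall>p\<in>set L. length (snd p) = length xs" "\<And>F. der x F xs = combo L F"
    using der_combo[of xs x] by blast
  have "act V x (embw xs) = combo_ten L"
    unfolding std_act_embw[OF V xs] L(2) combo_ten_def ..
  then show "act V x (embw xs) \<in> Cn n" using combo_ten_Cn L(1) xs by simp
qed

end

context killing_lie_algebra
begin

lemma std_is_rep:
  assumes V: "std n V" shows "is_rep V"
proof -
  have c: "car V = Cn n" "deg V = n" using V by (simp_all add: std_def)
  note lin = std_lin[OF V] and C = std_act_Cn[OF V]
  have linear: "lin_on scale ten_scale UNIV (\<lambda>x. act V x v)" if "v \<in> Cn n" for v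
  proof -
    have "act V (x + y) v = act V x v + act V y v" for x y
    proof (rule lin_on_Cn_eq[OF lin _ _ that])
      show "ten_linear (Cn n) (\<lambda>v. act V x v + act V y v)"
        using lin by (simp add: lin_on_def ten.scale_right_distrib)
      fix xs :: "'g list" assume "length xs = n"
      then show "act V (x + y) (embw xs) = act V x (embw xs) + act V y (embw xs)"
        using lin_form_der[of xs, OF embw_mlin] by (simp add: std_act_embw[OF V] lin_form_def plus_fun_def)
    qed
    moreover have "act V (c *s x) v = ten_scale c (act V x v)" for c x
    proof (rule lin_on_Cn_eq[OF lin _ _ that])
      show "ten_linear (Cn n) (\<lambda>v. ten_scale c (act V x v))"
        using lin by (simp add: lin_on_def ten.scale_right_distrib mult.commute)
      fix xs :: "'g list" assume "length xs = n"
      then show "act V (c *s x) (embw xs) = ten_scale c (act V x (embw xs))"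
        using lin_form_der[of xs, OF embw_mlin] by (simp add: std_act_embw[OF V] lin_form_def ten_scale_def)
    qed
    ultimately show ?thesis by (simp add: lin_on_def)
  qed
  have bracket: "act V (brk x y) v = act V x (act V y v) - act V y (act V x v)" if "v \<in> Cn n" for x y v
  proof (rule lin_on_Cn_eq[OF lin _ _ that])
    show "ten_linear (Cn n) (\<lambda>v. act V x (act V y v) - act V y (act V x v))"
      unfolding lin_on_def
      by (simp add: lin_on_add[OF lin] lin_on_scale[OF lin] C ten.scale_right_diff_distrib algebra_simps)
    fix xs :: "'g list" assume xs: "length xs = n"
    have "act V x (act V y (embw xs)) = (\<lambda>l. der y (der x (\<lambda>ys. embw ys l)) xs)" for x y
    proof -
      obtain L where L: "\<forall>p\<in>set L. length (snd p) = length xs" "\<And>F. der y F xs = combo L F"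
        using der_combo[of xs y] by blast
      have "act V y (embw xs) = combo_ten L"
        unfolding std_act_embw[OF V xs] L(2) combo_ten_def ..
      then show ?thesis using std_act_combo[OF V] L xs by simp
    qed
    then show "act V (brk x y) (embw xs) = act V x (act V y (embw xs)) - act V y (act V x (embw xs))"
      by (intro ext) (simp add: std_act_embw[OF V xs] der_brk[OF embw_mlin])
  qed
  show ?thesis
    unfolding is_rep_def c
  proof (intro conjI)
    show "\<exists>S. finite S \<and> Cn n = ten.span S"
      using Cn_finite_span finite_words by (intro exI[of _ "embw ` words n"]) simp
    show "\<forall>v\<in>Cn n. \<forall>l. length l \<noteq> n \<longrightarrow> v l = 0" using Cn_support by blast
    show "\<forall>x. act V x \<in> Cn n \<rightarrow>\<^sub>E Cn n \<and> ten_linear (Cn n) (act V x)"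
      using V C lin by (auto simp: std_def PiE_def)
    show "\<forall>v\<in>Cn n. lin_on scale ten_scale UNIV (\<lambda>x. act V x v)" using linear by blast
    show "\<forall>x y. \<forall>v\<in>Cn n. act V (brk x y) v = act V x (act V y v) - act V y (act V x v)" using bracket by blast
  qed
qed

section \<open>The interpretation of diagrams computes the multilinear semantics\<close>

text \<open>
  The values on tensors of words determine a linear map, and here they are read off pointwise,
  with \<open>F\<close> the evaluation of tensors at a word \<open>l\<close>.
\<close>

definition realizes :: "tm \<Rightarrow> (('g \<Rightarrow> complex) ten \<Rightarrow> ('g \<Rightarrow> complex) ten) \<Rightarrow> bool" where
  "realizes t f \<longleftrightarrow> f \<in> extensional (Cn (src t)) \<and> ten_linear (Cn (src t)) f \<and>
     (\<forall>xs. length xs = src t \<longrightarrow> f (embw xs) = (\<lambda>l. sem t (\<lambda>ys. embw ys l) xs))"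

lemma realizes_embw: "realizes t f \<Longrightarrow> length xs = src t \<Longrightarrow> f (embw xs) = (\<lambda>l. sem t (\<lambda>ys. embw ys l) xs)"
  by (simp add: realizes_def)

lemma realizes_lin: "realizes t f \<Longrightarrow> ten_linear (Cn (src t)) f"
  by (simp add: realizes_def)

lemma realizes_combo:
  "realizes t f \<Longrightarrow> \<forall>p\<in>set L. length (snd p) = src t \<Longrightarrow>
    f (combo_ten L) = (\<lambda>l. combo L (sem t (\<lambda>ys. embw ys l)))"
  by (rule lin_on_combo[OF realizes_lin realizes_embw])

lemma sem_combo_ten:
  assumes "wf_tm t" "length xs = src t"
  obtains L where "\<forall>p\<in>set L. length (snd p) = tgt t" "\<forall>F. sem t F xs = combo L F"
    "(\<lambda>l. sem t (\<lambda>ys. embw ys l) xs) = combo_ten L"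
  using sem_combo[OF assms] unfolding combo_ten_def by metis

lemma realizes_Cn:
  assumes "wf_tm t" "realizes t f" "v \<in> Cn (src t)"
  shows "f v \<in> Cn (tgt t)"
proof (rule maps_Cn[OF realizes_lin[OF assms(2)] _ assms(3)])
  fix xs :: "'g list" assume xs: "length xs = src t"
  obtain L where "\<forall>p\<in>set L. length (snd p) = tgt t" "\<forall>F. sem t F xs = combo L F" "(\<lambda>l. sem t (\<lambda>ys. embw ys l) xs) = combo_ten L"
    by (rule sem_combo_ten[OF assms(1) xs])
  then show "f (embw xs) \<in> Cn (tgt t)"
    using combo_ten_Cn realizes_embw[OF assms(2) xs] by simp
qed

lemma realizes_equivariant:
  assumes t: "wf_tm t" "realizes t f" and V: "std (src t) V" and W: "std (tgt t) W" and v: "v \<in> Cn (src t)"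
  shows "f (act V x v) = act W x (f v)"
proof (rule lin_on_Cn_eq[OF _ _ _ v])
  note f = realizes_lin[OF t(2)] and fC = realizes_Cn[OF t]
  show "ten_linear (Cn (src t)) (\<lambda>v. f (act V x v))"
    unfolding lin_on_def
    by (simp add: lin_on_add[OF std_lin[OF V]] lin_on_scale[OF std_lin[OF V]] lin_on_add[OF f] lin_on_scale[OF f]
        std_act_Cn[OF V])
  show "ten_linear (Cn (src t)) (\<lambda>v. act W x (f v))"
    unfolding lin_on_def
    by (simp add: lin_on_add[OF f] lin_on_scale[OF f] fC lin_on_add[OF std_lin[OF W]] lin_on_scale[OF std_lin[OF W]])
  fix xs :: "'g list" assume xs: "length xs = src t"
  obtain L where L: "\<forall>p\<in>set L. length (snd p) = length xs" "\<And>F. der x F xs = combo L F"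
    using der_combo[of xs x] by blast
  have "act V x (embw xs) = combo_ten L"
    unfolding std_act_embw[OF V xs] L(2) combo_ten_def ..
  then have 1: "f (act V x (embw xs)) = (\<lambda>l. der x (sem t (\<lambda>ys. embw ys l)) xs)"
    using realizes_combo[OF t(2)] L xs by simp
  obtain M where M: "\<forall>p\<in>set M. length (snd p) = tgt t" "\<forall>F. sem t F xs = combo M F"
      "(\<lambda>l. sem t (\<lambda>ys. embw ys l) xs) = combo_ten M"
    by (rule sem_combo_ten[OF t(1) xs])
  have "f (embw xs) = combo_ten M" using realizes_embw[OF t(2) xs] M(3) by (rule HOL.trans)
  then have 2: "act W x (f (embw xs)) = (\<lambda>l. sem t (der x (\<lambda>ys. embw ys l)) xs)"
    unfolding M(2)[rule_format] using std_act_combo[OF W M(1)] by simp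
  show "f (act V x (embw xs)) = act W x (f (embw xs))"
    unfolding 1 2 using sem_der[OF t(1) embw_mlin xs] by simp
qed

lemma realizes_unique:
  assumes "sem_eq s t" "realizes s f" "realizes t g"
  shows "f = g"
proof (rule lin_on_Cn_ext[of _ "src s"])
  have st: "src t = src s" using assms(1) by (simp add: sem_eq_def)
  show "f \<in> extensional (Cn (src s))" "g \<in> extensional (Cn (src s))"
    "ten_linear (Cn (src s)) f" "ten_linear (Cn (src s)) g"
    using assms(2,3) by (simp_all add: realizes_def st)
  fix xs :: "'g list" assume xs: "length xs = src s"
  have "sem s (\<lambda>ys. embw ys l) xs = sem t (\<lambda>ys. embw ys l) xs" for l
    using assms(1) embw_mlin xs by (simp add: sem_eq_def)
  then show "f (embw xs) = g (embw xs)"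
    using realizes_embw[OF assms(2) xs] realizes_embw[OF assms(3), of xs] xs st by simp
qed

lemma lift_realizes:
  assumes \<beta>: "bilin_Cn m n \<beta>" and t: "src t = m + n"
    and gen: "\<And>xs ys. length xs = m \<Longrightarrow> length ys = n \<Longrightarrow>
      \<beta> (embw xs) (embw ys) = (\<lambda>l. sem t (\<lambda>zs. embw zs l) (xs @ ys))"
  shows "realizes t (lift (Phi_obj m) (Phi_obj n) \<beta>)"
proof -
  note L = lift_Cn[OF car_Phi_obj(2,1,1) \<beta>]
  have "lift (Phi_obj m) (Phi_obj n) \<beta> (embw zs) = (\<lambda>l. sem t (\<lambda>ys. embw ys l) zs)" if "length zs = m + n" for zs
    using L(4)[of "take m zs" "drop m zs"] gen[of "take m zs" "drop m zs"] that by simp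
  then show ?thesis unfolding realizes_def t using L(1,2) by blast
qed

lemma tens_adj: "tens_rep adj_rep adj_rep = Phi_obj 2"
  unfolding adj_Phi_obj tens_Phi_obj one_add_one ..

lemma Phi_GM: "\<exists>f. Phi_m = Intw (Phi_obj 2) (Phi_obj 1) f \<and> realizes GM f"
proof (intro exI conjI)
  show "Phi_m = Intw (Phi_obj 2) (Phi_obj 1) (lift (Phi_obj 1) (Phi_obj 1) (\<lambda>a b. emb (brk (unemb a) (unemb b))))"
    unfolding Phi_m_def tens_adj unfolding adj_Phi_obj ..
  show "realizes GM (lift (Phi_obj 1) (Phi_obj 1) (\<lambda>a b. emb (brk (unemb a) (unemb b))))"
  proof (rule lift_realizes)
    show "bilin_Cn 1 1 (\<lambda>a b. emb (brk (unemb a) (unemb b)))"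
      unfolding bilin_Cn_def Cn_1
      by (auto simp: lin_on_def emb_add[symmetric] emb_scale[symmetric] brk_add brk_scale)
    fix xs ys :: "'g list" assume "length xs = 1" "length ys = 1"
    then obtain a b where "xs = [a]" "ys = [b]" using length_1_cases[of xs] length_1_cases[of ys] by auto
    then show "emb (brk (unemb (embw xs)) (unemb (embw ys))) = (\<lambda>l. sem GM (\<lambda>zs. embw zs l) (xs @ ys))"
      by (simp add: embw_single del: embw.simps)
  qed simp
qed

lemma Phi_GS: "\<exists>f. Phi_s = Intw (Phi_obj 2) (Phi_obj 2) f \<and> realizes GS f"
proof (intro exI conjI)
  show "Phi_s = Intw (Phi_obj 2) (Phi_obj 2) (lift (Phi_obj 1) (Phi_obj 1) (\<lambda>a b. tprod 1 b a))"
    unfolding Phi_s_def tens_adj unfolding adj_Phi_obj ..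
  show "realizes GS (lift (Phi_obj 1) (Phi_obj 1) (\<lambda>a b. tprod 1 b a))"
  proof (rule lift_realizes)
    show "bilin_Cn 1 1 (\<lambda>a b. tprod 1 b a)"
      unfolding bilin_Cn_def lin_on_def
      by (simp add: tprod_add_left tprod_add_right tprod_scale_left tprod_scale_right)
    fix xs ys :: "'g list" assume "length xs = 1" "length ys = 1"
    then obtain a b where ab: "xs = [a]" "ys = [b]" using length_1_cases[of xs] length_1_cases[of ys] by auto
    have "tprod 1 (embw [b]) (embw [a]) = embw [b, a]"
      using embw_append[of "[b]" "[a]"] by simp
    then show "tprod 1 (embw ys) (embw xs) = (\<lambda>l. sem GS (\<lambda>zs. embw zs l) (xs @ ys))"
      unfolding ab by simp
  qed simp
qed

lemma Phi_GEps: "\<exists>f. Phi_eps = Intw (Phi_obj 2) (Phi_obj 0) f \<and> realizes GEps f"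
proof (intro exI conjI)
  let ?\<beta> = "\<lambda>a b. ten_scale (killing (unemb a) (unemb b)) ten_one"
  show "Phi_eps = Intw (Phi_obj 2) (Phi_obj 0) (lift (Phi_obj 1) (Phi_obj 1) ?\<beta>)"
    unfolding Phi_eps_def tens_adj unit_Phi_obj unfolding adj_Phi_obj ..
  show "realizes GEps (lift (Phi_obj 1) (Phi_obj 1) ?\<beta>)"
  proof (rule lift_realizes)
    show "bilin_Cn 1 1 ?\<beta>"
      unfolding bilin_Cn_def Cn_1
      by (auto simp: lin_on_def emb_add[symmetric] emb_scale[symmetric] killing_add killing_scale ten.scale_left_distrib)
    fix xs ys :: "'g list" assume "length xs = 1" "length ys = 1"
    then obtain a b where "xs = [a]" "ys = [b]" using length_1_cases[of xs] length_1_cases[of ys] by auto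
    then show "?\<beta> (embw xs) (embw ys) = (\<lambda>l. sem GEps (\<lambda>zs. embw zs l) (xs @ ys))"
      by (simp add: embw_single ten_scale_def del: embw.simps(2))
  qed simp
qed

lemma Phi_GEta: "\<exists>f. Phi_eta = Intw (Phi_obj 0) (Phi_obj 2) f \<and> realizes GEta f"
proof (intro exI conjI)
  let ?w = "\<Sum>b\<in>Basis. tprod 1 (emb b) (emb (dual_vec b))"
  let ?f = "restrict (\<lambda>v. ten_scale (v []) ?w) (Cn 0)"
  show "Phi_eta = Intw (Phi_obj 0) (Phi_obj 2) ?f"
    unfolding Phi_eta_def tens_adj unit_Phi_obj car_Phi_obj ..
  have "tprod 1 (emb b) (emb b') = embw [b, b']" for b b'
    using embw_append[of "[b]" "[b']"] embw_single by simp
  then have w: "?w l = (\<Sum>b\<in>Basis. embw [b, dual_vec b] l)" for l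
    by (simp add: sum_fun_apply)
  have "ten_one \<in> Cn 0" using embw_Cn[of "[]" 0] by simp
  then have "?f (embw []) = ?w" by (simp add: ten_one_def)
  then have "?f (embw []) = (\<lambda>l. sem GEta (\<lambda>ys. embw ys l) [])"
    using w by (intro ext) (simp only: sem.simps)
  moreover have "ten_linear (Cn 0) ?f"
    using ten.subspace_add[OF Cn_subspace] ten.subspace_scale[OF Cn_subspace]
    by (simp add: lin_on_def ten.scale_left_distrib) (simp add: ten_scale_def)
  ultimately show "realizes GEta ?f" by (simp add: realizes_def)
qed

lemma Phi_tm_simps:
  "Phi_tm (Id n) = idm gmod (Phi_obj n)" "Phi_tm GM = Phi_m" "Phi_tm GS = Phi_s" "Phi_tm GEta = Phi_eta"
  "Phi_tm GEps = Phi_eps" "Phi_tm (Zero m n) = zer gmod (Phi_obj m) (Phi_obj n)"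
  "Phi_tm (a \<boxplus> b) = add gmod (Phi_tm a) (Phi_tm b)" "Phi_tm (c \<odot> a) = scl gmod c (Phi_tm a)"
  "Phi_tm (b \<cdot> a) = cmp gmod (Phi_tm b) (Phi_tm a)" "Phi_tm (a \<boxtimes> b) = tmo gmod (Phi_tm a) (Phi_tm b)"
  by (simp_all add: Phi_tm_def Phi_obj_def)

lemma gmod_Phi_obj:
  "idm gmod (Phi_obj n) = Intw (Phi_obj n) (Phi_obj n) (restrict (\<lambda>v. v) (Cn n))"
  "zer gmod (Phi_obj m) (Phi_obj n) = Intw (Phi_obj m) (Phi_obj n) (restrict (\<lambda>v. 0) (Cn m))"
  "add gmod (Intw (Phi_obj m) (Phi_obj n) f) (Intw (Phi_obj m) (Phi_obj n) g) =
     Intw (Phi_obj m) (Phi_obj n) (restrict (\<lambda>v. f v + g v) (Cn m))"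
  "scl gmod c (Intw (Phi_obj m) (Phi_obj n) f) = Intw (Phi_obj m) (Phi_obj n) (restrict (\<lambda>v. ten_scale c (f v)) (Cn m))"
  "cmp gmod (Intw (Phi_obj n) (Phi_obj k) g) (Intw (Phi_obj m) (Phi_obj n) f) =
     Intw (Phi_obj m) (Phi_obj k) (compose (Cn m) g f)"
  "tmo gmod (Intw (Phi_obj m) (Phi_obj n) f) (Intw (Phi_obj m') (Phi_obj n') g) =
     Intw (Phi_obj (m + m')) (Phi_obj (n + n')) (lift (Phi_obj m) (Phi_obj m') (\<lambda>v w. tprod n (f v) (g w)))"
  by (simp_all add: gmod_def tens_Phi_obj)

lemma Phi_tm_realizes:
  "wf_tm t \<Longrightarrow> \<exists>f. Phi_tm t = Intw (Phi_obj (src t)) (Phi_obj (tgt t)) f \<and> realizes t f"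
proof (induction t)
  case (Id n)
  have "realizes (Id n) (restrict (\<lambda>v. v) (Cn n))"
    using ten.subspace_add[OF Cn_subspace] ten.subspace_scale[OF Cn_subspace]
    by (simp add: realizes_def lin_on_def embw_Cn)
  then show ?case
    by (simp add: Phi_tm_simps gmod_Phi_obj)
next
  case GM then show ?case using Phi_GM by (simp add: Phi_tm_simps)
next
  case GS then show ?case using Phi_GS by (simp add: Phi_tm_simps)
next
  case GEta then show ?case using Phi_GEta by (simp add: Phi_tm_simps)
next
  case GEps then show ?case using Phi_GEps by (simp add: Phi_tm_simps)
next
  case (Zero m n)
  have "realizes (Zero m n) (restrict (\<lambda>v. 0) (Cn m))"
    using ten.subspace_add[OF Cn_subspace] ten.subspace_scale[OF Cn_subspace]
    by (simp add: realizes_def lin_on_def embw_Cn zero_fun_def[symmetric])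
  then show ?case
    by (simp add: Phi_tm_simps gmod_Phi_obj)
next
  case (Add a b)
  have wf: "wf_tm a" "wf_tm b" and s: "src b = src a" "tgt b = tgt a" using Add.prems by auto
  obtain f where f: "Phi_tm a = Intw (Phi_obj (src a)) (Phi_obj (tgt a)) f" "realizes a f"
    using Add.IH(1)[OF wf(1)] by blast
  obtain g where g: "Phi_tm b = Intw (Phi_obj (src a)) (Phi_obj (tgt a)) g" "realizes b g"
    using Add.IH(2)[OF wf(2)] unfolding s by blast
  let ?h = "restrict (\<lambda>v. f v + g v) (Cn (src a))"
  have "Phi_tm (a \<boxplus> b) = Intw (Phi_obj (src a)) (Phi_obj (tgt a)) ?h"
    unfolding Phi_tm_simps f(1) g(1) by (rule gmod_Phi_obj)
  moreover have "realizes (a \<boxplus> b) ?h"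
    unfolding realizes_def src.simps
  proof (intro conjI allI impI)
    show "?h \<in> extensional (Cn (src a))" by simp
    have "ten_linear (Cn (src a)) f" "ten_linear (Cn (src a)) g"
      using realizes_lin[OF f(2)] realizes_lin[OF g(2)] unfolding s .
    then show "ten_linear (Cn (src a)) ?h"
      using ten.subspace_add[OF Cn_subspace] ten.subspace_scale[OF Cn_subspace]
      by (simp add: lin_on_def ten.scale_right_distrib)
    fix xs :: "'g list" assume xs: "length xs = src a"
    show "?h (embw xs) = (\<lambda>l. sem (a \<boxplus> b) (\<lambda>ys. embw ys l) xs)"
      using realizes_embw[OF f(2) xs] realizes_embw[OF g(2), of xs] xs s by (intro ext) (simp add: embw_Cn)
  qed
  ultimately show ?case unfolding src.simps tgt.simps by blast
next
  case (Scal c a)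
  have wf: "wf_tm a" using Scal.prems by simp
  obtain f where f: "Phi_tm a = Intw (Phi_obj (src a)) (Phi_obj (tgt a)) f" "realizes a f"
    using Scal.IH[OF wf] by blast
  let ?h = "restrict (\<lambda>v. ten_scale c (f v)) (Cn (src a))"
  have "Phi_tm (c \<odot> a) = Intw (Phi_obj (src a)) (Phi_obj (tgt a)) ?h"
    unfolding Phi_tm_simps f(1) by (rule gmod_Phi_obj)
  moreover have "realizes (c \<odot> a) ?h"
    unfolding realizes_def src.simps
  proof (intro conjI allI impI)
    show "?h \<in> extensional (Cn (src a))" by simp
    show "ten_linear (Cn (src a)) ?h"
      using realizes_lin[OF f(2)] ten.subspace_add[OF Cn_subspace] ten.subspace_scale[OF Cn_subspace]
      by (simp add: lin_on_def ten.scale_right_distrib mult.commute)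
    fix xs :: "'g list" assume xs: "length xs = src a"
    show "?h (embw xs) = (\<lambda>l. sem (c \<odot> a) (\<lambda>ys. embw ys l) xs)"
      using realizes_embw[OF f(2) xs] xs by (intro ext) (simp add: embw_Cn ten_scale_def)
  qed
  ultimately show ?case unfolding src.simps tgt.simps by blast
next
  case (Comp b a)
  have wf: "wf_tm a" "wf_tm b" and m: "src b = tgt a" using Comp.prems by auto
  obtain f where f: "Phi_tm a = Intw (Phi_obj (src a)) (Phi_obj (tgt a)) f" "realizes a f"
    using Comp.IH(2)[OF wf(1)] by blast
  obtain g where g: "Phi_tm b = Intw (Phi_obj (tgt a)) (Phi_obj (tgt b)) g" "realizes b g"
    using Comp.IH(1)[OF wf(2)] unfolding m by blast
  let ?h = "compose (Cn (src a)) g f"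
  have "Phi_tm (b \<cdot> a) = Intw (Phi_obj (src a)) (Phi_obj (tgt b)) ?h"
    unfolding Phi_tm_simps f(1) g(1) by (rule gmod_Phi_obj)
  moreover have "realizes (b \<cdot> a) ?h"
    unfolding realizes_def
  proof (intro conjI allI impI)
    show "?h \<in> extensional (Cn (src (b \<cdot> a)))" by simp
    have fl: "ten_linear (Cn (src a)) f" and gl: "ten_linear (Cn (tgt a)) g"
      using f(2) g(2) m by (simp_all add: realizes_def)
    have fC: "f v \<in> Cn (tgt a)" if "v \<in> Cn (src a)" for v using realizes_Cn[OF wf(1) f(2) that] .
    show "ten_linear (Cn (src (b \<cdot> a))) ?h"
      unfolding lin_on_def
      by (simp add: compose_def ten.subspace_add[OF Cn_subspace] ten.subspace_scale[OF Cn_subspace]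
         lin_on_add[OF fl] lin_on_scale[OF fl] lin_on_add[OF gl] lin_on_scale[OF gl] fC)
    fix xs :: "'g list" assume "length xs = src (b \<cdot> a)"
    then have xs: "length xs = src a" by simp
    obtain M where M: "\<forall>p\<in>set M. length (snd p) = tgt a" "\<forall>F. sem a F xs = combo M F"
        "(\<lambda>l. sem a (\<lambda>ys. embw ys l) xs) = combo_ten M"
      by (rule sem_combo_ten[OF wf(1) xs])
    have "?h (embw xs) = g (combo_ten M)"
      using xs by (simp add: compose_def embw_Cn realizes_embw[OF f(2)] M(3))
    also have "\<dots> = (\<lambda>l. combo M (sem b (\<lambda>ys. embw ys l)))"
      using M(1) m by (intro realizes_combo[OF g(2)]) simp
    finally show "?h (embw xs) = (\<lambda>l. sem (b \<cdot> a) (\<lambda>ys. embw ys l) xs)" by (simp add: M(2)[rule_format])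
  qed
  ultimately show ?case unfolding src.simps tgt.simps by blast
next
  case (Tens a b)
  have wf: "wf_tm a" "wf_tm b" using Tens.prems by auto
  obtain f where f: "Phi_tm a = Intw (Phi_obj (src a)) (Phi_obj (tgt a)) f" "realizes a f"
    using Tens.IH(1)[OF wf(1)] by blast
  obtain g where g: "Phi_tm b = Intw (Phi_obj (src b)) (Phi_obj (tgt b)) g" "realizes b g"
    using Tens.IH(2)[OF wf(2)] by blast
  let ?\<beta> = "\<lambda>v w. tprod (tgt a) (f v) (g w)"
  have fl: "ten_linear (Cn (src a)) f" and gl: "ten_linear (Cn (src b)) g"
    using f(2) g(2) by (simp_all add: realizes_def)
  have "Phi_tm (a \<boxtimes> b) = Intw (Phi_obj (src a + src b)) (Phi_obj (tgt a + tgt b)) (lift (Phi_obj (src a)) (Phi_obj (src b)) ?\<beta>)"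
    unfolding Phi_tm_simps f(1) g(1) by (rule gmod_Phi_obj)
  moreover have "realizes (a \<boxtimes> b) (lift (Phi_obj (src a)) (Phi_obj (src b)) ?\<beta>)"
  proof (rule lift_realizes)
    show "bilin_Cn (src a) (src b) ?\<beta>"
      unfolding bilin_Cn_def lin_on_def
      by (simp add: lin_on_add[OF fl] lin_on_scale[OF fl] lin_on_add[OF gl] lin_on_scale[OF gl]
        tprod_add_left tprod_add_right tprod_scale_left tprod_scale_right)
    fix xs ys :: "'g list" assume l: "length xs = src a" "length ys = src b"
    show "tprod (tgt a) (f (embw xs)) (g (embw ys)) = (\<lambda>l. sem (a \<boxtimes> b) (\<lambda>zs. embw zs l) (xs @ ys))"
    proof
      fix k
      have "sem (a \<boxtimes> b) (\<lambda>zs. embw zs k) (xs @ ys) = sem a (\<lambda>us. sem b (\<lambda>vs. embw (us @ vs) k) ys) xs"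
        using l by simp
      also have "\<dots> = sem a (\<lambda>us. sem b (\<lambda>vs. embw vs (drop (tgt a) k)) ys * embw us (take (tgt a) k)) xs"
      proof (rule sem_cong[OF wf(1) l(1)])
        fix us :: "'g list" assume us: "length us = tgt a"
        have "sem b (\<lambda>vs. embw (us @ vs) k) ys = sem b (\<lambda>vs. embw us (take (tgt a) k) * embw vs (drop (tgt a) k)) ys"
          by (rule sem_cong[OF wf(2) l(2)]) (simp add: embw_append us tprod_def)
        then show "sem b (\<lambda>vs. embw (us @ vs) k) ys = sem b (\<lambda>vs. embw vs (drop (tgt a) k)) ys * embw us (take (tgt a) k)"
          by (simp add: sem_scale[OF wf(2) l(2)])
      qed
      also have "\<dots> = sem b (\<lambda>vs. embw vs (drop (tgt a) k)) ys * sem a (\<lambda>us. embw us (take (tgt a) k)) xs"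
        by (rule sem_scale[OF wf(1) l(1)])
      finally show "tprod (tgt a) (f (embw xs)) (g (embw ys)) k = sem (a \<boxtimes> b) (\<lambda>zs. embw zs k) (xs @ ys)"
        by (simp add: tprod_def realizes_embw[OF f(2) l(1)] realizes_embw[OF g(2) l(2)])
    qed
  qed simp
  ultimately show ?case unfolding src.simps tgt.simps by blast
qed

lemma Phi_tm_eq: "sem_eq s t \<Longrightarrow> Phi_tm s = Phi_tm t"
proof -
  assume e: "sem_eq s t"
  obtain f where f: "Phi_tm s = Intw (Phi_obj (src s)) (Phi_obj (tgt s)) f" "realizes s f"
    using Phi_tm_realizes[of s] e by (auto simp: sem_eq_def)
  obtain g where g: "Phi_tm t = Intw (Phi_obj (src t)) (Phi_obj (tgt t)) g" "realizes t g"
    using Phi_tm_realizes[of t] e by (auto simp: sem_eq_def)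
  show ?thesis using realizes_unique[OF e f(2) g(2)] f(1) g(1) e by (simp add: sem_eq_def)
qed

lemma Phi_tm_hom:
  assumes "t \<in> tms m n"
  shows "Phi_tm t \<in> hom gmod (Phi_obj m) (Phi_obj n)"
proof -
  have t: "wf_tm t" "src t = m" "tgt t = n" using assms by (simp_all add: tms_def)
  obtain f where f: "Phi_tm t = Intw (Phi_obj m) (Phi_obj n) f" "realizes t f"
    using Phi_tm_realizes[OF t(1)] t by auto
  have "f \<in> Cn m \<rightarrow>\<^sub>E Cn n" using realizes_Cn[OF t(1) f(2)] f(2) t by (auto simp: realizes_def PiE_def)
  moreover have "ten_linear (Cn m) f" using f(2) t by (simp add: realizes_def)
  moreover have "f (act (Phi_obj m) x v) = act (Phi_obj n) x (f v)" if "v \<in> Cn m" for x v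
    using realizes_equivariant[OF t(1) f(2), of "Phi_obj m" "Phi_obj n" v x] std_Phi_obj that t by simp
  ultimately show ?thesis unfolding f(1) by (simp add: gmod_def)
qed

end

section \<open>Factorisation through the quotient\<close>

lemma cls_eqI: "tm_cong R a b \<Longrightarrow> cls (tm_cong R) a = cls (tm_cong R) b"
  unfolding cls_def by (blast intro: tm_cong.trans tm_cong.sym)

lemma cls_memI: "a \<in> tms m n \<Longrightarrow> a \<in> cls (tm_cong R) a"
  unfolding cls_def by (blast intro: tm_cong.refl)

lemma cls_memD: "b \<in> cls (tm_cong R) a \<Longrightarrow> tm_cong R a b"
  by (simp add: cls_def)

text \<open>
  The operations of a quotient category are unions over all representatives. If the operation
  respects the congruence, all members of the union are the same class.
\<close>

lemma UN_cls2:
  assumes "a \<in> tms m n" "b \<in> tms k l"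
    and "\<And>a' b'. tm_cong R a a' \<Longrightarrow> tm_cong R b b' \<Longrightarrow> tm_cong R (g a b) (g a' b')"
  shows "(\<Union>p\<in>cls (tm_cong R) a. \<Union>q\<in>cls (tm_cong R) b. cls (tm_cong R) (g p q)) = cls (tm_cong R) (g a b)"
proof -
  have "cls (tm_cong R) (g p q) = cls (tm_cong R) (g a b)" if "p \<in> cls (tm_cong R) a" "q \<in> cls (tm_cong R) b" for p q
    using cls_eqI[OF assms(3)[OF cls_memD[OF that(1)] cls_memD[OF that(2)]]] by simp
  moreover have "cls (tm_cong R) a \<noteq> {}" "cls (tm_cong R) b \<noteq> {}"
    using cls_memI[OF assms(1)] cls_memI[OF assms(2)] by blast+
  ultimately show ?thesis by (simp add: SUP_eq_const)
qed

lemma UN_cls1: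
  assumes "a \<in> tms m n" and "\<And>a'. tm_cong R a a' \<Longrightarrow> tm_cong R (g a) (g a')"
  shows "(\<Union>p\<in>cls (tm_cong R) a. cls (tm_cong R) (g p)) = cls (tm_cong R) (g a)"
proof -
  have "cls (tm_cong R) (g p) = cls (tm_cong R) (g a)" if "p \<in> cls (tm_cong R) a" for p
    using cls_eqI[OF assms(2)[OF cls_memD[OF that]]] by simp
  moreover have "cls (tm_cong R) a \<noteq> {}" using cls_memI[OF assms(1)] by blast
  ultimately show ?thesis by (simp add: SUP_eq_const)
qed

abbreviation cT :: "complex \<Rightarrow> tm \<Rightarrow> tm set" where
  "cT \<delta> \<equiv> cls (tm_cong (T_rels \<delta>))"

lemma T_cat_simps:
  "obj (T_cat \<delta>) = UNIV" "hom (T_cat \<delta>) m n = cT \<delta> ` tms m n" "idm (T_cat \<delta>) n = cT \<delta> (Id n)"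
  "zer (T_cat \<delta>) m n = cT \<delta> (Zero m n)" "tob (T_cat \<delta>) m n = m + n"
  by (simp_all add: T_cat_def quot_def tm_cat_def)

lemma T_cat_add:
  "a \<in> tms m n \<Longrightarrow> b \<in> tms m n \<Longrightarrow> lmcat.add (T_cat \<delta>) (cT \<delta> a) (cT \<delta> b) = cT \<delta> (a \<boxplus> b)"
  unfolding T_cat_def quot_def tm_cat_def lmcat.simps
  by (rule UN_cls2) (auto intro: tm_cong.add_cong simp: tms_def)

lemma T_cat_scl: "a \<in> tms m n \<Longrightarrow> lmcat.scl (T_cat \<delta>) c (cT \<delta> a) = cT \<delta> (c \<odot> a)"
  unfolding T_cat_def quot_def tm_cat_def lmcat.simps
  by (rule UN_cls1) (auto intro: tm_cong.scal_cong)

lemma T_cat_cmp: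
  "a \<in> tms m n \<Longrightarrow> b \<in> tms n k \<Longrightarrow> cmp (T_cat \<delta>) (cT \<delta> b) (cT \<delta> a) = cT \<delta> (b \<cdot> a)"
  unfolding T_cat_def quot_def tm_cat_def lmcat.simps
  by (rule UN_cls2) (auto intro: tm_cong.comp_cong simp: tms_def)

lemma T_cat_tmo:
  "a \<in> tms m n \<Longrightarrow> b \<in> tms k l \<Longrightarrow> tmo (T_cat \<delta>) (cT \<delta> a) (cT \<delta> b) = cT \<delta> (a \<boxtimes> b)"
  unfolding T_cat_def quot_def tm_cat_def lmcat.simps
  by (rule UN_cls2) (auto intro: tm_cong.tens_cong)

lemma T_cat_diff:
  "a \<in> tms m n \<Longrightarrow> b \<in> tms m n \<Longrightarrow> diff (T_cat \<delta>) (cT \<delta> a) (cT \<delta> b) = cT \<delta> (a \<boxplus> (-1) \<odot> b)"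
  unfolding diff_def by (simp add: T_cat_scl T_cat_add[of _ m n] tms_def)

lemma EL_rels_types: "(l, r) \<in> EL_rels \<delta> \<Longrightarrow> \<exists>m n. l \<in> tms m n \<and> r \<in> tms m n"
  unfolding EL_rels_def
  by (auto simp: tms_def D_tm_def K_tm_def H_tm_def T_tm_def S_tm_def tau_tm_def Sigma_tm_def)

context quartic_lie_algebra
begin

lemma T_cong_sound: "tm_cong (T_rels \<delta>) a b \<Longrightarrow> sem_eq a b"
  by (rule tm_cong_sound) (auto intro: T_rels_sound simp: \<delta>)

lemma cT_eqD: "cT \<delta> a = cT \<delta> b \<Longrightarrow> b \<in> tms m n \<Longrightarrow> sem_eq a b"
  using T_cong_sound cls_memD cls_memI by metis

lemma cT_eq_type: "cT \<delta> a = cT \<delta> b \<Longrightarrow> a \<in> tms m n \<Longrightarrow> b \<in> tms k l \<Longrightarrow> a \<in> tms k l"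
  using cT_eqD[of a b k l] by (auto simp: sem_eq_def tms_def)

lemma Phi_mor_cT:
  assumes "t \<in> tms m n" shows "Phi_mor (cT \<delta> t) = Phi_tm t"
proof -
  have "Phi_tm u = Phi_tm t" if "u \<in> cT \<delta> t" for u
    using Phi_tm_eq[OF T_cong_sound[OF cls_memD[OF that]]] by simp
  then have "Phi_tm ` cT \<delta> t = {Phi_tm t}" using cls_memI[OF assms] by blast
  then show ?thesis unfolding Phi_mor_def by simp
qed

text \<open>
  These diagrams are sent to zero by the functor.
\<close>

definition null_tm :: "tm \<Rightarrow> bool" where
  "null_tm t \<longleftrightarrow> (\<forall>F xs. mlin (tgt t) F \<longrightarrow> length xs = src t \<longrightarrow> sem t F xs = 0)"

lemma EL_ideal_null:
  assumes "EL_ideal \<delta> m n f"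
  shows "\<exists>t\<in>tms m n. f = cT \<delta> t \<and> null_tm t"
  using assms unfolding EL_ideal_def
proof (induction rule: tensor_ideal.induct)
  case (gen A B f)
  then obtain l r where lr: "f = diff (T_cat \<delta>) (cT \<delta> l) (cT \<delta> r)" "(l, r) \<in> EL_rels \<delta>" by blast
  obtain m n where mn: "l \<in> tms m n" "r \<in> tms m n" using EL_rels_types[OF lr(2)] by blast
  have f: "f = cT \<delta> (l \<boxplus> (-1) \<odot> r)" unfolding lr(1) by (rule T_cat_diff[OF mn])
  obtain t where t: "t \<in> tms A B" "f = cT \<delta> t" using gen.hyps(3) unfolding T_cat_simps by blast
  have "l \<boxplus> (-1) \<odot> r \<in> tms m n" using mn by (simp add: tms_def)
  moreover have "cT \<delta> (l \<boxplus> (-1) \<odot> r) = cT \<delta> t" using f t(2) by simp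
  ultimately have ty: "l \<boxplus> (-1) \<odot> r \<in> tms A B" using cT_eq_type t(1) by blast
  have "null_tm (l \<boxplus> (-1) \<odot> r)"
    unfolding null_tm_def
  proof (intro allI impI)
    fix F and xs :: "'g list"
    assume "mlin (tgt (l \<boxplus> (-1) \<odot> r)) F" "length xs = src (l \<boxplus> (-1) \<odot> r)"
    then have "sem l F xs = sem r F xs" by (intro EL_rels_sound[OF lr(2)]) simp_all
    then show "sem (l \<boxplus> (-1) \<odot> r) F xs = 0" by simp
  qed
  then show ?case using ty f by blast
next
  case (zero A B)
  have "Zero A B \<in> tms A B" "null_tm (Zero A B)" by (simp_all add: tms_def null_tm_def)
  then show ?case unfolding T_cat_simps by blast
next
  case (add A B f g)
  then obtain s t where s: "s \<in> tms A B" "f = cT \<delta> s" "null_tm s" and t: "t \<in> tms A B" "g = cT \<delta> t" "null_tm t"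
    by blast
  have "s \<boxplus> t \<in> tms A B" "null_tm (s \<boxplus> t)" using s t by (simp_all add: tms_def null_tm_def)
  moreover have "lmcat.add (T_cat \<delta>) f g = cT \<delta> (s \<boxplus> t)"
    unfolding s(2) t(2) by (rule T_cat_add[OF s(1) t(1)])
  ultimately show ?case by blast
next
  case (scl A B f c)
  then obtain s where s: "s \<in> tms A B" "f = cT \<delta> s" "null_tm s" by blast
  have "c \<odot> s \<in> tms A B" "null_tm (c \<odot> s)" using s by (simp_all add: tms_def null_tm_def)
  moreover have "lmcat.scl (T_cat \<delta>) c f = cT \<delta> (c \<odot> s)"
    unfolding s(2) by (rule T_cat_scl[OF s(1)])
  ultimately show ?case by blast
next
  case (comp_left A B f E g)
  then obtain s where s: "s \<in> tms A B" "f = cT \<delta> s" "null_tm s" by blast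
  obtain u where u: "u \<in> tms B E" "g = cT \<delta> u" using comp_left.hyps unfolding T_cat_simps by blast
  have "u \<cdot> s \<in> tms A E" using s u by (simp add: tms_def)
  moreover have "null_tm (u \<cdot> s)"
    using s u sem_mlin[of u] by (simp add: null_tm_def tms_def)
  moreover have "cmp (T_cat \<delta>) g f = cT \<delta> (u \<cdot> s)"
    unfolding s(2) u(2) by (rule T_cat_cmp[OF s(1) u(1)])
  ultimately show ?case by blast
next
  case (comp_right A B f E g)
  then obtain s where s: "s \<in> tms A B" "f = cT \<delta> s" "null_tm s" by blast
  obtain u where u: "u \<in> tms E A" "g = cT \<delta> u" using comp_right.hyps unfolding T_cat_simps by blast
  have "s \<cdot> u \<in> tms E B" using s u by (simp add: tms_def)
  moreover have "null_tm (s \<cdot> u)"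
    unfolding null_tm_def
  proof (intro allI impI)
    fix F and xs :: "'g list" assume F: "mlin (tgt (s \<cdot> u)) F" and "length xs = src (s \<cdot> u)"
    then have wf: "wf_tm u" "length xs = src u" using u by (simp_all add: tms_def)
    have "sem u (sem s F) xs = sem u (\<lambda>_. 0) xs"
      by (rule sem_cong[OF wf]) (use s u F in \<open>simp add: null_tm_def tms_def\<close>)
    then show "sem (s \<cdot> u) F xs = 0" by (simp add: sem_0[OF wf])
  qed
  moreover have "cmp (T_cat \<delta>) f g = cT \<delta> (s \<cdot> u)"
    unfolding s(2) u(2) by (rule T_cat_cmp[OF u(1) s(1)])
  ultimately show ?case by blast
next
  case (tens_left A B f E F' g)
  then obtain s where s: "s \<in> tms A B" "f = cT \<delta> s" "null_tm s" by blast
  obtain u where u: "u \<in> tms E F'" "g = cT \<delta> u" using tens_left.hyps unfolding T_cat_simps by blast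
  have "u \<boxtimes> s \<in> tms (E + A) (F' + B)" using s u by (simp add: tms_def)
  moreover have "null_tm (u \<boxtimes> s)"
    unfolding null_tm_def
  proof (intro allI impI)
    fix F and xs :: "'g list" assume F: "mlin (tgt (u \<boxtimes> s)) F" and l: "length xs = src (u \<boxtimes> s)"
    have wf: "wf_tm u" "length (take (src u) xs) = src u" using u l by (simp_all add: tms_def)
    have "sem u (\<lambda>ys. sem s (\<lambda>zs. F (ys @ zs)) (drop (src u) xs)) (take (src u) xs) = sem u (\<lambda>_. 0) (take (src u) xs)"
    proof (rule sem_cong[OF wf])
      fix ys :: "'g list" assume "length ys = tgt u"
      then have "mlin (tgt s) (\<lambda>zs. F (ys @ zs))" using mlin_append_left[of "tgt u" "tgt s" F ys] F by simp
      then show "sem s (\<lambda>zs. F (ys @ zs)) (drop (src u) xs) = 0"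
        using s(3) l by (simp add: null_tm_def)
    qed
    then show "sem (u \<boxtimes> s) F xs = 0" by (simp add: sem_0[OF wf])
  qed
  moreover have "tmo (T_cat \<delta>) g f = cT \<delta> (u \<boxtimes> s)"
    unfolding s(2) u(2) by (rule T_cat_tmo[OF u(1) s(1)])
  ultimately show ?case unfolding T_cat_simps by blast
next
  case (tens_right A B f E F' g)
  then obtain s where s: "s \<in> tms A B" "f = cT \<delta> s" "null_tm s" by blast
  obtain u where u: "u \<in> tms E F'" "g = cT \<delta> u" using tens_right.hyps unfolding T_cat_simps by blast
  have "s \<boxtimes> u \<in> tms (A + E) (B + F')" using s u by (simp add: tms_def)
  moreover have "null_tm (s \<boxtimes> u)"
    unfolding null_tm_def
  proof (intro allI impI)
    fix F and xs :: "'g list" assume F: "mlin (tgt (s \<boxtimes> u)) F" and l: "length xs = src (s \<boxtimes> u)"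
    have "mlin (tgt s) (\<lambda>ys. sem u (\<lambda>zs. F (ys @ zs)) (drop (src s) xs))"
      by (rule sem_partial_mlin) (use u F l in \<open>simp_all add: tms_def\<close>)
    then show "sem (s \<boxtimes> u) F xs = 0" using s(3) l by (simp add: null_tm_def)
  qed
  moreover have "tmo (T_cat \<delta>) f g = cT \<delta> (s \<boxtimes> u)"
    unfolding s(2) u(2) by (rule T_cat_tmo[OF s(1) u(1)])
  ultimately show ?case unfolding T_cat_simps by blast
qed

text \<open>
  Source and target of a diagram are the same for all members of its class, and the difference
  of congruent diagrams is null.
\<close>

lemma EL_congD:
  assumes E: "EL_cong \<delta> (cT \<delta> s) g" and s: "s \<in> tms m n"
  shows "\<exists>t\<in>tms m n. g = cT \<delta> t \<and> Phi_tm t = Phi_tm s"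
proof -
  obtain A B where AB: "cT \<delta> s \<in> hom (T_cat \<delta>) A B" "g \<in> hom (T_cat \<delta>) A B"
    and I: "EL_ideal \<delta> A B (diff (T_cat \<delta>) (cT \<delta> s) g)"
    using E unfolding EL_cong_def ideal_cong_def by blast
  obtain s' where s': "s' \<in> tms A B" "cT \<delta> s = cT \<delta> s'" using AB(1) unfolding T_cat_simps by blast
  have sA: "s \<in> tms A B" by (rule cT_eq_type[OF s'(2) s s'(1)])
  then have mn: "A = m" "B = n" using s by (auto simp: tms_def)
  obtain t where t: "t \<in> tms m n" "g = cT \<delta> t" using AB(2) unfolding T_cat_simps mn by blast
  obtain u where u: "u \<in> tms m n" "cT \<delta> (s \<boxplus> (-1) \<odot> t) = cT \<delta> u" "null_tm u"
    using EL_ideal_null[OF I] unfolding mn t(2) T_cat_diff[OF s t(1)] by blast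
  have e: "sem_eq (s \<boxplus> (-1) \<odot> t) u" by (rule cT_eqD[OF u(2,1)])
  have "sem_eq t s"
  proof (rule sem_eqI[OF t(1) s])
    fix F and xs :: "'g list" assume F: "mlin n F" "length xs = m"
    have "sem (s \<boxplus> (-1) \<odot> t) F xs = sem u F xs" using e F s by (simp add: sem_eq_def tms_def)
    also have "\<dots> = 0" using u F by (simp add: null_tm_def tms_def)
    finally show "sem t F xs = sem s F xs" by simp
  qed
  then show ?thesis using t Phi_tm_eq by blast
qed

lemma EL_cong_refl:
  assumes s: "s \<in> tms m n" shows "EL_cong \<delta> (cT \<delta> s) (cT \<delta> s)"
proof -
  have "diff (T_cat \<delta>) (cT \<delta> s) (cT \<delta> s) = zer (T_cat \<delta>) m n"
    unfolding T_cat_diff[OF s s] T_cat_simps by (rule cls_eqI[OF tm_cong.add_neg[OF s]])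
  moreover have "EL_ideal \<delta> m n (zer (T_cat \<delta>) m n)"
    unfolding EL_ideal_def by (rule tensor_ideal.zero) (simp_all add: T_cat_simps)
  ultimately show ?thesis
    unfolding EL_cong_def ideal_cong_def using s by (auto simp: T_cat_simps)
qed

abbreviation cE :: "tm \<Rightarrow> tm set set" where
  "cE s \<equiv> cls (EL_cong \<delta>) (cT \<delta> s)"

text \<open>
  Composites, sums and multiples in the quotient are unions over representatives. They are
  described here by the common image of their members, which is the value of the functor on
  the quotient.
\<close>

definition image_of :: "tm set set \<Rightarrow> tm \<Rightarrow> bool" where
  "image_of P s \<longleftrightarrow> P \<noteq> {} \<and> (\<forall>f\<in>P. Phi_mor f = Phi_tm s)"

definition Psi :: "tm set set \<Rightarrow> ('g, 'g \<Rightarrow> complex) intw" where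
  "Psi P = the_elem (Phi_mor ` P)"

lemma Psi_eq: "image_of P s \<Longrightarrow> Psi P = Phi_tm s"
proof -
  assume P: "image_of P s"
  then obtain f where f: "f \<in> P" unfolding image_of_def by blast
  have "Phi_mor ` P = {Phi_tm s}"
  proof
    show "Phi_mor ` P \<subseteq> {Phi_tm s}" using P unfolding image_of_def by blast
    show "{Phi_tm s} \<subseteq> Phi_mor ` P" using P f imageI[OF f, of Phi_mor] unfolding image_of_def by simp
  qed
  then show ?thesis by (simp add: Psi_def)
qed

lemma cE_memD:
  assumes "f \<in> cE s" "s \<in> tms m n"
  shows "\<exists>t\<in>tms m n. f = cT \<delta> t \<and> Phi_tm t = Phi_tm s"
  using assms EL_congD by (simp add: cls_def)

lemma cE_self: "s \<in> tms m n \<Longrightarrow> cT \<delta> s \<in> cE s"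
  using EL_cong_refl by (simp add: cls_def)

lemma image_of_cE:
  assumes "s \<in> tms m n" shows "image_of (cE s) s"
  unfolding image_of_def
proof (intro conjI ballI)
  show "cE s \<noteq> {}" using cE_self[OF assms] by blast
  fix f assume "f \<in> cE s"
  then show "Phi_mor f = Phi_tm s" using cE_memD[OF _ assms] Phi_mor_cT by metis
qed

text \<open>
  For an operation \<open>g\<close> on morphism classes that is computed by an operation
  \<open>h\<close> on diagrams.
\<close>

lemma image_of_UN1:
  assumes s: "s \<in> tms m n"
    and g: "\<And>u. u \<in> tms m n \<Longrightarrow> Phi_tm u = Phi_tm s \<Longrightarrow> g (cT \<delta> u) = cT \<delta> (h u) \<and> h u \<in> tms k l \<and> Phi_tm (h u) = M"
    and M: "Phi_tm (h s) = M"
  shows "image_of (\<Union>p\<in>cE s. cls (EL_cong \<delta>) (g p)) (h s)"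
  unfolding image_of_def
proof (intro conjI ballI)
  have "cT \<delta> (h s) \<in> cls (EL_cong \<delta>) (g (cT \<delta> s))"
    using g[OF s HOL.refl] cE_self by metis
  then show "(\<Union>p\<in>cE s. cls (EL_cong \<delta>) (g p)) \<noteq> {}" using cE_self[OF s] by blast
  fix f assume "f \<in> (\<Union>p\<in>cE s. cls (EL_cong \<delta>) (g p))"
  then obtain p where p: "p \<in> cE s" "f \<in> cls (EL_cong \<delta>) (g p)" by blast
  obtain u where u: "u \<in> tms m n" "p = cT \<delta> u" "Phi_tm u = Phi_tm s" using cE_memD[OF p(1) s] by blast
  note gu = g[OF u(1,3)]
  have "f \<in> cE (h u)" using p(2) gu unfolding u(2) by simp
  then have "Phi_mor f = Phi_tm (h u)" using image_of_cE gu unfolding image_of_def by blast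
  then show "Phi_mor f = Phi_tm (h s)" using gu M by simp
qed

lemma image_of_UN2:
  assumes s: "s \<in> tms m n" and s': "s' \<in> tms m' n'"
    and g: "\<And>u v. u \<in> tms m n \<Longrightarrow> v \<in> tms m' n' \<Longrightarrow> Phi_tm u = Phi_tm s \<Longrightarrow> Phi_tm v = Phi_tm s' \<Longrightarrow>
      g (cT \<delta> u) (cT \<delta> v) = cT \<delta> (h u v) \<and> h u v \<in> tms k l \<and> Phi_tm (h u v) = Phi_tm (h s s')"
  shows "image_of (\<Union>p\<in>cE s. \<Union>q\<in>cE s'. cls (EL_cong \<delta>) (g p q)) (h s s')"
  unfolding image_of_def
proof (intro conjI ballI)
  have "cT \<delta> (h s s') \<in> cls (EL_cong \<delta>) (g (cT \<delta> s) (cT \<delta> s'))"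
    using g[OF s s' HOL.refl HOL.refl] cE_self by metis
  then show "(\<Union>p\<in>cE s. \<Union>q\<in>cE s'. cls (EL_cong \<delta>) (g p q)) \<noteq> {}" using cE_self[OF s] cE_self[OF s'] by blast
  fix f assume "f \<in> (\<Union>p\<in>cE s. \<Union>q\<in>cE s'. cls (EL_cong \<delta>) (g p q))"
  then obtain p q where p: "p \<in> cE s" and q: "q \<in> cE s'" and f: "f \<in> cls (EL_cong \<delta>) (g p q)" by blast
  obtain u where u: "u \<in> tms m n" "p = cT \<delta> u" "Phi_tm u = Phi_tm s" using cE_memD[OF p s] by blast
  obtain v where v: "v \<in> tms m' n'" "q = cT \<delta> v" "Phi_tm v = Phi_tm s'" using cE_memD[OF q s'] by blast
  note gu = g[OF u(1) v(1) u(3) v(3)]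
  have "f \<in> cE (h u v)" using f gu unfolding u(2) v(2) by simp
  then have "Phi_mor f = Phi_tm (h u v)" using image_of_cE gu unfolding image_of_def by blast
  then show "Phi_mor f = Phi_tm (h s s')" using gu by simp
qed

theorem Phi_factors:
  "factors_through (T_cat \<delta>) (EL_cat \<delta>) gmod id (cls (EL_cong \<delta>)) Phi_obj Phi_mor"
  unfolding factors_through_def
proof (intro exI[of _ Phi_obj] exI[of _ Psi] conjI ballI)
  have EL: "obj (EL_cat \<delta>) = UNIV" "hom (EL_cat \<delta>) m n = cE ` tms m n" "idm (EL_cat \<delta>) n = cE (Id n)" for m n
    by (auto simp: EL_cat_def quot_def T_cat_simps image_image)
  have EL_ops:
    "lmcat.scl (EL_cat \<delta>) c P = (\<Union>p\<in>P. cls (EL_cong \<delta>) (lmcat.scl (T_cat \<delta>) c p))"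
    "lmcat.add (EL_cat \<delta>) P Q = (\<Union>p\<in>P. \<Union>q\<in>Q. cls (EL_cong \<delta>) (lmcat.add (T_cat \<delta>) p q))"
    "cmp (EL_cat \<delta>) P Q = (\<Union>p\<in>P. \<Union>q\<in>Q. cls (EL_cong \<delta>) (cmp (T_cat \<delta>) p q))" for c P Q
    by (simp_all add: EL_cat_def quot_def)
  have Psi_cE: "Psi (cE s) = Phi_tm s" if "s \<in> tms m n" for s m n
    by (rule Psi_eq[OF image_of_cE[OF that]])
  show "linear_functor (EL_cat \<delta>) gmod Phi_obj Psi"
    unfolding linear_functor_def
  proof (intro conjI ballI allI)
    fix A
    show "Phi_obj A \<in> obj gmod" using std_is_rep[OF std_Phi_obj] by (simp add: gmod_def)
    have "Id A \<in> tms A A" by (simp add: tms_def)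
    then show "Psi (idm (EL_cat \<delta>) A) = idm gmod (Phi_obj A)"
      unfolding EL using Psi_cE Phi_tm_simps(1) by metis
  next
    fix A B f assume "f \<in> hom (EL_cat \<delta>) A B"
    then obtain s where s: "s \<in> tms A B" "f = cE s" unfolding EL by blast
    show "Psi f \<in> hom gmod (Phi_obj A) (Phi_obj B)"
      unfolding s(2) Psi_cE[OF s(1)] by (rule Phi_tm_hom[OF s(1)])
    show "Psi (lmcat.scl (EL_cat \<delta>) c f) = lmcat.scl gmod c (Psi f)" for c
    proof -
      have "image_of (lmcat.scl (EL_cat \<delta>) c f) (c \<odot> s)"
        unfolding EL_ops s(2)
        by (rule image_of_UN1[OF s(1), where h = "\<lambda>u. c \<odot> u" and M = "Phi_tm (c \<odot> s)" and k = A and l = B])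
          (auto simp: T_cat_scl Phi_tm_simps tms_def)
      then show ?thesis unfolding s(2) Psi_cE[OF s(1)] by (simp add: Psi_eq Phi_tm_simps)
    qed
    show "Psi (lmcat.add (EL_cat \<delta>) f g) = lmcat.add gmod (Psi f) (Psi g)" if "g \<in> hom (EL_cat \<delta>) A B" for g
    proof -
      obtain t where t: "t \<in> tms A B" "g = cE t" using \<open>g \<in> hom (EL_cat \<delta>) A B\<close> unfolding EL by blast
      have "image_of (lmcat.add (EL_cat \<delta>) f g) (s \<boxplus> t)"
        unfolding EL_ops s(2) t(2)
        by (rule image_of_UN2[OF s(1) t(1), where k = A and l = B])
          (auto simp: T_cat_add Phi_tm_simps tms_def)
      then show ?thesis unfolding s(2) t(2) Psi_cE[OF s(1)] Psi_cE[OF t(1)] by (simp add: Psi_eq Phi_tm_simps)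
    qed
    show "Psi (cmp (EL_cat \<delta>) g f) = cmp gmod (Psi g) (Psi f)" if "g \<in> hom (EL_cat \<delta>) B E" for E g
    proof -
      obtain t where t: "t \<in> tms B E" "g = cE t" using \<open>g \<in> hom (EL_cat \<delta>) B E\<close> unfolding EL by blast
      have "image_of (cmp (EL_cat \<delta>) g f) (t \<cdot> s)"
        unfolding EL_ops s(2) t(2)
        by (rule image_of_UN2[OF t(1) s(1), where k = A and l = E])
          (auto simp: T_cat_cmp[of _ A B _ E] Phi_tm_simps tms_def)
      then show ?thesis unfolding s(2) t(2) Psi_cE[OF s(1)] Psi_cE[OF t(1)] by (simp add: Psi_eq Phi_tm_simps)
    qed
  qed
  show "Phi_obj A = Phi_obj (id A)" for A by simp
  fix A B f assume "f \<in> hom (T_cat \<delta>) A B"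
  then obtain s where s: "s \<in> tms A B" "f = cT \<delta> s" unfolding T_cat_simps by blast
  show "Phi_mor f = Psi (cls (EL_cong \<delta>) f)"
    unfolding s(2) Psi_cE[OF s(1)] by (rule Phi_mor_cT[OF s(1)])
qed

end

theorem proposition5p5:
  fixes scale :: "complex \<Rightarrow> 'g::ab_group_add \<Rightarrow> 'g"
    and Basis :: "'g set"
    and brk :: "'g \<Rightarrow> 'g \<Rightarrow> 'g"
    and X :: exceptional
    and \<delta> :: complex
  assumes "complex_lie_algebra scale Basis brk"
    and "complex_lie_algebra.simple scale brk"
    and "complex_lie_algebra.has_cartan_matrix scale Basis brk (cartan_matrix X)"
    and "\<delta> = of_nat (vector_space.dim scale (UNIV :: 'g set))"
  shows "factors_through (T_cat \<delta>) (EL_cat \<delta>) (complex_lie_algebra.gmod scale brk)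
           id (cls (EL_cong \<delta>))
           (complex_lie_algebra.Phi_obj scale brk) (complex_lie_algebra.Phi_mor scale Basis brk)"
proof -
  interpret complex_lie_algebra scale Basis brk by fact
  have "\<delta> = of_nat (card Basis)" using assms(4) by simp
  moreover have "quartic_lie_algebra scale Basis brk (of_nat (card Basis))"
    by (rule exceptional_is_quartic[OF assms(2,3)])
  ultimately show ?thesis by (simp only: quartic_lie_algebra.Phi_factors)
qed

end
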